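(* Let $(\Gamma,\mathbf c)$, $o$, $(r_N)$, $(\Gamma_N,\mathbf c)$, $(\mathcal V_N)$, $(\mathcal T_N)$, the boundary sets $\partial V_N\subset V(\Gamma_N)$, the rates $\{\lambda_\pm(a):a\in\partial V_N\}$, the generator $\mathcal L^{\rm bEX}_{(\Gamma_N,\mathbf c)}$, the densities $\rho_N$ and the flows $i_{\rho_N}$ be as in the context, and let $\phi$ be a local function bundle for vertices (resp. for edges) with associated function $U_{N,\epsilon}$. Let $\mathbb P^N_{\eta^N_0}$ be the law of the boundary-driven exclusion process $(\eta^N_t)_{t\ge0}$ with generator $\mathcal T_N\mathcal L^{\rm bEX}_{(\Gamma_N,\mathbf c)}$, started from the initial configuration $\eta^N_0\in\{0,1\}^{V(\Gamma_N)}$. Assume: (E) $\displaystyle\limsup_{N\to\infty}\frac{|V(\Gamma_N)|}{\mathcal V_N}<\infty$; (BR) there exist $\gamma,\gamma'\in[1,\infty)$ such that for all $N$ and all $a\in\partial V_N$, $\gamma^{-1}\le\frac{\lambda_+(a)}{\lambda_-(a)}\le\gamma$ and $(\gamma')^{-1}\le\frac{\lambda_+(a)}{c_a}\le\gamma'$; (1) $\displaystyle\liminf_{N\to\infty}\frac{\mathcal T_N}{\mathcal V_N}=\infty$; (2) for each $x\in V(\Gamma)$ and each $y,z\in B(x,r_{\epsilon N})$, $\displaystyle\liminf_{\epsilon\downarrow 0}\liminf_{N\to\infty}\frac{\mathcal T_N}{\mathcal V_N}\left(R^{(\Gamma_N,\mathbf c)}_{\rm eff}(y,z)\right)^{-1}=\infty$;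 (3) the sequence of boundary rates is chosen such that $\displaystyle\limsup_{N\to\infty}\frac{\mathcal T_N}{\mathcal V_N}\sum_{a\in\partial V_N}|i_{\rho_N}(a)|<\infty$ and $\displaystyle\limsup_{N\to\infty}\frac{\mathcal T_N}{\mathcal V_N}\,\mathcal E^{\rm el}_{(\Gamma_N,\mathbf c)}(\rho_N)<\infty$. Then for each $T>0$ and each $\delta>0$, $$\limsup_{\epsilon\downarrow0}\ \limsup_{N\to\infty}\ \sup_{\mathsf p}\ \frac1{\mathcal V_N}\log\mathbb P^N_{\eta^N_0}\left\{\left|\int_0^T U_{N,\epsilon}(\mathsf p,\eta^N_t)\,dt\right|>\delta\right\}=-\infty,$$ where the supremum runs over all $\mathsf p=x\in V(\Gamma_N)$ (resp. all $\mathsf p=e\in E(\Gamma_N)$). Also, for each $T>0$, each $\delta>0$ and each continuous function $G:[0,T]\to\mathbb R$, $$\limsup_{N\to\infty}\ \sup_{a\in\partial V_N}\ \frac1{\mathcal V_N}\log\mathbb P^N_{\eta^N_0}\left\{\left|\int_0^T G(t)\left[\eta^N_t(a)-\frac{\lambda_+(a)}{\lambda_+(a)+\lambda_-(a)}\right]dt\right|>\delta\right\}=-\infty.$$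
   Context: Weighted graph: $\Gamma=(V(\Gamma),E(\Gamma))$ is an infinite, undirected, connected, locally finite graph with conductances $\mathbf c=(c_{xy})_{xy\in E(\Gamma)}$, $c_{xy}>0$ ($c_{xy}=0$ if $xy$ is not an edge). $d$ is the graph metric and $B(x,r)=\{y\in V(\Gamma): d(x,y)<r\}$. When an edge $e$ is given a direction, its tail is $\underline e$ and its head is $\overline e$. Exhaustion: fix $o\in V(\Gamma)$ and a monotone increasing sequence of radii $(r_N)_{N\ge1}$, $r_1=1$, $r_N\uparrow\infty$. $\Gamma_N$ is the finite graph with $V(\Gamma_N)=B(o,r_N)$ and $E(\Gamma_N)=\{xy\in E(\Gamma): x,y\in V(\Gamma_N)\}$, with inherited conductances. $(\mathcal V_N)_{N\ge1}$ and $(\mathcal T_N)_{N\ge 1}$ are two increasing sequences of positive real numbers. $\epsilon\in[0,1]$, and in subscripts $\epsilon N$ means the integer part of $\epsilon N$. Energy and resistance on a weighted graph $(G,\mathbf c)$: $\mathcal E^{\rm el}_{(G,\mathbf c)}(h)=\sum_{xw\in E(G)}c_{xw}[h(x)-h(w)]^2$ and $R_{\rm eff}^{(G,\mathbf c)}(y,z)=\left(\inf\{\mathcal E^{\rm el}_{(G,\mathbf c)}(h): h:V(G)\to\mathbb R,\ h(y)=1,\ h(z)=0\}\right)^{-1}$, with $\inf\emptyset=\infty$. Boundary-driven exclusion process: to each $\Gamma_N$ is associated a nonempty boundary set $\partial V_N\subset V(\Gamma_N)$, with $c_{aa'}=0$ for all $a,a'\in\partial V_N$, and rates $\lambda_\pm(a)\in\mathbb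 R_+$, $a\in\partial V_N$. For $a\in\partial V_N$, $c_a=\sum_{y\in V(\Gamma_N)}c_{ay}$. For $f:\{0,1\}^{V(\Gamma_N)}\to\mathbb R$, $\mathcal L^{\rm bEX}_{(\Gamma_N,\mathbf c)}f=\mathcal L^{\rm EX}_{(\Gamma_N,\mathbf c)}f+\mathcal L^{b}_{\partial V_N}f$ with $(\mathcal L^{\rm EX}_{(\Gamma_N,\mathbf c)}f)(\eta)=\sum_{xy\in E(\Gamma_N)}c_{xy}[f(\eta^{xy})-f(\eta)]$ and $(\mathcal L^b_{\partial V_N}f)(\eta)=\sum_{a\in\partial V_N}[\lambda_-(a)\eta(a)+\lambda_+(a)(1-\eta(a))][f(\eta^a)-f(\eta)]$, where $\eta^{xy}$ is $\eta$ with the values at $x,y$ exchanged and $\eta^a$ is $\eta$ with the value at $a$ replaced by $1-\eta(a)$. $\mu^N_{\rm inv}$ is the unique invariant measure of the process generated by $\mathcal L^{\rm bEX}_{(\Gamma_N,\mathbf c)}$, and $\rho_N(x):=E_{\mu^N_{\rm inv}}[\eta(x)]$, $x\in V(\Gamma_N)$; the function $\rho_N$ is harmonic for the graph Laplacian on $V(\Gamma_N)\setminus\partial V_N$. For $h:V(\Gamma_N)\to\mathbb R$ harmonic on $V(\Gamma_N)\setminus\partial V_N$, the flow of $h$ out of $a\in\partial V_N$ is $i_h(a)=\sum_{y\in V(\Gamma_N)}c_{ay}[h(y)-h(a)]$. Local function bundles: $\phi:V(\Gamma)\times\{0,1\}^{V(\Gamma)}\to\mathbb R$ is a local function bundle for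 vertices if there is $r_\phi\in(0,\infty)$ such that for every $x$, $\phi_x:=\phi(x,\cdot)$ depends only on $\{\eta(z):z\in B(x,r_\phi)\}$. $\phi:E(\Gamma)\times\{0,1\}^{V(\Gamma)}\to\mathbb R$ is a local function bundle for edges if there is $r_\phi\in(0,\infty)$ such that for every $e$, $\phi_e:=\phi(e,\cdot)$ depends only on $\{\eta(z):z\in B(\underline e,r_\phi)\}$. Put $\Phi_{\mathsf p}(\alpha):=\int\phi_{\mathsf p}\,d\nu_\alpha$, $\alpha\in[0,1]$, where $\nu_\alpha$ is the product Bernoulli measure with all marginals $\nu_\alpha\{\eta(x)=1\}=\alpha$. For finite $\Lambda$, ${\rm Av}_\Lambda[\eta]:=|\Lambda|^{-1}\sum_{z\in\Lambda}\eta(z)$. Set $U_{N,\epsilon}(\mathsf p,\eta):=\phi_{\mathsf p}(\eta)-\Phi_{\mathsf p}\big({\rm Av}_{B(\mathsf p,r_{\epsilon N})}[\eta]\big)$, with $B(\mathsf p,r)=B(x,r)$ if $\mathsf p=x$ and $B(\underline e,r)$ if $\mathsf p=e$.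
   Formalization: Proved for bundles with uniformly bounded values and numbers of sites (false otherwise); (2) is taken uniformly over x in V(Γ_N), y,z in the ball within Γ_N; the sup runs over p with φ_p defined on Γ_N, averages over the ball within Γ_N; the λ₊/c_a bound is required only if c_a≠0. *)

theory Defs
  imports "HOL-Probability.Probability"
begin

text \<open>
  The vertex set of the infinite graph is the whole type \<^typ>\<open>'v\<close>; \<open>xy\<close> is an edge iff
  its conductance \<open>c x y\<close> is positive.
\<close>

locale weighted_graph =
  fixes c :: "'v \<Rightarrow> 'v \<Rightarrow> real"
  assumes sym: "c x y = c y x"
    and nonneg: "0 \<le> c x y"
    and no_loops: "c x x = 0"
    and locally_finite: "finite {y. 0 < c x y}"
    and connected: "(\<lambda>u v. 0 < c u v)\<^sup>*\<^sup>* x y"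
    and infinite_vertices: "infinite (UNIV :: 'v set)"

definition gdist :: "('v \<Rightarrow> 'v \<Rightarrow> real) \<Rightarrow> 'v \<Rightarrow> 'v \<Rightarrow> nat" where
  "gdist c x y = (LEAST n. ((\<lambda>u v. 0 < c u v) ^^ n) x y)"

definition gball :: "('v \<Rightarrow> 'v \<Rightarrow> real) \<Rightarrow> 'v \<Rightarrow> real \<Rightarrow> 'v set" where
  "gball c x r = {y. real (gdist c x y) < r}"

text \<open>
  The finite graph induced on a finite vertex set \<open>V\<close> is given by \<open>V\<close> itself.
  Sums over its undirected edges are half of the sums over ordered pairs in \<open>V\<close>.
\<close>

definition directed_edges :: "('v \<Rightarrow> 'v \<Rightarrow> real) \<Rightarrow> 'v set \<Rightarrow> ('v \<times> 'v) set" where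
  "directed_edges c V = {(x, y). x \<in> V \<and> y \<in> V \<and> 0 < c x y}"

definition energy :: "'v set \<Rightarrow> ('v \<Rightarrow> 'v \<Rightarrow> real) \<Rightarrow> ('v \<Rightarrow> real) \<Rightarrow> real" where
  "energy V c h = (\<Sum>x\<in>V. \<Sum>w\<in>V. c x w * (h x - h w)\<^sup>2) / 2"

text \<open>
  For \<open>y = z\<close> the infimum is over the empty set, hence \<open>\<infinity>\<close>, and the resistance is \<open>0\<close>,
  whose inverse in \<^typ>\<open>ereal\<close> is again \<open>\<infinity>\<close>.
\<close>

definition R_eff :: "'v set \<Rightarrow> ('v \<Rightarrow> 'v \<Rightarrow> real) \<Rightarrow> 'v \<Rightarrow> 'v \<Rightarrow> ereal" where
  "R_eff V c y z = inverse (INF h\<in>{h. h y = 1 \<and> h z = 0}. ereal (energy V c h))"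

definition site_conductance :: "'v set \<Rightarrow> ('v \<Rightarrow> 'v \<Rightarrow> real) \<Rightarrow> 'v \<Rightarrow> real" where
  "site_conductance V c a = (\<Sum>y\<in>V. c a y)"

definition flow :: "'v set \<Rightarrow> ('v \<Rightarrow> 'v \<Rightarrow> real) \<Rightarrow> ('v \<Rightarrow> real) \<Rightarrow> 'v \<Rightarrow> real" where
  "flow V c h a = (\<Sum>y\<in>V. c a y * (h y - h a))"


text \<open>
  Particle configurations are functions into \<^typ>\<open>bool\<close>. A configuration on a finite vertex
  set \<open>V\<close> is an extensional function, so its values outside \<open>V\<close> carry no information.
\<close>

type_synonym 'v config = "'v \<Rightarrow> bool"

definition configs :: "'v set \<Rightarrow> 'v config set" where
  "configs V = V \<rightarrow>\<^sub>E UNIV"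

definition exchange :: "'v \<Rightarrow> 'v \<Rightarrow> 'v config \<Rightarrow> 'v config" where
  "exchange x y \<eta> = \<eta>(x := \<eta> y, y := \<eta> x)"

definition flip :: "'v \<Rightarrow> 'v config \<Rightarrow> 'v config" where
  "flip a \<eta> = \<eta>(a := \<not> \<eta> a)"

definition L_EX :: "'v set \<Rightarrow> ('v \<Rightarrow> 'v \<Rightarrow> real) \<Rightarrow> ('v config \<Rightarrow> real) \<Rightarrow> 'v config \<Rightarrow> real" where
  "L_EX V c f \<eta> = (\<Sum>x\<in>V. \<Sum>y\<in>V. c x y * (f (exchange x y \<eta>) - f \<eta>)) / 2"

definition L_bdry ::
    "'v set \<Rightarrow> ('v \<Rightarrow> real) \<Rightarrow> ('v \<Rightarrow> real) \<Rightarrow> ('v config \<Rightarrow> real) \<Rightarrow> 'v config \<Rightarrow> real" where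
  "L_bdry bd lamP lamM f \<eta> =
     (\<Sum>a\<in>bd. (lamM a * of_bool (\<eta> a) + lamP a * (1 - of_bool (\<eta> a))) * (f (flip a \<eta>) - f \<eta>))"

definition L_bEX ::
    "'v set \<Rightarrow> ('v \<Rightarrow> 'v \<Rightarrow> real) \<Rightarrow> 'v set \<Rightarrow> ('v \<Rightarrow> real) \<Rightarrow> ('v \<Rightarrow> real)
      \<Rightarrow> ('v config \<Rightarrow> real) \<Rightarrow> 'v config \<Rightarrow> real" where
  "L_bEX V c bd lamP lamM f \<eta> = L_EX V c f \<eta> + L_bdry bd lamP lamM f \<eta>"


text \<open>The semigroup \<open>exp (t L)\<close> of a generator \<open>L\<close> on a finite state space.\<close>

definition semigroup_gen :: "(('s \<Rightarrow> real) \<Rightarrow> 's \<Rightarrow> real) \<Rightarrow> real \<Rightarrow> ('s \<Rightarrow> real) \<Rightarrow> 's \<Rightarrow> real" where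
  "semigroup_gen L t f \<eta> = (\<Sum>n. t ^ n / fact n * (L ^^ n) f \<eta>)"

definition transition_prob :: "(('s \<Rightarrow> real) \<Rightarrow> 's \<Rightarrow> real) \<Rightarrow> real \<Rightarrow> 's \<Rightarrow> 's \<Rightarrow> real" where
  "transition_prob L t \<eta> \<xi> = semigroup_gen L t (indicator {\<xi>}) \<eta>"

definition invariant_measure :: "'s set \<Rightarrow> (('s \<Rightarrow> real) \<Rightarrow> 's \<Rightarrow> real) \<Rightarrow> 's pmf \<Rightarrow> bool" where
  "invariant_measure S L \<mu> \<longleftrightarrow>
     set_pmf \<mu> \<subseteq> S \<and>
     (\<forall>t\<ge>0. \<forall>f. measure_pmf.expectation \<mu> (semigroup_gen L t f) = measure_pmf.expectation \<mu> f)"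

definition density :: "'v config pmf \<Rightarrow> 'v \<Rightarrow> real" where
  "density \<mu> x = measure_pmf.expectation \<mu> (\<lambda>\<eta>. of_bool (\<eta> x))"

text \<open>
  \<open>X\<close> is, on the probability space \<open>M\<close>, the continuous-time Markov chain on the finite state
  space \<open>S\<close> with generator \<open>L\<close> started from \<open>\<eta>0\<close>: its finite-dimensional distributions are the
  Markovian ones and its paths are right-continuous with left limits (in the discrete topology).
  This determines the law of \<open>X\<close> on path space.
\<close>

definition markov_chain_from ::
    "'w measure \<Rightarrow> 's set \<Rightarrow> (('s \<Rightarrow> real) \<Rightarrow> 's \<Rightarrow> real) \<Rightarrow> 's \<Rightarrow> (real \<Rightarrow> 'w \<Rightarrow> 's) \<Rightarrow> bool" where
  "markov_chain_from M S L \<eta>0 X \<longleftrightarrow>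
     prob_space M \<and>
     \<eta>0 \<in> S \<and>
     (\<forall>t\<ge>0. X t \<in> M \<rightarrow>\<^sub>M count_space S) \<and>
     (\<forall>\<omega>\<in>space M. X 0 \<omega> = \<eta>0 \<and>
        (\<forall>t\<ge>0. \<forall>\<^sub>F s in at_right t. X s \<omega> = X t \<omega>) \<and>
        (\<forall>t>0. \<exists>\<eta>. \<forall>\<^sub>F s in at_left t. X s \<omega> = \<eta>)) \<and>
     (\<forall>n (t :: nat \<Rightarrow> real) \<xi>.
        t 0 = 0 \<and> mono t \<and> \<xi> 0 = \<eta>0 \<and> (\<forall>i. \<xi> i \<in> S) \<longrightarrow>
        measure M {\<omega>\<in>space M. \<forall>i\<in>{1..n}. X (t i) \<omega> = \<xi> i} =
          (\<Prod>i<n. transition_prob L (t (Suc i) - t i) (\<xi> i) (\<xi> (Suc i))))"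


definition depends_only_on :: "'v set \<Rightarrow> ('v config \<Rightarrow> real) \<Rightarrow> bool" where
  "depends_only_on A f \<longleftrightarrow> (\<forall>\<eta> \<eta>'. (\<forall>z\<in>A. \<eta> z = \<eta>' z) \<longrightarrow> f \<eta> = f \<eta>')"

definition vertex_bundle :: "('v \<Rightarrow> 'v \<Rightarrow> real) \<Rightarrow> ('v \<Rightarrow> 'v config \<Rightarrow> real) \<Rightarrow> bool" where
  "vertex_bundle c \<phi> \<longleftrightarrow> (\<exists>r>0. \<forall>x. depends_only_on (gball c x r) (\<phi> x))"

text \<open>An edge bundle is indexed by directed edges \<open>(tail, head)\<close>.\<close>

definition edge_bundle :: "('v \<Rightarrow> 'v \<Rightarrow> real) \<Rightarrow> ('v \<times> 'v \<Rightarrow> 'v config \<Rightarrow> real) \<Rightarrow> bool" where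
  "edge_bundle c \<phi> \<longleftrightarrow>
     (\<exists>r>0. \<forall>e\<in>directed_edges c UNIV. depends_only_on (gball c (fst e) r) (\<phi> e))"

text \<open>
  Uniformity of a bundle in its index: uniformly bounded values and a uniformly bounded number
  of relevant sites. Estimates that take a supremum over a growing set of indices are false
  without it. Unbounded values: for \<open>\<phi>\<^sub>x(\<eta>) = A\<^sub>x \<eta>(x)\<close> with \<open>A\<^sub>x\<close> growing fast enough, every
  threshold on the time integral is eventually exceeded. Unboundedly many sites: on a ray with
  \<open>2\<^sup>n\<close> leaves attached at distance \<open>2\<^sup>n\<close> from the root, let \<open>\<phi>\<^sub>x\<close> be the indicator that at most half
  of the neighbours of \<open>x\<close> are occupied.
\<close>

definition uniform_bundle :: "'p set \<Rightarrow> ('p \<Rightarrow> 'v config \<Rightarrow> real) \<Rightarrow> bool" where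
  "uniform_bundle P \<phi> \<longleftrightarrow>
     (\<exists>K :: nat. \<forall>p\<in>P. (\<forall>\<eta>. \<bar>\<phi> p \<eta>\<bar> \<le> real K) \<and>
        (\<exists>A. finite A \<and> card A \<le> K \<and> depends_only_on A (\<phi> p)))"

definition bernoulli_product :: "real \<Rightarrow> 'v config measure" where
  "bernoulli_product \<alpha> = PiM UNIV (\<lambda>_. measure_pmf (bernoulli_pmf \<alpha>))"

definition bernoulli_mean :: "('v config \<Rightarrow> real) \<Rightarrow> real \<Rightarrow> real" where
  "bernoulli_mean f \<alpha> = integral\<^sup>L (bernoulli_product \<alpha>) f"

definition Av :: "'v set \<Rightarrow> 'v config \<Rightarrow> real" where
  "Av A \<eta> = (\<Sum>z\<in>A. of_bool (\<eta> z)) / real (card A)"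

text \<open>
  \<open>f\<close> is the member of the bundle at the index under consideration and \<open>x\<close> its base point
  (the vertex itself, or the tail of the edge). A configuration on \<open>V\<close> has no values
  outside \<open>V\<close>, so the average is over the part of the ball that lies in \<open>V\<close>.
\<close>

definition U_fun ::
    "'v set \<Rightarrow> ('v \<Rightarrow> 'v \<Rightarrow> real) \<Rightarrow> real \<Rightarrow> 'v \<Rightarrow> ('v config \<Rightarrow> real) \<Rightarrow> 'v config \<Rightarrow> real" where
  "U_fun V c r x f \<eta> = f \<eta> - bernoulli_mean f (Av (gball c x r \<inter> V) \<eta>)"

text \<open>The logarithm of a probability, with \<open>log 0 = -\<infinity>\<close>.\<close>

definition elog :: "real \<Rightarrow> ereal" where
  "elog p = (if p \<le> 0 then -\<infinity> else ereal (ln p))"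

end

theory Submission
  imports Defs
begin

text \<open>
  By a Feynman-Kac bound the exponential moments of a time integral are controlled by the top of
  the spectrum of \<open>\<T>\<^sub>N L + W\<close> in \<open>L\<^sup>2(\<nu>)\<close>, where \<open>\<nu>\<close> is the product Bernoulli measure with the
  stationary profile \<open>\<rho>\<^sub>N\<close>; by the maximum principle \<open>\<rho>\<^sub>N\<close> is bounded away from \<open>0\<close> and \<open>1\<close>, so that
  starting from a single configuration costs a factor of at most \<open>e\<^bsup>O(|V|)\<^esup>\<close>. Although \<open>\<nu>\<close> is not
  invariant, stationarity of \<open>\<rho>\<^sub>N\<close> makes all first-order terms of the adjoint \<open>L\<^sup>* 1\<close> cancel, and the
  quadratic form of \<open>L\<close> is minus the Dirichlet form up to \<open>O(energy \<rho>\<^sub>N)\<close>.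

  In the bulk one passes to the exchange-invariant counting measure. There
  \<open>m y z = \<parallel>h \<circ> exchange y z - h\<parallel>\<close> satisfies \<open>m y w \<le> m y x + 2 m x w\<close>, hence \<open>m y\<close> is a test function
  for the effective resistance and \<open>(m y z)\<^sup>2 \<le> 4 R\<^sub>e\<^sub>f\<^sub>f(y,z)\<close> times the Dirichlet form: all exchanges in
  a ball are cheap, and the replacement becomes a mean-field statement, in which \<open>\<eta> a - Av\<close> is an
  average of the differences \<open>\<eta> a - \<eta> z\<close>, each antisymmetric under an exchange. At the boundary
  the flip part of the Dirichlet form is used in the same way.
\<close>

section \<open>Feynman-Kac bounds for finite Markov chains\<close>

text \<open>All errors are calibrated against one free parameter. The potential is multiplied by
  \<open>k * v\<close>, with \<open>v\<close> the scale \<open>\<V> N\<close>. After taking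
  logarithms and dividing by \<open>v\<close> there remain terms bounded independently of
  \<open>k\<close>, the gain \<open>- k * \<delta>\<close>, and errors that grow with
  \<open>k\<close> but become small with the size of the ball or with the accelerated inverse
  resistance. So \<open>k\<close> is fixed by the bound that is wanted, and the other quantities are
  made large afterwards. The cost of the deterministic start is of the first kind by (E), the energy
  cost by (3). The obstacle is that two measures are needed: antisymmetry under an exchange calls
  for an exchange-invariant measure, while the generator has a good form bound in the weight \<nu>.
  The substitution \<open>h = sqrt \<nu> * g\<close> passes between them. The generator is not
  self-adjoint for \<nu>, so an upper bound on its quadratic form has to take the place of spectral
  theory. The invariant measure enters only through its one-site densities. At the boundary the
  strength of the reservoirs comes from the resistance condition for neighbouring sites, which
  forces the accelerated conductance at every site to infinity.\<close>

lemma summable_exp_bound: "summable (\<lambda>n. x ^ n / fact n * (B :: real))"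
 using summable_exp[of x] by (intro summable_mult2) (simp add: field_simps)

lemma suminf_exp_bound: "(\<Sum>n. x ^ n / fact n * (B :: real)) = exp x * B"
 using summable_exp[of x] by (subst suminf_mult2[symmetric]) (simp_all add: exp_def field_simps)

section \<open>Elementary exponential estimates, sums over discrete paths, Riemann sums\<close>

lemma exp_minus_one_le: "exp x - 1 \<le> x * exp x" for x :: real
proof -
 have "1 - x \<le> exp (- x)" using exp_ge_add_one_self[of "- x"] by simp
 then have "(1 - x) * exp x \<le> 1" by (metis exp_ge_zero exp_minus_inverse mult.commute mult_right_mono)
 then show ?thesis by (simp add: algebra_simps)
qed

lemma abs_exp_minus_one_le: "\<bar>exp x - 1\<bar> \<le> \<bar>x\<bar> * exp \<bar>x\<bar>" for x :: real
proof (cases "0 \<le> x")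
 case True
 with exp_minus_one_le[of x] show ?thesis by simp
next
 case False
 then have "1 - exp x \<le> - x" using exp_ge_add_one_self[of x] by linarith
 moreover have "- x * 1 \<le> - x * exp (- x)"
  by (rule mult_left_mono) (use False in auto)
 moreover have "\<bar>exp x - 1\<bar> = 1 - exp x" "\<bar>x\<bar> = - x" using False by auto
 ultimately show ?thesis by simp
qed

lemma abs_exp_linear_le: "\<bar>exp x - 1 - x\<bar> \<le> x^2 * exp \<bar>x\<bar>" for x :: real
proof -
 have "exp x - 1 - x \<le> x * (exp x - 1)" using exp_minus_one_le[of x] by (simp add: algebra_simps)
 also have "... \<le> \<bar>x\<bar> * \<bar>exp x - 1\<bar>" by (metis abs_ge_self abs_mult)
 also have "... \<le> \<bar>x\<bar> * (\<bar>x\<bar> * exp \<bar>x\<bar>)" by (intro mult_left_mono abs_exp_minus_one_le) auto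
 finally have "exp x - 1 - x \<le> x^2 * exp \<bar>x\<bar>"
  by (simp add: power2_eq_square flip: mult.assoc)
 moreover have "0 \<le> exp x - 1 - x" using exp_ge_add_one_self[of x] by linarith
 ultimately show ?thesis by simp
qed

text \<open>Peels the last time off a discrete path; this drives the induction in
  \<open>sum_paths_eq_iterated\<close>.\<close>

lemma sum_PiE_Suc:
 fixes F :: "(nat \<Rightarrow> 's) \<Rightarrow> real"
 shows "(\<Sum>\<xi>\<in>PiE {1..Suc n} (\<lambda>_. S). F \<xi>) = (\<Sum>\<xi>\<in>PiE {1..n} (\<lambda>_. S). \<Sum>s\<in>S. F (\<xi>(Suc n := s)))"
proof -
 have ins: "{1..Suc n} = insert (Suc n) {1..n}" by auto
 have "(\<Sum>\<xi>\<in>PiE {1..Suc n} (\<lambda>_. S). F \<xi>) = (\<Sum>(s, \<xi>)\<in>S \<times> PiE {1..n} (\<lambda>_. S). F (\<xi>(Suc n := s)))"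
  unfolding ins PiE_insert_eq
  by (subst sum.reindex[OF inj_combinator]) (auto simp: case_prod_beta intro!: sum.cong)
 also have "... = (\<Sum>s\<in>S. \<Sum>\<xi>\<in>PiE {1..n} (\<lambda>_. S). F (\<xi>(Suc n := s)))"
  by (rule sum.cartesian_product[symmetric])
 finally show ?thesis by (simp add: sum.swap[of _ "PiE _ _"])
qed

text \<open>Rounding up makes the grid points approach t from the right, the only side on which the
  paths are continuous.\<close>

lemma nat_ceiling_at_right:
 assumes "0 \<le> t"
 shows "(\<lambda>n. real (nat \<lceil>t * real (Suc n)\<rceil>) / real (Suc n)) \<longlonglongrightarrow> t"
proof (rule real_tendsto_sandwich)
 show "\<forall>\<^sub>F n in sequentially. t \<le> real (nat \<lceil>t * real (Suc n)\<rceil>) / real (Suc n)"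
  by (intro always_eventually allI) (simp add: field_simps real_nat_ceiling_ge)
 show "\<forall>\<^sub>F n in sequentially. real (nat \<lceil>t * real (Suc n)\<rceil>) / real (Suc n) \<le> t + 1 / real (Suc n)"
 proof (intro always_eventually allI)
  fix n
  have "real (nat \<lceil>t * real (Suc n)\<rceil>) \<le> t * real (Suc n) + 1"
   using assms by (simp add: of_nat_nat del: of_nat_Suc)
  then show "real (nat \<lceil>t * real (Suc n)\<rceil>) / real (Suc n) \<le> t + 1 / real (Suc n)"
   by (simp add: field_simps del: of_nat_Suc)
 qed
 have "(\<lambda>n. t + 1 / real (Suc n)) \<longlonglongrightarrow> t + 0"
  by (intro tendsto_add tendsto_const LIMSEQ_Suc[OF lim_1_over_n])
 then show "(\<lambda>n. t + 1 / real (Suc n)) \<longlonglongrightarrow> t" by simp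
qed simp

text \<open>The sample points lie to the right of the integration variable, so right-continuity suffices.\<close>

lemma riemann_sum_tendsto:
 fixes f :: "real \<Rightarrow> real"
 assumes T: "0 < T" and bd: "\<And>t. 0 \<le> t \<Longrightarrow> t \<le> T \<Longrightarrow> \<bar>f t\<bar> \<le> w"
  and cont: "\<And>t. 0 \<le> t \<Longrightarrow> t < T \<Longrightarrow> (f \<longlongrightarrow> f t) (at_right t)"
 shows "(\<lambda>n. \<Sum>i\<in>{1..Suc n}. T / real (Suc n) * f (real i * (T / real (Suc n))))
      \<longlonglongrightarrow> (LBINT t:{0..T}. f t)"
proof -
 define h where "h n = T / real (Suc n)" for n
 define k where "k n t = nat \<lceil>t / T * real (Suc n)\<rceil>" for n t
 \<comment> \<open>The step function that takes on each half-open cell the value of f at the right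
   end point; at every t in \<open>{0<..T}\<close> exactly one summand survives.\<close>
 define s where "s n t = (\<Sum>i\<in>{1..Suc n}. indicator {real (i - 1) * h n<..real i * h n} t * f (real i * h n))" for n t
 have hp: "0 < h n" for n using T by (simp add: h_def)
 have s_eq: "s n t = f (real (k n t) * h n)" if t: "0 < t" "t \<le> T" for n t
 proof -
  have eq: "t / T * real (Suc n) = t / h n" using T by (simp add: h_def)
  have pos: "0 < \<lceil>t / h n\<rceil>" using t hp by simp
  have kr: "real (k n t) = of_int \<lceil>t / h n\<rceil>" unfolding k_def eq using pos by simp
  have k1: "1 \<le> k n t" using pos unfolding k_def eq by linarith
  have "t / T * real (Suc n) \<le> 1 * real (Suc n)" using t T by (intro mult_right_mono) auto
  then have "\<lceil>t / T * real (Suc n)\<rceil> \<le> int (Suc n)" by (simp add: ceiling_le_iff del: of_nat_Suc)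
  then have k2: "k n t \<le> Suc n" unfolding k_def by linarith
  have "indicator {real (i - 1) * h n<..real i * h n} t * f (real i * h n)
    = (if i = k n t then f (real (k n t) * h n) else 0)" if "i \<in> {1..Suc n}" for i
  proof -
   have "t \<in> {real (i - 1) * h n<..real i * h n} \<longleftrightarrow> real i - 1 < t / h n \<and> t / h n \<le> real i"
    using that hp[of n] by (auto simp: of_nat_diff field_simps)
   also have "... \<longleftrightarrow> \<lceil>t / h n\<rceil> = int i"
    by (auto simp: ceiling_eq_iff)
   also have "... \<longleftrightarrow> i = k n t"
    using kr by linarith
   finally show ?thesis by (auto simp: indicator_def)
  qed
  then have "s n t = (\<Sum>i\<in>{1..Suc n}. if i = k n t then f (real (k n t) * h n) else 0)"
   unfolding s_def by (intro sum.cong refl)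
  also have "... = f (real (k n t) * h n)" using k1 k2 by simp
  finally show ?thesis .
 qed
 have kT: "real (k n t) * h n \<le> T" "t \<le> real (k n t) * h n" if t: "0 < t" "t \<le> T" for n t
 proof -
  have "t / T * real (Suc n) \<le> 1 * real (Suc n)" using t T by (intro mult_right_mono) auto
  then have "\<lceil>t / T * real (Suc n)\<rceil> \<le> int (Suc n)" by (simp add: ceiling_le_iff del: of_nat_Suc)
  then have "k n t \<le> Suc n" unfolding k_def by linarith
  then have "real (k n t) * h n \<le> real (Suc n) * h n" using hp[of n] by (intro mult_right_mono) auto
  then show "real (k n t) * h n \<le> T" by (simp add: h_def)
  have "t / T * real (Suc n) \<le> real (k n t)" unfolding k_def by (rule real_nat_ceiling_ge)
  then have "t / T * real (Suc n) * h n \<le> real (k n t) * h n" using hp[of n] by (intro mult_right_mono) auto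
  then show "t \<le> real (k n t) * h n" using T by (simp add: h_def)
 qed
 have lim: "(\<lambda>n. s n t) \<longlonglongrightarrow> f t" if t: "0 < t" "t < T" for t
 proof -
  have "(\<lambda>n. real (k n t) / real (Suc n)) \<longlonglongrightarrow> t / T"
   unfolding k_def by (rule nat_ceiling_at_right) (use t in auto)
  then have "(\<lambda>n. real (k n t) / real (Suc n) * T) \<longlonglongrightarrow> t / T * T"
   by (intro tendsto_mult tendsto_const)
  then have l: "(\<lambda>n. real (k n t) * h n) \<longlonglongrightarrow> t" using T by (simp add: h_def)
  have "(f \<longlongrightarrow> f t) (at t within {t..})"
  proof -
   have "at t within {t..} = at_right t" by (rule at_within_Ici_at_right)
   then show ?thesis using cont[of t] t by simp
  qed
  then have "continuous (at t within {t..}) f" by (simp add: continuous_within)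
  then have "(\<lambda>n. f (real (k n t) * h n)) \<longlonglongrightarrow> f t"
   by (rule continuous_within_tendsto_compose) (use l kT t in auto)
  then show ?thesis using s_eq t by simp
 qed
 \<comment> \<open>At 0 every step function vanishes, and at T nothing is assumed about continuity.
   Both points are null sets.\<close>
 have AE: "AE t in lborel. t \<noteq> 0 \<and> t \<noteq> T"
  by (intro AE_conjI AE_lborel_singleton)
 have m: "(\<lambda>t. indicator {0..T} t * s n t) \<in> borel_measurable lborel" for n
  unfolding s_def by measurable
 \<comment> \<open>Measurability of f is derived here: on the open interval it is the pointwise
   limit of the step functions.\<close>
 have mf: "(\<lambda>t. indicator {0<..<T} t * f t) \<in> borel_measurable lborel"
 proof (rule borel_measurable_LIMSEQ_real)
  show "(\<lambda>n. indicator {0<..<T} t * s n t) \<longlonglongrightarrow> indicator {0<..<T} t * f t" for t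
   using lim[of t] by (auto simp: indicator_def)
  show "(\<lambda>t. indicator {0<..<T} t * s n t) \<in> borel_measurable lborel" for n
   unfolding s_def by measurable
 qed
 have mf': "(\<lambda>t. indicator {0..T} t * f t) \<in> borel_measurable lborel"
 proof -
  have "(\<lambda>t. indicator {0<..<T} t * f t + indicator {0} t * f 0 + indicator {T} t * f T) \<in> borel_measurable lborel"
   by (intro borel_measurable_add mf) measurable
  also have "(\<lambda>t. indicator {0<..<T} t * f t + indicator {0} t * f 0 + indicator {T} t * f T)
    = (\<lambda>t. indicator {0..T} t * f t)"
   using T by (intro ext) (auto simp: indicator_def)
  finally show ?thesis .
 qed
 have "(\<lambda>n. LINT t|lborel. indicator {0..T} t * s n t) \<longlonglongrightarrow> (LINT t|lborel. indicator {0..T} t * f t)"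
 proof (rule integral_dominated_convergence[where w = "\<lambda>t. indicator {0..T} t * w"])
  show "integrable lborel (\<lambda>t. indicator {0..T} t * w)"
   using T by (intro integrable_mult_left) simp
  show "AE t in lborel. (\<lambda>n. indicator {0..T} t * s n t) \<longlonglongrightarrow> indicator {0..T} t * f t"
   using AE by eventually_elim (use lim in \<open>auto simp: indicator_def\<close>)
  show "AE t in lborel. norm (indicator {0..T} t * s n t) \<le> indicator {0..T} t * w" for n
   using AE
  proof eventually_elim
   case (elim t)
   show ?case
   proof (cases "0 < t \<and> t \<le> T")
    case True
    have "\<bar>f (real (k n t) * h n)\<bar> \<le> w" using kT[of t n] True by (intro bd) auto
    then show ?thesis using True s_eq[of t n] by simp
   qed (use elim in \<open>auto simp: indicator_def\<close>)
  qed
 qed (use m mf' in auto)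
 moreover have "(LINT t|lborel. indicator {0..T} t * s n t) = (\<Sum>i\<in>{1..Suc n}. h n * f (real i * h n))" for n
 proof -
  have "(LINT t|lborel. indicator {0..T} t * s n t)
   = integral\<^sup>L lborel (\<lambda>t. \<Sum>i\<in>{1..Suc n}. indicator {real (i - 1) * h n<..real i * h n} t * f (real i * h n))"
  proof (intro Bochner_Integration.integral_cong refl)
   fix t
   have "indicator {real (i - 1) * h n<..real i * h n} t = (0 :: real)" if "t \<notin> {0..T}" "i \<in> {1..Suc n}" for i
   proof -
    have "0 \<le> real (i - 1) * h n" using hp[of n] by simp
    moreover have "real i * h n \<le> real (Suc n) * h n" using hp[of n] that by (intro mult_right_mono) auto
    moreover have "real (Suc n) * h n = T" by (simp add: h_def)
    ultimately show ?thesis using that by (auto simp: indicator_def)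
   qed
   then show "indicator {0..T} t * s n t = (\<Sum>i\<in>{1..Suc n}. indicator {real (i - 1) * h n<..real i * h n} t * f (real i * h n))"
    unfolding s_def by (cases "t \<in> {0..T}") auto
  qed
  also have "... = (\<Sum>i\<in>{1..Suc n}. (LINT t|lborel. indicator {real (i - 1) * h n<..real i * h n} t * f (real i * h n)))"
   by (rule Bochner_Integration.integral_sum) (intro integrable_mult_left, use hp in simp)
  also have "... = (\<Sum>i\<in>{1..Suc n}. h n * f (real i * h n))"
  proof (intro sum.cong refl)
   fix i assume "i \<in> {1..Suc n}"
   then have "measure lborel {real (i - 1) * h n<..real i * h n} = h n"
    using hp[of n] by (subst measure_lborel_Ioc) (auto simp: of_nat_diff algebra_simps)
   then show "(LINT t|lborel. indicator {real (i - 1) * h n<..real i * h n} t * f (real i * h n)) = h n * f (real i * h n)"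
    by simp
  qed
  finally show ?thesis .
 qed
 ultimately show ?thesis unfolding h_def by (simp add: set_lebesgue_integral_def)
qed

text \<open>A linear operator on functions of the whole type with a sup-norm bound on S. Taking
  \<open>B = 0\<close> in \<open>L_bound\<close> shows that \<open>L f\<close> on S depends only on
  f on S, so the values outside the state space never interfere. The bound \<Lambda> makes the
  exponential series converge.\<close>

locale finite_generator =
 fixes S :: "'s set" and L :: "('s \<Rightarrow> real) \<Rightarrow> 's \<Rightarrow> real" and \<Lambda> :: real
 assumes finite_S: "finite S"
  and rate_nonneg: "0 \<le> \<Lambda>"
  and L_add: "L (\<lambda>x. f x + g x) = (\<lambda>x. L f x + L g x)"
  and L_scale: "L (\<lambda>x. k * f x) = (\<lambda>x. k * L f x)"
  and L_bound: "(\<And>x. x \<in> S \<Longrightarrow> \<bar>f x\<bar> \<le> B) \<Longrightarrow> x \<in> S \<Longrightarrow> \<bar>L f x\<bar> \<le> \<Lambda> * B"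
begin

section \<open>The semigroup as an exponential series\<close>

abbreviation P where "P \<equiv> semigroup_gen L"

lemma pow_add: "(L ^^ n) (\<lambda>x. f x + g x) = (\<lambda>x. (L ^^ n) f x + (L ^^ n) g x)"
 by (induction n) (simp_all add: L_add)

lemma pow_scale: "(L ^^ n) (\<lambda>x. k * f x) = (\<lambda>x. k * (L ^^ n) f x)"
 by (induction n) (simp_all add: L_scale)

lemma pow_bound:
 assumes "\<And>x. x \<in> S \<Longrightarrow> \<bar>f x\<bar> \<le> B" "x \<in> S"
 shows "\<bar>(L ^^ n) f x\<bar> \<le> \<Lambda> ^ n * B"
 using assms(2)
proof (induction n arbitrary: x)
 case (Suc n)
 have "\<bar>L ((L ^^ n) f) x\<bar> \<le> \<Lambda> * (\<Lambda> ^ n * B)"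
  by (rule L_bound) (use Suc in auto)
 then show ?case by (simp add: mult.assoc)
qed (use assms in auto)

lemma bounded_on_S: obtains B where "\<And>x. x \<in> S \<Longrightarrow> \<bar>f x\<bar> \<le> (B :: real)"
proof -
 have "\<bar>f x\<bar> \<le> (\<Sum>y\<in>S. \<bar>f y\<bar>)" if "x \<in> S" for x
  by (rule member_le_sum) (use finite_S that in auto)
 then show ?thesis using that by blast
qed

lemma exp_term_bound:
 assumes "\<And>x. x \<in> S \<Longrightarrow> \<bar>f x\<bar> \<le> B" "x \<in> S" "0 \<le> t"
 shows "norm (t ^ n / fact n * (L ^^ n) f x) \<le> (t * \<Lambda>) ^ n / fact n * B"
proof -
 have "t ^ n / fact n * \<bar>(L ^^ n) f x\<bar> \<le> t ^ n / fact n * (\<Lambda> ^ n * B)"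
  by (intro mult_left_mono pow_bound assms) (use assms in auto)
 then show ?thesis using assms(3) by (simp add: abs_mult power_mult_distrib)
qed

lemma semigroup_summable:
 assumes "x \<in> S" "0 \<le> t"
 shows "summable (\<lambda>n. t ^ n / fact n * (L ^^ n) f x)"
proof -
 obtain B where "\<And>x. x \<in> S \<Longrightarrow> \<bar>f x\<bar> \<le> B" using bounded_on_S[of f] by metis
 then show ?thesis
  by (intro summable_comparison_test'[OF summable_exp_bound exp_term_bound]) (use assms in auto)
qed

lemma semigroup_add:
 assumes "x \<in> S" "0 \<le> t"
 shows "P t (\<lambda>x. f x + g x) x = P t f x + P t g x"
 unfolding semigroup_gen_def pow_add distrib_left
 by (intro suminf_add[symmetric] semigroup_summable assms)

lemma semigroup_scale:
 assumes "x \<in> S" "0 \<le> t"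
 shows "P t (\<lambda>x. k * f x) x = k * P t f x"
 unfolding semigroup_gen_def pow_scale
 using suminf_mult[OF semigroup_summable[OF assms], of k] by (simp add: mult.left_commute)

text \<open>Linearity and \<open>pow_bound\<close> with bound 0, applied to the difference of f and
  g.\<close>

lemma semigroup_cong:
 assumes "\<And>x. x \<in> S \<Longrightarrow> f x = g x" "x \<in> S" "0 \<le> t"
 shows "P t f x = P t g x"
proof -
 have "\<bar>(L ^^ n) (\<lambda>x. f x + (- 1) * g x) x\<bar> \<le> \<Lambda> ^ n * 0" for n
  by (rule pow_bound) (use assms in auto)
 then have "(L ^^ n) f x = (L ^^ n) g x" for n
  unfolding pow_add pow_scale by (simp add: algebra_simps)
 then show ?thesis by (simp add: semigroup_gen_def)
qed

lemma semigroup_sum: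
 assumes "x \<in> S" "0 \<le> t" "finite I"
 shows "P t (\<lambda>x. \<Sum>i\<in>I. k i * f i x) x = (\<Sum>i\<in>I. k i * P t (f i) x)"
 using assms(3)
proof (induction I)
 case empty
 have "P t (\<lambda>x. 0 * (0 :: real)) x = 0 * P t (\<lambda>x. 0) x" by (rule semigroup_scale[OF assms(1,2)])
 then show ?case by simp
next
 case (insert i I)
 then show ?case by (simp add: semigroup_add semigroup_scale assms)
qed

lemma semigroup_eq_transition:
 assumes "x \<in> S" "0 \<le> t"
 shows "P t f x = (\<Sum>y\<in>S. transition_prob L t x y * f y)"
proof -
 have "P t f x = P t (\<lambda>x. \<Sum>y\<in>S. f y * indicator {y} x) x"
 proof (rule semigroup_cong[OF _ assms])
  fix x assume "x \<in> S"
  have "(\<Sum>y\<in>S. f y * indicator {y} x) = (\<Sum>y\<in>S. if y = x then f x else 0)"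
   by (rule sum.cong) (auto simp: indicator_def)
  then show "f x = (\<Sum>y\<in>S. f y * indicator {y} x)" using finite_S \<open>x \<in> S\<close> by simp
 qed
 then show ?thesis
  by (simp add: semigroup_sum[OF assms finite_S] transition_prob_def mult.commute)
qed

text \<open>Second-order remainder of the exponential series. Since t is at most 1, the factor
  \<open>t^2\<close> comes out of every remaining term, and what is left is dominated by the series
  of \<open>exp \<Lambda>\<close>.\<close>

lemma semigroup_expansion:
 assumes f: "\<And>x. x \<in> S \<Longrightarrow> \<bar>f x\<bar> \<le> B" and x: "x \<in> S" and t: "0 \<le> t" "t \<le> 1"
 shows "\<bar>P t f x - f x - t * L f x\<bar> \<le> t^2 * (exp \<Lambda> * B)"
proof -
 let ?a = "\<lambda>n. t ^ n / fact n * (L ^^ n) f x"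
 have B: "0 \<le> B" using f[OF x] by simp
 have sa: "summable ?a" by (rule semigroup_summable[OF x t(1)])
 have "P t f x = (\<Sum>n. ?a (n + 2)) + (\<Sum>n<2. ?a n)"
  unfolding semigroup_gen_def by (rule suminf_split_initial_segment[OF sa])
 then have eq: "P t f x - f x - t * L f x = (\<Sum>n. ?a (n + 2))"
  by (simp add: eval_nat_numeral)
 have le: "norm (?a (n + 2)) \<le> t^2 * (\<Lambda> ^ (n + 2) / fact (n + 2) * B)" for n
 proof -
  have "norm (?a (n + 2)) \<le> (t * \<Lambda>) ^ (n + 2) / fact (n + 2) * B"
   by (rule exp_term_bound[OF f x t(1)])
  also have "... = t ^ n * (t^2 * (\<Lambda> ^ (n + 2) / fact (n + 2) * B))"
   by (simp add: power_mult_distrib power_add power2_eq_square mult_ac)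
  also have "... \<le> 1 * (t^2 * (\<Lambda> ^ (n + 2) / fact (n + 2) * B))"
   by (intro mult_right_mono power_le_one) (use t B rate_nonneg in auto)
  finally show ?thesis by simp
 qed
 have sm: "summable (\<lambda>n. \<Lambda> ^ (n + 2) / fact (n + 2) * B)"
  by (rule summable_ignore_initial_segment[OF summable_exp_bound])
 have "norm (\<Sum>n. ?a (n + 2)) \<le> (\<Sum>n. t^2 * (\<Lambda> ^ (n + 2) / fact (n + 2) * B))"
  by (rule norm_suminf_le[OF le summable_mult[OF sm]])
 also have "... = t^2 * (\<Sum>n. \<Lambda> ^ (n + 2) / fact (n + 2) * B)" by (rule suminf_mult[OF sm])
 also have "(\<Sum>n. \<Lambda> ^ (n + 2) / fact (n + 2) * B) \<le> exp \<Lambda> * B"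
 proof -
  have "exp \<Lambda> * B = (\<Sum>n. \<Lambda> ^ (n + 2) / fact (n + 2) * B) + (\<Sum>n<2. \<Lambda> ^ n / fact n * B)"
   unfolding suminf_exp_bound[symmetric]
   by (rule suminf_split_initial_segment[OF summable_exp_bound])
  moreover have "0 \<le> (\<Sum>n<2. \<Lambda> ^ n / fact n * B)"
   by (intro sum_nonneg) (use B rate_nonneg in auto)
  ultimately show ?thesis by linarith
 qed
 finally show ?thesis unfolding eq by (simp add: mult_left_mono)
qed

section \<open>One step of the discretized Feynman-Kac product\<close>

lemma L_diff: "L (\<lambda>x. f x - g x) = (\<lambda>x. L f x - L g x)"
 using L_add[of f "\<lambda>x. (- 1) * g x"] unfolding L_scale by simp

lemma perturbed_exp:
 assumes g: "\<And>x. x \<in> S \<Longrightarrow> \<bar>g x\<bar> \<le> B" and W: "\<And>x. x \<in> S \<Longrightarrow> \<bar>W x\<bar> \<le> w"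
  and x: "x \<in> S" and h: "0 \<le> h" "h \<le> 1"
 shows "\<bar>P h (\<lambda>x. exp (h * W x) * g x) x - g x - h * (L g x + W x * g x)\<bar>
      \<le> h^2 * ((exp \<Lambda> + \<Lambda> * w + w^2) * exp w * B)"
proof -
 let ?f = "\<lambda>x. exp (h * W x) * g x"
 have w: "0 \<le> w" and B: "0 \<le> B" using W[OF x] g[OF x] by auto
 have hW: "\<bar>h * W y\<bar> \<le> h * w" if "y \<in> S" for y
  using W[OF that] h by (simp add: abs_mult mult_left_mono)
 have hw: "h * w \<le> w" using h w by (simp add: mult_left_le_one_le)
 have e: "exp \<bar>h * W y\<bar> \<le> exp w" if "y \<in> S" for y
  using order_trans[OF hW[OF that] hw] by simp
 have f: "\<bar>?f y\<bar> \<le> exp w * B" if "y \<in> S" for y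
 proof -
  have "exp (h * W y) \<le> exp w" using e[OF that] by (meson abs_ge_self exp_le_cancel_iff order_trans)
  then show ?thesis using g[OF that] by (simp add: abs_mult mult_mono)
 qed
 have 1: "\<bar>P h ?f x - ?f x - h * L ?f x\<bar> \<le> h^2 * (exp \<Lambda> * (exp w * B))"
  by (rule semigroup_expansion[OF f x h])
 have "\<bar>L (\<lambda>x. ?f x - g x) x\<bar> \<le> \<Lambda> * (h * w * exp w * B)"
 proof (rule L_bound[OF _ x])
  fix y assume y: "y \<in> S"
  have "\<bar>?f y - g y\<bar> = \<bar>exp (h * W y) - 1\<bar> * \<bar>g y\<bar>"
   by (simp add: left_diff_distrib flip: abs_mult)
  also have "... \<le> (h * w * exp w) * B"
  proof (intro mult_mono g y)
   have "\<bar>h * W y\<bar> * exp \<bar>h * W y\<bar> \<le> h * w * exp w"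
    by (intro mult_mono hW e y) (use h w in auto)
   then show "\<bar>exp (h * W y) - 1\<bar> \<le> h * w * exp w"
    using abs_exp_minus_one_le[of "h * W y"] by linarith
  qed (use h w in auto)
  finally show "\<bar>?f y - g y\<bar> \<le> h * w * exp w * B" .
 qed
 then have 2: "\<bar>h * (L ?f x - L g x)\<bar> \<le> h^2 * (\<Lambda> * w * exp w * B)"
  unfolding L_diff using mult_left_mono[of _ _ h] h(1) by (fastforce simp: abs_mult power2_eq_square mult_ac)
 have 3: "\<bar>?f x - g x - h * (W x * g x)\<bar> \<le> h^2 * (w^2 * exp w * B)"
 proof -
  have "\<bar>?f x - g x - h * (W x * g x)\<bar> = \<bar>exp (h * W x) - 1 - h * W x\<bar> * \<bar>g x\<bar>"
   by (subst abs_mult[symmetric]) (simp add: algebra_simps)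
  also have "... \<le> ((h * w)^2 * exp w) * B"
  proof (intro mult_mono g x)
   have "(h * W x)^2 \<le> (h * w)^2" using hW[OF x] abs_le_square_iff[of "h * W x" "h * w"] h w by simp
   then have "(h * W x)^2 * exp \<bar>h * W x\<bar> \<le> (h * w)^2 * exp w"
    by (intro mult_mono e x) auto
   then show "\<bar>exp (h * W x) - 1 - h * W x\<bar> \<le> (h * w)^2 * exp w"
    using abs_exp_linear_le[of "h * W x"] by linarith
  qed (use B in auto)
  finally show ?thesis by (simp add: power_mult_distrib mult_ac)
 qed
 \<comment> \<open>Three second-order errors: the Taylor remainder of the semigroup, the generator
   applied to \<open>?f - g\<close>, and the linearization of \<open>exp (h * W x)\<close>.\<close>
 have "P h ?f x - g x - h * (L g x + W x * g x)
   = (P h ?f x - ?f x - h * L ?f x) + h * (L ?f x - L g x) + (?f x - g x - h * (W x * g x))"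
  by (simp add: algebra_simps)
 with 1 2 3 have "\<bar>P h ?f x - g x - h * (L g x + W x * g x)\<bar>
   \<le> h^2 * (exp \<Lambda> * (exp w * B)) + h^2 * (\<Lambda> * w * exp w * B) + h^2 * (w^2 * exp w * B)"
  by linarith
 then show ?thesis by (simp add: algebra_simps)
qed

text \<open>One step is \<open>g + h * (L g + W g)\<close> up to second order in h, so its squared
  norm is that of g plus 2h times the quadratic form, up to second order. This needs the form bound
  alone and no symmetry of L. The constant C is uniform in h, W, g and \<theta>, because the steps
  of one product use different potentials. It may be crude: over \<open>T / h\<close> steps it
  contributes only \<open>C * T * h\<close> to the exponent.\<close>

lemma perturbed_step_L2:
 assumes \<nu>: "\<And>x. x \<in> S \<Longrightarrow> 0 < \<nu> x" and w: "0 \<le> w"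
 obtains C where "0 \<le> C" "\<And>h W g \<theta>. \<lbrakk>0 \<le> h; h \<le> 1; \<And>x. x \<in> S \<Longrightarrow> \<bar>W x\<bar> \<le> w;
   (\<Sum>x\<in>S. \<nu> x * (g x * (L g x + W x * g x))) \<le> \<theta> * (\<Sum>x\<in>S. \<nu> x * (g x)^2)\<rbrakk>
  \<Longrightarrow> (\<Sum>x\<in>S. \<nu> x * (P h (\<lambda>x. exp (h * W x) * g x) x)^2)
    \<le> exp (2 * \<theta> * h + C * h^2) * (\<Sum>x\<in>S. \<nu> x * (g x)^2)"
proof (cases "S = {}")
 case True
 then show ?thesis using that[of 0] by simp
next
 case False
 \<comment> \<open>The smallest weight turns the weighted L2 norm into a sup bound on g, in which
   all remainders are measured.\<close>
 define m where "m = Min (\<nu> ` S)"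
 have m: "0 < m" "\<And>x. x \<in> S \<Longrightarrow> m \<le> \<nu> x"
  using False finite_S \<nu> by (auto simp: m_def)
 define K where "K = (exp \<Lambda> + \<Lambda> * w + w^2) * exp w"
 define K2 where "K2 = (\<Lambda> + w)^2 + 2 * K * (1 + \<Lambda> + w) + K^2"
 have K: "0 \<le> K" "0 \<le> K2" using w rate_nonneg by (auto simp: K_def K2_def)
 define C where "C = K2 * (\<Sum>x\<in>S. \<nu> x) / m"
 have sum\<nu>: "0 \<le> (\<Sum>x\<in>S. \<nu> x)" using \<nu> by (intro sum_nonneg) (auto intro: less_imp_le)
 have "0 \<le> C" using K sum\<nu> m by (simp add: C_def)
 moreover have "(\<Sum>x\<in>S. \<nu> x * (P h (\<lambda>x. exp (h * W x) * g x) x)^2)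
    \<le> exp (2 * \<theta> * h + C * h^2) * (\<Sum>x\<in>S. \<nu> x * (g x)^2)"
  if h: "0 \<le> h" "h \<le> 1" and W: "\<And>x. x \<in> S \<Longrightarrow> \<bar>W x\<bar> \<le> w"
   and form: "(\<Sum>x\<in>S. \<nu> x * (g x * (L g x + W x * g x))) \<le> \<theta> * (\<Sum>x\<in>S. \<nu> x * (g x)^2)"
  for h W g \<theta>
 proof -
  define n where "n = (\<Sum>x\<in>S. \<nu> x * (g x)^2)"
  have n: "0 \<le> n" unfolding n_def using \<nu> by (intro sum_nonneg mult_nonneg_nonneg) (auto intro: less_imp_le)
  define B where "B = sqrt (n / m)"
  have B2: "B^2 = n / m" "0 \<le> B" using n m by (auto simp: B_def)
  have g: "\<bar>g x\<bar> \<le> B" if x: "x \<in> S" for x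
  proof -
   have "m * (g x)^2 \<le> \<nu> x * (g x)^2" by (intro mult_right_mono m x) auto
   also have "... \<le> n" unfolding n_def
    by (rule member_le_sum[OF x, where f = "\<lambda>x. \<nu> x * (g x)^2"])
     (use finite_S \<nu> in \<open>auto intro!: mult_nonneg_nonneg intro: less_imp_le\<close>)
   finally have "(g x)^2 \<le> n / m" using m by (simp add: field_simps)
   then show ?thesis unfolding B_def by (metis real_sqrt_abs real_sqrt_le_mono)
  qed
  let ?v = "\<lambda>x. L g x + W x * g x"
  let ?Q = "\<lambda>x. P h (\<lambda>x. exp (h * W x) * g x) x"
  have pt: "(?Q x)^2 \<le> (g x)^2 + 2 * h * (g x * ?v x) + h^2 * (K2 * B^2)" if x: "x \<in> S" for x
  proof -
   define R where "R = ?Q x - g x - h * ?v x"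
   have R: "\<bar>R\<bar> \<le> h^2 * (K * B)"
    unfolding R_def K_def by (rule perturbed_exp[OF g W x h])
   have v: "\<bar>?v x\<bar> \<le> (\<Lambda> + w) * B"
   proof -
    have "\<bar>L g x\<bar> \<le> \<Lambda> * B" by (rule L_bound[OF g x])
    moreover have "\<bar>W x * g x\<bar> \<le> w * B"
     unfolding abs_mult by (intro mult_mono W g x w) auto
    ultimately show ?thesis by (simp add: algebra_simps)
   qed
   have v2: "(?v x)^2 \<le> (\<Lambda> + w)^2 * B^2"
    using v abs_le_square_iff[of "?v x" "(\<Lambda> + w) * B"] B2 w rate_nonneg
    by (simp add: power_mult_distrib)
   have h2: "0 \<le> h^2" "h^2 \<le> 1" using h by (auto simp: power_le_one)
   have gv: "\<bar>g x + h * ?v x\<bar> \<le> (1 + \<Lambda> + w) * B"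
   proof -
    have "\<bar>h * ?v x\<bar> \<le> 1 * ((\<Lambda> + w) * B)"
     unfolding abs_mult by (intro mult_mono v) (use h in auto)
    then show ?thesis using g[OF x] by (simp add: algebra_simps)
   qed
   have "R * (g x + h * ?v x) \<le> \<bar>R\<bar> * \<bar>g x + h * ?v x\<bar>" by (metis abs_ge_self abs_mult)
   also have "... \<le> (h^2 * (K * B)) * ((1 + \<Lambda> + w) * B)"
    by (intro mult_mono R gv) (use K B2 in auto)
   finally have r1: "2 * (R * (g x + h * ?v x)) \<le> h^2 * (2 * K * (1 + \<Lambda> + w) * B^2)"
    by (simp add: power2_eq_square algebra_simps)
   have "\<bar>R\<bar> * \<bar>R\<bar> \<le> (h^2 * (K * B)) * (1 * (K * B))"
    using R order_trans[OF R mult_right_mono[OF h2(2)]] K B2 by (intro mult_mono) auto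
   then have r2: "R^2 \<le> h^2 * (K^2 * B^2)" by (simp add: power2_eq_square mult_ac)
   have "?Q x = g x + h * ?v x + R" by (simp add: R_def)
   then have "(?Q x)^2 = (g x)^2 + 2 * h * (g x * ?v x) + h^2 * (?v x)^2
     + 2 * (R * (g x + h * ?v x)) + R^2"
    by (simp add: power2_eq_square algebra_simps)
   also have "... \<le> (g x)^2 + 2 * h * (g x * ?v x) + h^2 * ((\<Lambda> + w)^2 * B^2)
     + h^2 * (2 * K * (1 + \<Lambda> + w) * B^2) + h^2 * (K^2 * B^2)"
    by (intro add_mono r1 r2 mult_left_mono v2 h2 order_refl)
   finally show ?thesis by (simp add: K2_def algebra_simps)
  qed
  have "(\<Sum>x\<in>S. \<nu> x * (?Q x)^2)
    \<le> (\<Sum>x\<in>S. \<nu> x * ((g x)^2 + 2 * h * (g x * ?v x) + h^2 * (K2 * B^2)))"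
   by (intro sum_mono mult_left_mono pt) (use \<nu> in \<open>auto intro: less_imp_le\<close>)
  also have "... = n + 2 * h * (\<Sum>x\<in>S. \<nu> x * (g x * ?v x)) + h^2 * (K2 * B^2) * (\<Sum>x\<in>S. \<nu> x)"
   by (simp add: n_def distrib_left sum.distrib sum_distrib_left sum_distrib_right mult_ac)
  also have "... \<le> n + 2 * h * (\<theta> * n) + h^2 * (K2 * B^2) * (\<Sum>x\<in>S. \<nu> x)"
   using form h unfolding n_def by (intro add_mono mult_left_mono order_refl) auto
  also have "... = (1 + (2 * \<theta> * h + C * h^2)) * n"
   by (simp add: B2 C_def algebra_simps)
  also have "... \<le> exp (2 * \<theta> * h + C * h^2) * n"
   by (intro mult_right_mono exp_ge_add_one_self n)
  finally show ?thesis by (simp add: n_def)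
 qed
 ultimately show ?thesis using that by blast
qed

text \<open>The backward recursion: the factor at the latest time acts on g first, and
  \<open>P h\<close> then carries the result one step towards time 0.\<close>

primrec iterated :: "real \<Rightarrow> (nat \<Rightarrow> 's \<Rightarrow> real) \<Rightarrow> nat \<Rightarrow> ('s \<Rightarrow> real) \<Rightarrow> 's \<Rightarrow> real" where
 "iterated h F 0 g = g"
| "iterated h F (Suc n) g = iterated h F n (P h (\<lambda>x. F (Suc n) x * g x))"

text \<open>Chapman-Kolmogorov with weights. Paths are indexed by times from 1 on, so the starting
  point is inserted by \<open>\<xi>(0 := x0)\<close>.\<close>

lemma sum_paths_eq_iterated:
 assumes x0: "x0 \<in> S" and h: "0 \<le> h"
 shows "(\<Sum>\<xi>\<in>PiE {1..n} (\<lambda>_. S). (\<Prod>i<n. transition_prob L h ((\<xi>(0 := x0)) i) (\<xi> (Suc i)) * F (Suc i) (\<xi> (Suc i)))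
       * g ((\<xi>(0 := x0)) n))
     = iterated h F n g x0"
proof (induction n arbitrary: g)
 case 0
 then show ?case by simp
next
 case (Suc n)
 let ?p = "transition_prob L h"
 let ?G = "\<lambda>n \<xi>. \<Prod>i<n. ?p ((\<xi>(0 := x0)) i) (\<xi> (Suc i)) * F (Suc i) (\<xi> (Suc i))"
 have "(\<Sum>\<xi>\<in>PiE {1..Suc n} (\<lambda>_. S). ?G (Suc n) \<xi> * g ((\<xi>(0 := x0)) (Suc n)))
   = (\<Sum>\<xi>\<in>PiE {1..n} (\<lambda>_. S). \<Sum>s\<in>S. ?G n \<xi> * (?p ((\<xi>(0 := x0)) n) s * F (Suc n) s) * g s)"
  unfolding sum_PiE_Suc
 proof (intro sum.cong refl)
  fix \<xi> :: "nat \<Rightarrow> 's" and s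
  have "?G n (\<xi>(Suc n := s)) = ?G n \<xi>"
   by (intro prod.cong refl) auto
  then show "?G (Suc n) (\<xi>(Suc n := s)) * g (((\<xi>(Suc n := s))(0 := x0)) (Suc n))
    = ?G n \<xi> * (?p ((\<xi>(0 := x0)) n) s * F (Suc n) s) * g s"
   by (simp add: fun_upd_twist[of 0 "Suc n"])
 qed
 also have "... = (\<Sum>\<xi>\<in>PiE {1..n} (\<lambda>_. S). ?G n \<xi> * P h (\<lambda>x. F (Suc n) x * g x) ((\<xi>(0 := x0)) n))"
 proof (intro sum.cong refl)
  fix \<xi> assume \<xi>: "\<xi> \<in> PiE {1..n} (\<lambda>_. S)"
  have "(\<xi>(0 := x0)) n \<in> S" using \<xi> x0 by (cases n) auto
  then show "(\<Sum>s\<in>S. ?G n \<xi> * (?p ((\<xi>(0 := x0)) n) s * F (Suc n) s) * g s)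
    = ?G n \<xi> * P h (\<lambda>x. F (Suc n) x * g x) ((\<xi>(0 := x0)) n)"
   by (simp only: semigroup_eq_transition[OF _ h] sum_distrib_left) (simp only: mult_ac)
 qed
 also have "... = iterated h F (Suc n) g x0" unfolding iterated.simps by (rule Suc.IH)
 finally show ?case .
qed

text \<open>The product is expanded over all possible values at the n grid times, which leaves only
  the finite-dimensional distributions.\<close>

lemma expectation_prod_eq_iterated:
 assumes mc: "markov_chain_from M S L x0 X" and h: "0 \<le> h"
 shows "integral\<^sup>L M (\<lambda>\<omega>. \<Prod>i\<in>{1..n}. F i (X (real i * h) \<omega>)) = iterated h F n (\<lambda>_. 1) x0"
proof -
 interpret prob_space M using mc by (simp add: markov_chain_from_def)
 have x0: "x0 \<in> S" and X: "\<And>t. 0 \<le> t \<Longrightarrow> X t \<in> M \<rightarrow>\<^sub>M count_space S"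
  using mc by (auto simp: markov_chain_from_def)
 have XS: "X t \<omega> \<in> S" if "0 \<le> t" "\<omega> \<in> space M" for t \<omega>
  using measurable_space[OF X[OF that(1)] that(2)] by simp
 let ?E = "\<lambda>\<xi>. {\<omega>\<in>space M. \<forall>i\<in>{1..n}. X (real i * h) \<omega> = \<xi> i}"
 have sets: "?E \<xi> \<in> sets M" if "\<xi> \<in> PiE {1..n} (\<lambda>_. S)" for \<xi>
 proof -
  have "X (real i * h) -` {\<xi> i} \<inter> space M \<in> sets M" if "i \<in> {1..n}" for i
   using that \<open>\<xi> \<in> _\<close> h by (intro measurable_sets[OF X]) auto
  then have "{\<omega>\<in>space M. X (real i * h) \<omega> = \<xi> i} \<in> sets M" if "i \<in> {1..n}" for i
   using that by (simp add: vimage_def Int_def conj_commute)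
  then show ?thesis by (intro sets.sets_Collect_finite_All) auto
 qed
 have "integral\<^sup>L M (\<lambda>\<omega>. \<Prod>i\<in>{1..n}. F i (X (real i * h) \<omega>))
   = integral\<^sup>L M (\<lambda>\<omega>. \<Sum>\<xi>\<in>PiE {1..n} (\<lambda>_. S). (\<Prod>i\<in>{1..n}. F i (\<xi> i)) * indicator (?E \<xi>) \<omega>)"
 proof (intro Bochner_Integration.integral_cong refl)
  fix \<omega> assume \<omega>: "\<omega> \<in> space M"
  have "(\<Prod>i\<in>{1..n}. F i (X (real i * h) \<omega>))
    = (\<Prod>i\<in>{1..n}. \<Sum>s\<in>S. F i s * of_bool (X (real i * h) \<omega> = s))"
   using XS[OF _ \<omega>] h finite_S by (intro prod.cong refl) (simp add: of_bool_def if_distrib cong: if_cong)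
  also have "... = (\<Sum>\<xi>\<in>PiE {1..n} (\<lambda>_. S). \<Prod>i\<in>{1..n}. F i (\<xi> i) * of_bool (X (real i * h) \<omega> = \<xi> i))"
   by (rule prod_sum_PiE) (use finite_S in auto)
  also have "... = (\<Sum>\<xi>\<in>PiE {1..n} (\<lambda>_. S). (\<Prod>i\<in>{1..n}. F i (\<xi> i)) * indicator (?E \<xi>) \<omega>)"
  proof (intro sum.cong refl)
   fix \<xi> :: "nat \<Rightarrow> 's"
   have "(\<Prod>i\<in>{1..n}. of_bool (X (real i * h) \<omega> = \<xi> i)) = (indicator (?E \<xi>) \<omega> :: real)"
    using \<omega> by (auto simp: indicator_def)
   then show "(\<Prod>i\<in>{1..n}. F i (\<xi> i) * of_bool (X (real i * h) \<omega> = \<xi> i))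
     = (\<Prod>i\<in>{1..n}. F i (\<xi> i)) * indicator (?E \<xi>) \<omega>"
    by (simp add: prod.distrib)
  qed
  finally show "(\<Prod>i\<in>{1..n}. F i (X (real i * h) \<omega>))
    = (\<Sum>\<xi>\<in>PiE {1..n} (\<lambda>_. S). (\<Prod>i\<in>{1..n}. F i (\<xi> i)) * indicator (?E \<xi>) \<omega>)" .
 qed
 also have "... = (\<Sum>\<xi>\<in>PiE {1..n} (\<lambda>_. S). (\<Prod>i\<in>{1..n}. F i (\<xi> i)) * measure M (?E \<xi>))"
  using sets by (subst Bochner_Integration.integral_sum) (auto simp: emeasure_eq_measure intro!: sum.cong)
 also have "... = (\<Sum>\<xi>\<in>PiE {1..n} (\<lambda>_. S).
   (\<Prod>i<n. transition_prob L h ((\<xi>(0 := x0)) i) (\<xi> (Suc i)) * F (Suc i) (\<xi> (Suc i))) * 1)"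
 proof (intro sum.cong refl)
  fix \<xi> assume \<xi>: "\<xi> \<in> PiE {1..n} (\<lambda>_. S)"
  \<comment> \<open>The finite-dimensional clause of \<open>markov_chain_from\<close> asks for
    states in S at every index, so the path is continued by \<open>x0\<close> beyond n.\<close>
  define \<zeta> where "\<zeta> i = (if i = 0 \<or> n < i then x0 else \<xi> i)" for i
  define \<tau> where "\<tau> i = real i * h" for i
  have fdd: "measure M {\<omega>\<in>space M. \<forall>i\<in>{1..n}. X (\<tau> i) \<omega> = \<zeta> i} =
     (\<Prod>i<n. transition_prob L (\<tau> (Suc i) - \<tau> i) (\<zeta> i) (\<zeta> (Suc i)))"
  proof -
   have "\<tau> 0 = 0" "mono \<tau>" using h by (auto simp: \<tau>_def intro!: monoI mult_right_mono)
   moreover have "\<zeta> 0 = x0" "\<forall>i. \<zeta> i \<in> S" using \<xi> x0 by (auto simp: \<zeta>_def)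
   ultimately show ?thesis using mc unfolding markov_chain_from_def by blast
  qed
  have e: "?E \<xi> = {\<omega>\<in>space M. \<forall>i\<in>{1..n}. X (\<tau> i) \<omega> = \<zeta> i}"
   by (auto simp: \<tau>_def \<zeta>_def)
  have "measure M (?E \<xi>) = (\<Prod>i<n. transition_prob L h ((\<xi>(0 := x0)) i) (\<xi> (Suc i)))"
   unfolding e fdd by (intro prod.cong refl) (auto simp: \<tau>_def \<zeta>_def algebra_simps)
  moreover have "(\<Prod>i\<in>{1..n}. F i (\<xi> i)) = (\<Prod>i<n. F (Suc i) (\<xi> (Suc i)))"
   by (rule prod.reindex_bij_witness[of _ Suc "\<lambda>i. i - 1"]) auto
  ultimately show "(\<Prod>i\<in>{1..n}. F i (\<xi> i)) * measure M (?E \<xi>)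
   = (\<Prod>i<n. transition_prob L h ((\<xi>(0 := x0)) i) (\<xi> (Suc i)) * F (Suc i) (\<xi> (Suc i))) * 1"
   by (simp add: prod.distrib mult.commute)
 qed
 also have "... = iterated h F n (\<lambda>_. 1) x0"
  by (rule sum_paths_eq_iterated[OF x0 h])
 finally show ?thesis .
qed

lemma iterated_L2_bound:
 assumes step: "\<And>i g. i \<in> {1..n} \<Longrightarrow>
   (\<Sum>x\<in>S. \<nu> x * (P h (\<lambda>x. F i x * g x) x)^2) \<le> exp b * (\<Sum>x\<in>S. \<nu> x * (g x)^2)"
 shows "(\<Sum>x\<in>S. \<nu> x * (iterated h F n g x)^2) \<le> exp (real n * b) * (\<Sum>x\<in>S. \<nu> x * (g x)^2)"
 using step
proof (induction n arbitrary: g)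
 case (Suc n)
 have "(\<Sum>x\<in>S. \<nu> x * (iterated h F (Suc n) g x)^2)
   \<le> exp (real n * b) * (\<Sum>x\<in>S. \<nu> x * (P h (\<lambda>x. F (Suc n) x * g x) x)^2)"
  unfolding iterated.simps by (rule Suc.IH) (use Suc.prems in auto)
 also have "... \<le> exp (real n * b) * (exp b * (\<Sum>x\<in>S. \<nu> x * (g x)^2))"
  by (intro mult_left_mono Suc.prems) auto
 also have "... = exp (real (Suc n) * b) * (\<Sum>x\<in>S. \<nu> x * (g x)^2)"
  by (simp add: algebra_simps exp_add)
 finally show ?case .
qed simp

text \<open>The exponential of a Riemann sum is a product over grid times, whose expectation is an
  \<open>iterated\<close> function at \<open>x0\<close>. The L2 bound is applied to each factor and
  the mesh tends to 0, by dominated convergence under \<open>w * T\<close>. Neither w nor the norm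
  bound \<Lambda> survives in the conclusion.\<close>

theorem feynman_kac_bound:
 assumes mc: "markov_chain_from M S L x0 X" and T: "0 < T"
  and \<nu>: "\<And>x. x \<in> S \<Longrightarrow> 0 < \<nu> x"
  and W: "\<And>t x. 0 \<le> t \<Longrightarrow> t \<le> T \<Longrightarrow> x \<in> S \<Longrightarrow> \<bar>W t x\<bar> \<le> w"
  and cont: "\<And>x. x \<in> S \<Longrightarrow> continuous_on {0..T} (\<lambda>t. W t x)"
  and form: "\<And>t g. 0 \<le> t \<Longrightarrow> t \<le> T \<Longrightarrow>
   (\<Sum>x\<in>S. \<nu> x * (g x * (L g x + W t x * g x))) \<le> \<theta> * (\<Sum>x\<in>S. \<nu> x * (g x)^2)"
 shows "integrable M (\<lambda>\<omega>. exp (LBINT t:{0..T}. W t (X t \<omega>)))" (is ?int)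
  and "integral\<^sup>L M (\<lambda>\<omega>. exp (LBINT t:{0..T}. W t (X t \<omega>))) \<le> sqrt (sum \<nu> S / \<nu> x0) * exp (\<theta> * T)"
   (is ?le)
proof -
 interpret prob_space M using mc by (simp add: markov_chain_from_def)
 have x0: "x0 \<in> S" and X: "\<And>t. 0 \<le> t \<Longrightarrow> X t \<in> M \<rightarrow>\<^sub>M count_space S"
  and right: "\<And>\<omega> t. \<omega> \<in> space M \<Longrightarrow> 0 \<le> t \<Longrightarrow> \<forall>\<^sub>F s in at_right t. X s \<omega> = X t \<omega>"
  using mc by (auto simp: markov_chain_from_def)
 have XS: "X t \<omega> \<in> S" if "0 \<le> t" "\<omega> \<in> space M" for t \<omega>
  using measurable_space[OF X[OF that(1)] that(2)] by simp
 have w: "0 \<le> w" using W[of 0 x0] T x0 by simp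
 define h where "h n = T / real (Suc n)" for n
 define Z where "Z n \<omega> = (\<Sum>i\<in>{1..Suc n}. h n * W (real i * h n) (X (real i * h n) \<omega>))" for n \<omega>
 have h: "0 < h n" for n using T by (simp add: h_def)
 have hT: "real i * h n \<le> T" if "i \<in> {1..Suc n}" for i n
 proof -
  have "real i * h n \<le> real (Suc n) * h n" using that h[of n] by (intro mult_right_mono) auto
  then show ?thesis by (simp add: h_def)
 qed
 have Zm: "Z n \<in> borel_measurable M" for n
  unfolding Z_def
  by (intro borel_measurable_sum borel_measurable_times borel_measurable_const measurable_compose[OF X])
   (use h[of n] in auto)
 have Zb: "\<bar>Z n \<omega>\<bar> \<le> w * T" if "\<omega> \<in> space M" for n \<omega>
 proof -
  have "\<bar>Z n \<omega>\<bar> \<le> (\<Sum>i\<in>{1..Suc n}. h n * w)"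
   unfolding Z_def
   by (rule order_trans[OF sum_abs], rule sum_mono)
    (use h[of n] hT XS[OF _ that] in \<open>auto simp: abs_mult intro!: mult_left_mono W\<close>)
  also have "... = w * T" by (simp add: h_def)
  finally show ?thesis .
 qed
 have Zlim: "(\<lambda>n. Z n \<omega>) \<longlonglongrightarrow> (LBINT t:{0..T}. W t (X t \<omega>))" if \<omega>: "\<omega> \<in> space M" for \<omega>
  unfolding Z_def h_def
 proof (rule riemann_sum_tendsto[OF T])
  show "\<bar>W t (X t \<omega>)\<bar> \<le> w" if "0 \<le> t" "t \<le> T" for t
   using W that XS[OF _ \<omega>] by auto
  show "((\<lambda>t. W t (X t \<omega>)) \<longlongrightarrow> W t (X t \<omega>)) (at_right t)" if t: "0 \<le> t" "t < T" for t
  proof -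
   \<comment> \<open>Just after t the path still sits in its state at time t, so continuity of W in
     time alone gives the right limit.\<close>
   have "((\<lambda>s. W s (X t \<omega>)) \<longlongrightarrow> W t (X t \<omega>)) (at t within {0..T})"
    using cont[OF XS[OF t(1) \<omega>]] t by (auto simp: continuous_on_def)
   then have "((\<lambda>s. W s (X t \<omega>)) \<longlongrightarrow> W t (X t \<omega>)) (at t within {t..T})"
    by (rule tendsto_within_subset) (use t in auto)
   then have "((\<lambda>s. W s (X t \<omega>)) \<longlongrightarrow> W t (X t \<omega>)) (at_right t)"
    using at_within_Icc_at_right[OF t(2)] by simp
   then show ?thesis
    by (rule Lim_transform_eventually) (use right[OF \<omega> t(1)] in eventually_elim, simp)
  qed
 qed
 have dom: "integrable M (\<lambda>\<omega>. exp (LBINT t:{0..T}. W t (X t \<omega>)))"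
  "(\<lambda>n. integral\<^sup>L M (\<lambda>\<omega>. exp (Z n \<omega>))) \<longlonglongrightarrow> integral\<^sup>L M (\<lambda>\<omega>. exp (LBINT t:{0..T}. W t (X t \<omega>)))"
 proof -
  let ?I = "\<lambda>\<omega>. LBINT t:{0..T}. W t (X t \<omega>)"
  have m: "(\<lambda>\<omega>. exp (?I \<omega>)) \<in> borel_measurable M"
   by (rule borel_measurable_LIMSEQ_real[where u = "\<lambda>n \<omega>. exp (Z n \<omega>)"])
    (use Zm in \<open>auto intro!: tendsto_exp Zlim\<close>)
  have mn: "(\<lambda>\<omega>. exp (Z n \<omega>)) \<in> borel_measurable M" for n using Zm by measurable
  have i: "integrable M (\<lambda>_. exp (w * T))" by simp
  have c: "AE \<omega> in M. (\<lambda>n. exp (Z n \<omega>)) \<longlonglongrightarrow> exp (?I \<omega>)"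
   by (intro AE_I2 tendsto_exp Zlim)
  have b: "AE \<omega> in M. norm (exp (Z n \<omega>)) \<le> exp (w * T)" for n
   by (intro AE_I2) (use Zb in \<open>fastforce simp: abs_le_iff\<close>)
  show "integrable M (\<lambda>\<omega>. exp (?I \<omega>))"
   by (rule integrable_dominated_convergence[OF m mn i c b])
  show "(\<lambda>n. integral\<^sup>L M (\<lambda>\<omega>. exp (Z n \<omega>))) \<longlonglongrightarrow> integral\<^sup>L M (\<lambda>\<omega>. exp (?I \<omega>))"
   by (rule integral_dominated_convergence[OF m mn i c b])
 qed
 obtain C where C: "0 \<le> C" and step: "\<And>h W g \<theta>. \<lbrakk>0 \<le> h; h \<le> 1; \<And>x. x \<in> S \<Longrightarrow> \<bar>W x\<bar> \<le> w;
   (\<Sum>x\<in>S. \<nu> x * (g x * (L g x + W x * g x))) \<le> \<theta> * (\<Sum>x\<in>S. \<nu> x * (g x)^2)\<rbrakk>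
  \<Longrightarrow> (\<Sum>x\<in>S. \<nu> x * (P h (\<lambda>x. exp (h * W x) * g x) x)^2)
    \<le> exp (2 * \<theta> * h + C * h^2) * (\<Sum>x\<in>S. \<nu> x * (g x)^2)"
  using perturbed_step_L2[of \<nu> w] \<nu> w by blast
 let ?b = "\<lambda>n. sqrt (exp (2 * \<theta> * T + C * T * h n) * (sum \<nu> S / \<nu> x0))"
 have le: "integral\<^sup>L M (\<lambda>\<omega>. exp (Z n \<omega>)) \<le> ?b n" if hn: "h n \<le> 1" for n
 proof -
  let ?F = "\<lambda>i x. exp (h n * W (real i * h n) x)"
  let ?u = "iterated (h n) ?F (Suc n) (\<lambda>_. 1)"
  have "integral\<^sup>L M (\<lambda>\<omega>. exp (Z n \<omega>)) = integral\<^sup>L M (\<lambda>\<omega>. \<Prod>i\<in>{1..Suc n}. ?F i (X (real i * h n) \<omega>))"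
   by (simp only: Z_def exp_sum[OF finite_atLeastAtMost])
  also have "... = ?u x0"
   by (rule expectation_prod_eq_iterated[OF mc]) (use h[of n] in simp)
  also have "... \<le> ?b n"
  proof (rule real_le_rsqrt)
   \<comment> \<open>Evaluation at one point is bounded by the L2 norm at the price of
     \<open>1 / \<nu> x0\<close>; this is the cost of the deterministic start.\<close>
   have "\<nu> x0 * (?u x0)^2 \<le> (\<Sum>x\<in>S. \<nu> x * (?u x)^2)"
    by (rule member_le_sum[OF x0, where f = "\<lambda>x. \<nu> x * (?u x)^2"])
     (use finite_S \<nu> in \<open>auto intro!: mult_nonneg_nonneg intro: less_imp_le\<close>)
   also have "... \<le> exp (real (Suc n) * (2 * \<theta> * h n + C * (h n)^2)) * (\<Sum>x\<in>S. \<nu> x * 1^2)"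
   proof (rule iterated_L2_bound)
    fix i g assume i: "i \<in> {1..Suc n}"
    have ih: "0 \<le> real i * h n" "real i * h n \<le> T" using h[of n] hT[OF i] by auto
    show "(\<Sum>x\<in>S. \<nu> x * (P (h n) (\<lambda>x. ?F i x * g x) x)^2)
      \<le> exp (2 * \<theta> * h n + C * (h n)^2) * (\<Sum>x\<in>S. \<nu> x * (g x)^2)"
     by (rule step) (use h[of n] hn W[OF ih] form[OF ih] in auto)
   qed
   also have "real (Suc n) * (2 * \<theta> * h n + C * (h n)^2) = 2 * \<theta> * T + C * T * h n"
   proof -
    have "T = real (Suc n) * h n" by (simp add: h_def)
    then show ?thesis by (simp add: power2_eq_square algebra_simps)
   qed
   finally show "(?u x0)^2 \<le> exp (2 * \<theta> * T + C * T * h n) * (sum \<nu> S / \<nu> x0)"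
    using \<nu>[OF x0] by (simp add: field_simps)
  qed
  finally show ?thesis .
 qed
 have h0: "h \<longlonglongrightarrow> 0"
  unfolding h_def by (rule LIMSEQ_Suc[OF lim_const_over_n])
 have "?b \<longlonglongrightarrow> sqrt (exp (2 * \<theta> * T + C * T * 0) * (sum \<nu> S / \<nu> x0))"
  by (intro tendsto_intros h0)
 moreover have "\<exists>N. \<forall>n\<ge>N. integral\<^sup>L M (\<lambda>\<omega>. exp (Z n \<omega>)) \<le> ?b n"
 proof -
  have "\<forall>\<^sub>F n in sequentially. h n < 1" by (rule order_tendstoD(2)[OF h0]) simp
  then have "\<forall>\<^sub>F n in sequentially. integral\<^sup>L M (\<lambda>\<omega>. exp (Z n \<omega>)) \<le> ?b n"
   by eventually_elim (use le in auto)
  then show ?thesis by (simp add: eventually_sequentially)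
 qed
 ultimately have "integral\<^sup>L M (\<lambda>\<omega>. exp (LBINT t:{0..T}. W t (X t \<omega>)))
   \<le> sqrt (exp (2 * \<theta> * T + C * T * 0) * (sum \<nu> S / \<nu> x0))"
  by (rule LIMSEQ_le[OF dom(2)])
 also have "... = sqrt ((exp (\<theta> * T))^2 * (sum \<nu> S / \<nu> x0))"
  by (simp add: power2_eq_square flip: exp_add)
 also have "... = sqrt (sum \<nu> S / \<nu> x0) * exp (\<theta> * T)" by (simp only: real_sqrt_mult real_sqrt_abs abs_exp_cancel mult.commute)
 finally show ?le .
 show ?int by (rule dom(1))
qed

text \<open>Markov's inequality for the exponential of the integral, once for each sign s; the two
  events account for the factor 2.\<close>

theorem time_integral_tail_bound:
 assumes mc: "markov_chain_from M S L x0 X" and T: "0 < T"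
  and \<nu>: "\<And>x. x \<in> S \<Longrightarrow> 0 < \<nu> x"
  and Y: "\<And>t x. 0 \<le> t \<Longrightarrow> t \<le> T \<Longrightarrow> x \<in> S \<Longrightarrow> \<bar>Y t x\<bar> \<le> w"
  and cont: "\<And>x. x \<in> S \<Longrightarrow> continuous_on {0..T} (\<lambda>t. Y t x)"
  and \<kappa>: "0 < \<kappa>"
  and form: "\<And>t g s. 0 \<le> t \<Longrightarrow> t \<le> T \<Longrightarrow> s \<in> {1, -1} \<Longrightarrow>
   (\<Sum>x\<in>S. \<nu> x * (g x * (L g x + s * \<kappa> * Y t x * g x))) \<le> \<theta> * (\<Sum>x\<in>S. \<nu> x * (g x)^2)"
 shows "measure M {\<omega> \<in> space M. \<bar>LBINT t:{0..T}. Y t (X t \<omega>)\<bar> > \<delta>}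
   \<le> 2 * exp (\<theta> * T - \<kappa> * \<delta>) * sqrt (sum \<nu> S / \<nu> x0)"
proof -
 interpret prob_space M using mc by (simp add: markov_chain_from_def)
 let ?I = "\<lambda>\<omega>. LBINT t:{0..T}. Y t (X t \<omega>)"
 let ?B = "exp (\<theta> * T - \<kappa> * \<delta>) * sqrt (sum \<nu> S / \<nu> x0)"
 let ?A = "\<lambda>s. {\<omega> \<in> space M. exp (\<kappa> * \<delta>) \<le> exp (s * \<kappa> * ?I \<omega>)}"
 have A: "?A s \<in> sets M \<and> prob (?A s) \<le> ?B" if s: "s \<in> {1, -1 :: real}" for s
 proof -
  have I: "(LBINT t:{0..T}. s * \<kappa> * Y t (X t \<omega>)) = s * \<kappa> * ?I \<omega>" for \<omega>
   by (rule set_integral_mult_right)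
  let ?W = "\<lambda>t x. s * \<kappa> * Y t x"
  have W: "\<bar>?W t x\<bar> \<le> \<kappa> * w" if "0 \<le> t" "t \<le> T" "x \<in> S" for t x
   using Y[OF that] s \<kappa> by (auto simp: abs_mult)
  have cW: "continuous_on {0..T} (\<lambda>t. ?W t x)" if "x \<in> S" for x
   by (intro continuous_intros cont that)
  have fW: "(\<Sum>x\<in>S. \<nu> x * (g x * (L g x + ?W t x * g x))) \<le> \<theta> * (\<Sum>x\<in>S. \<nu> x * (g x)^2)"
   if "0 \<le> t" "t \<le> T" for t g
   by (rule form[OF that s])
  note fk = feynman_kac_bound[OF mc T \<nu> W cW fW]
  have m: "(\<lambda>\<omega>. exp (s * \<kappa> * ?I \<omega>)) \<in> borel_measurable M"
   using borel_measurable_integrable[OF fk(1)] unfolding I .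
  have "prob (?A s) \<le> integral\<^sup>L M (\<lambda>\<omega>. exp (s * \<kappa> * ?I \<omega>)) / exp (\<kappa> * \<delta>)"
   using fk(1) unfolding I by (intro integral_Markov_inequality_measure[where A = "{}"]) auto
  also have "... \<le> (sqrt (sum \<nu> S / \<nu> x0) * exp (\<theta> * T)) / exp (\<kappa> * \<delta>)"
   using fk(2) unfolding I by (intro divide_right_mono) auto
  also have "... = ?B" by (simp add: exp_diff)
  finally have "prob (?A s) \<le> ?B" .
  moreover have "?A s \<in> sets M" using m by measurable
  ultimately show ?thesis by simp
 qed
 have "{\<omega> \<in> space M. \<bar>?I \<omega>\<bar> > \<delta>} \<subseteq> ?A 1 \<union> ?A (-1)"
 proof
  fix \<omega> assume \<omega>: "\<omega> \<in> {\<omega> \<in> space M. \<bar>?I \<omega>\<bar> > \<delta>}"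
  then have "\<kappa> * \<delta> \<le> \<kappa> * \<bar>?I \<omega>\<bar>" using \<kappa> by simp
  then show "\<omega> \<in> ?A 1 \<union> ?A (-1)" using \<omega> by (auto simp: abs_if split: if_splits)
 qed
 then have "measure M {\<omega> \<in> space M. \<bar>?I \<omega>\<bar> > \<delta>} \<le> prob (?A 1 \<union> ?A (-1))"
  by (intro finite_measure_mono sets.Un conjunct1[OF A]) auto
 also have "... \<le> prob (?A 1) + prob (?A (-1))"
  by (intro measure_Un_le conjunct1[OF A]) auto
 also have "... \<le> ?B + ?B" by (intro add_mono conjunct2[OF A]) auto
 finally show ?thesis by (simp add: mult_ac)
qed

end

section \<open>Mean-field replacement\<close>

lemma depends_only_onD: "depends_only_on A f \<Longrightarrow> (\<And>z. z \<in> A \<Longrightarrow> \<eta> z = \<eta>' z) \<Longrightarrow> f \<eta> = f \<eta>'"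
 by (auto simp: depends_only_on_def)

text \<open>The configuration that follows \<eta> on A and \<eta>' elsewhere agrees with \<eta> on A
  and with \<eta>' on B. The lemma lets the relevant sites of a bundle be taken from a small set, a
  ball and the finite graph at once.\<close>

lemma depends_only_on_Int:
 assumes "depends_only_on A f" "depends_only_on B f"
 shows "depends_only_on (A \<inter> B) f"
 unfolding depends_only_on_def
proof (intro allI impI)
 fix \<eta> \<eta>' :: "'a config" assume eq: "\<forall>z\<in>A \<inter> B. \<eta> z = \<eta>' z"
 define \<zeta> where "\<zeta> z = (if z \<in> A then \<eta> z else \<eta>' z)" for z
 have "f \<eta> = f \<zeta>" by (rule depends_only_onD[OF assms(1)]) (simp add: \<zeta>_def)
 also have "f \<zeta> = f \<eta>'" by (rule depends_only_onD[OF assms(2)]) (use eq in \<open>auto simp: \<zeta>_def\<close>)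
 finally show "f \<eta> = f \<eta>'" .
qed

lemma depends_only_on_fun_upd:
 assumes "depends_only_on (insert a A) f"
 shows "depends_only_on A (\<lambda>\<eta>. f (\<eta>(a := b)))"
 unfolding depends_only_on_def by (intro allI impI depends_only_onD[OF assms]) auto

text \<open>Branching on the value at one site freezes that site and reduces the number of relevant
  ones.\<close>

lemma depends_only_on_measurable:
 assumes "finite A" "depends_only_on A f"
 shows "f \<in> borel_measurable (bernoulli_product \<alpha>)"
 using assms
proof (induction A arbitrary: f)
 case empty
 then have "f = (\<lambda>_. f undefined)" by (auto simp: depends_only_on_def)
 then show ?case by (metis borel_measurable_const)
next
 case (insert a A)
 have c: "(\<lambda>\<eta>. \<eta> a) \<in> bernoulli_product \<alpha> \<rightarrow>\<^sub>M count_space UNIV"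
  unfolding bernoulli_product_def
  by (rule measurable_compose[OF measurable_component_singleton[of a UNIV]]) auto
 have "(\<lambda>\<eta>. if \<eta> a then f (\<eta>(a := True)) else f (\<eta>(a := False))) \<in> borel_measurable (bernoulli_product \<alpha>)"
  by (intro measurable_If insert.IH depends_only_on_fun_upd insert.prems)
   (use c in \<open>simp add: pred_def\<close>)
 also have "(\<lambda>\<eta>. if \<eta> a then f (\<eta>(a := True)) else f (\<eta>(a := False))) = f"
 proof
  fix \<eta> show "(if \<eta> a then f (\<eta>(a := True)) else f (\<eta>(a := False))) = f \<eta>"
   by (cases "\<eta> a") (simp_all add: fun_upd_idem)
 qed
 finally show ?case .
qed

lemma bernoulli_mean_const:
 assumes "depends_only_on {} f"
 shows "bernoulli_mean f \<alpha> = f \<eta>"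
proof -
 interpret prob_space "bernoulli_product \<alpha>"
  unfolding bernoulli_product_def by (intro prob_space_PiM prob_space_measure_pmf)
 define k where "k = f \<eta>"
 have "f \<xi> = k" for \<xi> unfolding k_def by (rule depends_only_onD[OF assms]) simp
 then have "f = (\<lambda>_. k)" by (rule ext)
 then show ?thesis by (simp add: bernoulli_mean_def prob_space)
qed

text \<open>Conditions on the occupation of the site a, by splitting the product measure into the
  coordinate a and the rest.\<close>

lemma bernoulli_mean_split:
 assumes A: "finite A" "depends_only_on A f" and F: "\<And>\<eta>. \<bar>f \<eta>\<bar> \<le> F" and \<alpha>: "0 \<le> \<alpha>" "\<alpha> \<le> 1"
 shows "bernoulli_mean f \<alpha> = \<alpha> * bernoulli_mean (\<lambda>\<eta>. f (\<eta>(a := True))) \<alpha>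
      + (1 - \<alpha>) * bernoulli_mean (\<lambda>\<eta>. f (\<eta>(a := False))) \<alpha>"
proof -
 let ?b = "measure_pmf (bernoulli_pmf \<alpha>)"
 let ?N = "PiM (UNIV - {a}) (\<lambda>_. ?b)"
 let ?u = "\<lambda>(x, \<eta>). \<eta>(a := x)"
 interpret N: prob_space ?N by (intro prob_space_PiM prob_space_measure_pmf)
 interpret pair_prob_space ?b ?N ..
 have ins: "insert a (UNIV - {a}) = UNIV" by auto
 have d: "distr (?b \<Otimes>\<^sub>M ?N) (bernoulli_product \<alpha>) ?u = bernoulli_product \<alpha>"
  using distr_pair_PiM_eq_PiM[of "UNIV - {a}" "\<lambda>_. ?b" a]
  unfolding ins bernoulli_product_def by (simp add: prob_space_measure_pmf)
 have mu: "?u \<in> ?b \<Otimes>\<^sub>M ?N \<rightarrow>\<^sub>M bernoulli_product \<alpha>"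
  using measurable_fun_upd[of UNIV "UNIV - {a}" a snd "?b \<Otimes>\<^sub>M ?N" "\<lambda>_. ?b" fst] ins
  unfolding bernoulli_product_def by (simp add: case_prod_beta)
 have main: "bernoulli_mean g \<alpha> = \<alpha> * integral\<^sup>L ?N (\<lambda>\<eta>. g (\<eta>(a := True)))
   + (1 - \<alpha>) * integral\<^sup>L ?N (\<lambda>\<eta>. g (\<eta>(a := False)))"
  if "finite B" "depends_only_on B g" and G: "\<And>\<eta>. \<bar>g \<eta>\<bar> \<le> F" for g B
 proof -
  have mg: "g \<in> borel_measurable (bernoulli_product \<alpha>)" by (rule depends_only_on_measurable[OF that(1,2)])
  have m: "(\<lambda>p. g (?u p)) \<in> borel_measurable (?b \<Otimes>\<^sub>M ?N)" by (rule measurable_compose[OF mu mg])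
  have i: "integrable (?b \<Otimes>\<^sub>M ?N) (\<lambda>p. g (?u p))"
   by (rule P.integrable_const_bound[of _ F]) (use G m in auto)
  have "bernoulli_mean g \<alpha> = integral\<^sup>L (distr (?b \<Otimes>\<^sub>M ?N) (bernoulli_product \<alpha>) ?u) g"
   unfolding d bernoulli_mean_def ..
  also have "... = integral\<^sup>L (?b \<Otimes>\<^sub>M ?N) (\<lambda>p. g (?u p))" by (rule integral_distr[OF mu mg])
  also have "... = (\<integral>x. (\<integral>\<eta>. g (\<eta>(a := x)) \<partial>?N) \<partial>?b)"
   using integral_fst'[OF i] by simp
  finally show ?thesis using \<alpha> by simp
 qed
 have d1: "depends_only_on A (\<lambda>\<eta>. f (\<eta>(a := x)))" for x
  using A(2) by (auto simp: depends_only_on_def)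
 \<comment> \<open>For a function with the site a frozen both integrals in \<open>main\<close>
   coincide, so the integrals over the remaining coordinates are themselves Bernoulli means.\<close>
 show ?thesis
  using main[OF A F] main[OF A(1) d1[of True] F] main[OF A(1) d1[of False] F]
  by (simp add: algebra_simps)
qed

section \<open>Exchanges, flips and exchange-antisymmetric observables\<close>

lemma exchange_exchange [simp]: "exchange x y (exchange x y \<eta>) = \<eta>"
 by (auto simp: exchange_def)

lemma exchange_configs: "x \<in> V \<Longrightarrow> y \<in> V \<Longrightarrow> \<eta> \<in> configs V \<Longrightarrow> exchange x y \<eta> \<in> configs V"
 by (auto simp: configs_def exchange_def PiE_def extensional_def)

lemma flip_flip [simp]: "flip a (flip a \<eta>) = \<eta>"
 by (auto simp: flip_def)

lemma flip_configs: "a \<in> V \<Longrightarrow> \<eta> \<in> configs V \<Longrightarrow> flip a \<eta> \<in> configs V"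
 by (auto simp: configs_def flip_def PiE_def extensional_def)

lemma finite_configs: "finite V \<Longrightarrow> finite (configs V)"
 by (auto simp: configs_def intro: finite_PiE)

lemma sum_exchange:
 "x \<in> V \<Longrightarrow> y \<in> V \<Longrightarrow> (\<Sum>\<eta>\<in>configs V. F (exchange x y \<eta>)) = (\<Sum>\<eta>\<in>configs V. F \<eta>)"
 by (rule sum.reindex_bij_witness[of _ "exchange x y" "exchange x y"]) (auto intro: exchange_configs)

lemma sum_flip:
 "a \<in> V \<Longrightarrow> (\<Sum>\<eta>\<in>configs V. F (flip a \<eta>)) = (\<Sum>\<eta>\<in>configs V. F \<eta>)"
 by (rule sum.reindex_bij_witness[of _ "flip a" "flip a"]) (auto intro: flip_configs)

definition swap_form :: "'v set \<Rightarrow> ('v config \<Rightarrow> real) \<Rightarrow> 'v \<Rightarrow> 'v \<Rightarrow> real" where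
 "swap_form V h y z = (\<Sum>\<eta>\<in>configs V. (h (exchange y z \<eta>) - h \<eta>)^2)"

lemma swap_form_nonneg: "0 \<le> swap_form V h y z"
 by (simp add: swap_form_def sum_nonneg)

text \<open>Averaging the sum with its image under the exchange e replaces \<open>h^2\<close> by
  half of the difference between \<open>h^2\<close> and its image, which factors as a difference
  times a sum. Cauchy-Schwarz bounds this; the sum has norm at most twice that of h, which cancels
  the half.\<close>

lemma antisymmetric_sum_bound:
 assumes a: "a \<in> V" "z \<in> V"
  and anti: "\<And>\<eta>. G (exchange a z \<eta>) = - G \<eta>" and G: "\<And>\<eta>. \<bar>G \<eta>\<bar> \<le> g"
 shows "\<bar>\<Sum>\<eta>\<in>configs V. G \<eta> * (h \<eta>)^2\<bar> \<le> g * (sqrt (swap_form V h a z) * sqrt (\<Sum>\<eta>\<in>configs V. (h \<eta>)^2))"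
proof -
 let ?S = "configs V" and ?e = "exchange a z"
 have g: "0 \<le> g" using G[of undefined] by linarith
 have "(\<Sum>\<eta>\<in>?S. G \<eta> * (h \<eta>)^2) = (\<Sum>\<eta>\<in>?S. - G \<eta> * (h (?e \<eta>))^2)"
  using sum_exchange[OF a, of "\<lambda>\<eta>. G \<eta> * (h \<eta>)^2"] by (simp only: anti)
 then have "2 * (\<Sum>\<eta>\<in>?S. G \<eta> * (h \<eta>)^2) = (\<Sum>\<eta>\<in>?S. G \<eta> * (h \<eta>)^2) + (\<Sum>\<eta>\<in>?S. - G \<eta> * (h (?e \<eta>))^2)"
  by linarith
 also have "... = (\<Sum>\<eta>\<in>?S. - G \<eta> * ((h (?e \<eta>) - h \<eta>) * (h (?e \<eta>) + h \<eta>)))"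
  unfolding sum.distrib[symmetric] by (intro sum.cong refl) (simp add: power2_eq_square algebra_simps)
 finally have double: "2 * (\<Sum>\<eta>\<in>?S. G \<eta> * (h \<eta>)^2)
   = (\<Sum>\<eta>\<in>?S. - G \<eta> * ((h (?e \<eta>) - h \<eta>) * (h (?e \<eta>) + h \<eta>)))" .
 have "2 * \<bar>\<Sum>\<eta>\<in>?S. G \<eta> * (h \<eta>)^2\<bar> = \<bar>2 * (\<Sum>\<eta>\<in>?S. G \<eta> * (h \<eta>)^2)\<bar>"
  by (simp only: abs_mult abs_numeral)
 also have "... = \<bar>\<Sum>\<eta>\<in>?S. - G \<eta> * ((h (?e \<eta>) - h \<eta>) * (h (?e \<eta>) + h \<eta>))\<bar>"
  by (simp only: double)
 also have "... \<le> (\<Sum>\<eta>\<in>?S. g * (\<bar>h (?e \<eta>) - h \<eta>\<bar> * \<bar>h (?e \<eta>) + h \<eta>\<bar>))"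
  by (rule order_trans[OF sum_abs], rule sum_mono) (use G in \<open>auto simp: abs_mult intro!: mult_right_mono\<close>)
 also have "... = g * (\<Sum>\<eta>\<in>?S. \<bar>h (?e \<eta>) - h \<eta>\<bar> * \<bar>h (?e \<eta>) + h \<eta>\<bar>)"
  by (simp add: sum_distrib_left)
 also have "... \<le> g * (L2_set (\<lambda>\<eta>. h (?e \<eta>) - h \<eta>) ?S * L2_set (\<lambda>\<eta>. h (?e \<eta>) + h \<eta>) ?S)"
  by (intro mult_left_mono L2_set_mult_ineq g)
 also have "... \<le> g * (sqrt (swap_form V h a z) * (2 * sqrt (\<Sum>\<eta>\<in>?S. (h \<eta>)^2)))"
 proof (intro mult_left_mono mult_mono g)
  have "(\<Sum>\<eta>\<in>?S. (h (?e \<eta>) + h \<eta>)^2) \<le> (\<Sum>\<eta>\<in>?S. 2 * (h (?e \<eta>))^2 + 2 * (h \<eta>)^2)"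
  proof (rule sum_mono)
   fix \<eta>
   have "0 \<le> (h (?e \<eta>) - h \<eta>)^2" by simp
   then show "(h (?e \<eta>) + h \<eta>)^2 \<le> 2 * (h (?e \<eta>))^2 + 2 * (h \<eta>)^2"
    by (simp add: power2_eq_square algebra_simps)
  qed
  also have "... = 2^2 * (\<Sum>\<eta>\<in>?S. (h \<eta>)^2)"
   using sum_exchange[OF a, of "\<lambda>\<eta>. (h \<eta>)^2"] by (simp only: sum.distrib sum_distrib_left[symmetric]) simp
  finally have "sqrt (\<Sum>\<eta>\<in>?S. (h (?e \<eta>) + h \<eta>)^2) \<le> sqrt (2^2 * (\<Sum>\<eta>\<in>?S. (h \<eta>)^2))"
   by (rule real_sqrt_le_mono)
  then show "L2_set (\<lambda>\<eta>. h (?e \<eta>) + h \<eta>) ?S \<le> 2 * sqrt (\<Sum>\<eta>\<in>?S. (h \<eta>)^2)"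
   by (simp add: L2_set_def real_sqrt_mult)
 next
  show "L2_set (\<lambda>\<eta>. h (?e \<eta>) - h \<eta>) ?S \<le> sqrt (swap_form V h a z)"
   by (simp only: L2_set_def swap_form_def order_refl)
 qed (simp_all only: L2_set_nonneg real_sqrt_ge_zero swap_form_nonneg)
 also have "... = 2 * (g * (sqrt (swap_form V h a z) * sqrt (\<Sum>\<eta>\<in>?S. (h \<eta>)^2)))"
  by (simp only: mult_ac)
 finally show ?thesis by linarith
qed

lemma Av_bounds: "0 \<le> Av B \<eta>" "Av B \<eta> \<le> 1"
proof -
 show "0 \<le> Av B \<eta>" by (simp add: Av_def sum_nonneg)
 have "(\<Sum>z\<in>B. of_bool (\<eta> z) :: real) \<le> (\<Sum>z\<in>B. 1)" by (rule sum_mono) simp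
 then show "Av B \<eta> \<le> 1" by (simp add: Av_def divide_le_eq)
qed

lemma Av_exchange:
 assumes "y \<in> B" "z \<in> B"
 shows "Av B (exchange y z \<eta>) = Av B \<eta>"
proof -
 have "(\<Sum>x\<in>B. of_bool (exchange y z \<eta> x) :: real) = (\<Sum>x\<in>B. of_bool (\<eta> x))"
  by (rule sum.reindex_bij_witness[of _ "(\<lambda>x. if x = y then z else if x = z then y else x)" "(\<lambda>x. if x = y then z else if x = z then y else x)"])
   (use assms in \<open>auto simp: exchange_def\<close>)
 then show ?thesis by (simp add: Av_def)
qed

text \<open>Induction on the relevant sites. Removing a site a leaves one error for replacing
  \<open>\<eta> a\<close> by the average, plus two instances with a frozen, whose extra weights
  \<open>Av\<close> and \<open>1 - Av\<close> are exchange invariant on B. This is why the statement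
  carries a weight \<psi>, and the count 1 + 2 * (previous count) yields
  \<open>2 ^ card A - 1\<close>. The bound K is kept apart from \<open>card A\<close> so that the
  error per step stays the same throughout the induction.\<close>

theorem mean_field_replacement:
 assumes V: "finite V" "B \<subseteq> V"
  and \<theta>: "0 \<le> \<theta>" "\<And>y z. y \<in> B \<Longrightarrow> z \<in> B \<Longrightarrow> swap_form V h y z \<le> \<theta>^2"
  and A: "finite A" "A \<subseteq> B" "card A \<le> K" "depends_only_on A f" and F: "\<And>\<eta>. \<bar>f \<eta>\<bar> \<le> F"
  and \<psi>: "\<And>\<eta>. \<bar>\<psi> \<eta>\<bar> \<le> 1" "\<And>y z \<eta>. y \<in> B \<Longrightarrow> z \<in> B \<Longrightarrow> \<psi> (exchange y z \<eta>) = \<psi> \<eta>"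
 shows "\<bar>\<Sum>\<eta>\<in>configs V. \<psi> \<eta> * (f \<eta> - bernoulli_mean f (Av B \<eta>)) * (h \<eta>)^2\<bar>
   \<le> (2 ^ card A - 1) * (2 * F * (real K / real (card B) * (\<Sum>\<eta>\<in>configs V. (h \<eta>)^2)
      + \<theta> * sqrt (\<Sum>\<eta>\<in>configs V. (h \<eta>)^2)))"
 using A F \<psi>
proof (induction A arbitrary: f \<psi>)
 case empty
 have "f \<eta> - bernoulli_mean f (Av B \<eta>) = 0" for \<eta>
  using bernoulli_mean_const[OF empty.prems(3), of "Av B \<eta>" \<eta>] by linarith
 then have "(\<Sum>\<eta>\<in>configs V. \<psi> \<eta> * (f \<eta> - bernoulli_mean f (Av B \<eta>)) * (h \<eta>)^2) = 0"
  by (intro sum.neutral ballI) (simp only: mult_zero_right mult_zero_left)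
 then show ?case by simp
next
 case (insert a A)
 let ?S = "configs V"
 define n where "n = (\<Sum>\<eta>\<in>?S. (h \<eta>)^2)"
 have n: "0 \<le> n" by (simp add: n_def sum_nonneg)
 have F0: "0 \<le> F" using insert.prems(4)[of undefined] by linarith
 define c0 where "c0 = 2 * F * (real K / real (card B) * n + \<theta> * sqrt n)"
 let ?f = "\<lambda>b \<eta>. f (\<eta>(a := b))"
 let ?q = "\<lambda>\<eta>. ?f True \<eta> - ?f False \<eta>"
 let ?av = "Av B"
 have fin: "finite B" using V finite_subset by blast
 have aB: "a \<in> B" "A \<subseteq> B" and cA: "card A \<le> K" using insert.hyps insert.prems(1,2) by auto
 have cB: "0 < card B" using aB fin card_gt_0_iff by blast
 have dq: "depends_only_on A (?f b)" for b by (rule depends_only_on_fun_upd[OF insert.prems(3)])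
 have dq2: "depends_only_on A ?q"
  unfolding depends_only_on_def
 proof (intro allI impI)
  fix \<eta> \<eta>' :: "'a config" assume "\<forall>z\<in>A. \<eta> z = \<eta>' z"
  then have "?f b \<eta> = ?f b \<eta>'" for b by (intro depends_only_onD[OF dq]) auto
  then show "?q \<eta> = ?q \<eta>'" by metis
 qed
 have q: "\<bar>?q \<eta>\<bar> \<le> 2 * F" for \<eta>
  using insert.prems(4)[of "\<eta>(a := True)"] insert.prems(4)[of "\<eta>(a := False)"] by linarith
 \<comment> \<open>Both f and its Bernoulli mean are split at the site a: f with weight
   \<open>\<eta> a\<close>, the mean with weight \<open>?av \<eta>\<close>. The discrepancy of the
   two weights multiplies the discrete derivative \<open>?q\<close>.\<close>
 have dec: "\<psi> \<eta> * (f \<eta> - bernoulli_mean f (?av \<eta>)) * (h \<eta>)^2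
   = \<psi> \<eta> * (of_bool (\<eta> a) - ?av \<eta>) * ?q \<eta> * (h \<eta>)^2
    + (\<psi> \<eta> * ?av \<eta>) * (?f True \<eta> - bernoulli_mean (?f True) (?av \<eta>)) * (h \<eta>)^2
    + (\<psi> \<eta> * (1 - ?av \<eta>)) * (?f False \<eta> - bernoulli_mean (?f False) (?av \<eta>)) * (h \<eta>)^2" for \<eta>
 proof -
  have f: "f \<eta> = ?f False \<eta> + of_bool (\<eta> a) * ?q \<eta>"
   by (cases "\<eta> a") (auto simp: fun_upd_idem)
  have b: "bernoulli_mean f (?av \<eta>) = ?av \<eta> * bernoulli_mean (?f True) (?av \<eta>)
    + (1 - ?av \<eta>) * bernoulli_mean (?f False) (?av \<eta>)"
   by (rule bernoulli_mean_split[of "insert a A"]) (use insert.hyps insert.prems Av_bounds in auto)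
  show ?thesis unfolding b by (subst f) (simp add: algebra_simps)
 qed
 have t1: "\<bar>\<Sum>\<eta>\<in>?S. \<psi> \<eta> * (of_bool (\<eta> a) - ?av \<eta>) * ?q \<eta> * (h \<eta>)^2\<bar> \<le> c0"
 proof -
  let ?G = "\<lambda>z \<eta>. \<psi> \<eta> * (of_bool (\<eta> a) - of_bool (\<eta> z)) * ?q \<eta>"
  have G: "\<bar>?G z \<eta>\<bar> \<le> 2 * F" for z \<eta>
  proof -
   have "\<bar>\<psi> \<eta>\<bar> * \<bar>of_bool (\<eta> a) - of_bool (\<eta> z)\<bar> * \<bar>?q \<eta>\<bar> \<le> 1 * 1 * (2 * F)"
    by (intro mult_mono insert.prems q) auto
   then show ?thesis by (simp add: abs_mult)
  qed
  \<comment> \<open>If z is in A, then \<open>?q\<close> may change under the exchange of a and z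
    and antisymmetry is lost. Such z get the trivial bound; they are at most K of the
    \<open>card B\<close> sites, whence \<open>K / card B\<close>.\<close>
  have each: "\<bar>\<Sum>\<eta>\<in>?S. ?G z \<eta> * (h \<eta>)^2\<bar> \<le> 2 * F * (\<theta> * sqrt n) + 2 * F * n * of_bool (z \<in> A)"
   if z: "z \<in> B" for z
  proof (cases "z \<in> A")
   case True
   have "\<bar>\<Sum>\<eta>\<in>?S. ?G z \<eta> * (h \<eta>)^2\<bar> \<le> (\<Sum>\<eta>\<in>?S. 2 * F * (h \<eta>)^2)"
    by (rule order_trans[OF sum_abs], rule sum_mono)
     (unfold abs_mult[of "?G z _"], intro mult_mono G, auto simp: F0)
   also have "... = 2 * F * n" by (simp add: n_def sum_distrib_left)
   moreover have "0 \<le> 2 * F * (\<theta> * sqrt n)" using F0 n \<theta>(1) by simp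
   ultimately show ?thesis using True by simp
  next
   case False
   have "\<bar>\<Sum>\<eta>\<in>?S. ?G z \<eta> * (h \<eta>)^2\<bar> \<le> 2 * F * (sqrt (swap_form V h a z) * sqrt n)"
    unfolding n_def
   proof (rule antisymmetric_sum_bound)
    fix \<eta>
    have "?q (exchange a z \<eta>) = ?q \<eta>"
     by (rule depends_only_onD[OF dq2]) (use False insert.hyps in \<open>auto simp: exchange_def\<close>)
    moreover have "\<psi> (exchange a z \<eta>) = \<psi> \<eta>" by (rule insert.prems(6)[OF aB(1) z])
    moreover have "exchange a z \<eta> a = \<eta> z" "exchange a z \<eta> z = \<eta> a" by (simp_all add: exchange_def)
    ultimately have "?G z (exchange a z \<eta>) = \<psi> \<eta> * (of_bool (\<eta> z) - of_bool (\<eta> a)) * ?q \<eta>"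
     by (simp only:)
    also have "... = - ?G z \<eta>" by (simp add: algebra_simps)
    finally show "?G z (exchange a z \<eta>) = - ?G z \<eta>" .
   qed (use V aB z G in auto)
   also have "... \<le> 2 * F * (\<theta> * sqrt n)"
   proof (intro mult_left_mono mult_right_mono)
    show "sqrt (swap_form V h a z) \<le> \<theta>" by (intro real_le_lsqrt \<theta> aB z)
   qed (use n F0 in auto)
   finally show ?thesis using False by simp
  qed
  have "(\<Sum>\<eta>\<in>?S. \<psi> \<eta> * (of_bool (\<eta> a) - ?av \<eta>) * ?q \<eta> * (h \<eta>)^2)
    = (\<Sum>\<eta>\<in>?S. (\<Sum>z\<in>B. ?G z \<eta> * (h \<eta>)^2) / real (card B))"
  proof (intro sum.cong refl)
   fix \<eta>
   have "(\<Sum>z\<in>B. ?G z \<eta> * (h \<eta>)^2) = \<psi> \<eta> * (\<Sum>z\<in>B. of_bool (\<eta> a) - of_bool (\<eta> z)) * ?q \<eta> * (h \<eta>)^2"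
    by (simp only: sum_distrib_left sum_distrib_right)
   also have "(\<Sum>z\<in>B. of_bool (\<eta> a) - of_bool (\<eta> z)) = real (card B) * (of_bool (\<eta> a) - ?av \<eta>)"
    using cB by (simp add: sum_subtractf Av_def algebra_simps)
   finally have e: "(\<Sum>z\<in>B. ?G z \<eta> * (h \<eta>)^2)
     = real (card B) * (\<psi> \<eta> * (of_bool (\<eta> a) - ?av \<eta>) * ?q \<eta> * (h \<eta>)^2)"
    by (simp only: mult_ac)
   show "\<psi> \<eta> * (of_bool (\<eta> a) - ?av \<eta>) * ?q \<eta> * (h \<eta>)^2 = (\<Sum>z\<in>B. ?G z \<eta> * (h \<eta>)^2) / real (card B)"
    unfolding e using cB by (intro nonzero_mult_div_cancel_left[symmetric]) simp
  qed
  also have "... = (\<Sum>z\<in>B. \<Sum>\<eta>\<in>?S. ?G z \<eta> * (h \<eta>)^2) / real (card B)"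
   by (subst sum.swap) (rule sum_divide_distrib[symmetric])
  finally have "\<bar>\<Sum>\<eta>\<in>?S. \<psi> \<eta> * (of_bool (\<eta> a) - ?av \<eta>) * ?q \<eta> * (h \<eta>)^2\<bar>
    = \<bar>\<Sum>z\<in>B. \<Sum>\<eta>\<in>?S. ?G z \<eta> * (h \<eta>)^2\<bar> / real (card B)" by simp
  also have "... \<le> (\<Sum>z\<in>B. 2 * F * (\<theta> * sqrt n) + 2 * F * n * of_bool (z \<in> A)) / real (card B)"
   by (intro divide_right_mono order_trans[OF sum_abs] sum_mono each) auto
  finally have 1: "\<bar>\<Sum>\<eta>\<in>?S. \<psi> \<eta> * (of_bool (\<eta> a) - ?av \<eta>) * ?q \<eta> * (h \<eta>)^2\<bar>
    \<le> (\<Sum>z\<in>B. 2 * F * (\<theta> * sqrt n) + 2 * F * n * of_bool (z \<in> A)) / real (card B)" .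
  have 2: "(\<Sum>z\<in>B. 2 * F * (\<theta> * sqrt n) + 2 * F * n * of_bool (z \<in> A))
    = real (card B) * (2 * F * (\<theta> * sqrt n)) + 2 * F * n * real (card A)"
  proof -
   have "(\<Sum>z\<in>B. of_bool (z \<in> A) :: real) = real (card A)"
    using aB fin by (simp add: Int_absorb1)
   then show ?thesis by (simp only: sum.distrib sum_distrib_left[symmetric]) simp
  qed
  have "2 * F * n * real (card A) \<le> 2 * F * n * real K"
   using cA F0 n by (simp add: mult_left_mono)
  then have 3: "(real (card B) * (2 * F * (\<theta> * sqrt n)) + 2 * F * n * real (card A)) / real (card B)
    \<le> (real (card B) * (2 * F * (\<theta> * sqrt n)) + 2 * F * n * real K) / real (card B)"
   by (simp only: divide_right_mono add_left_mono of_nat_0_le_iff)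
  have "(real (card B) * (2 * F * (\<theta> * sqrt n)) + 2 * F * n * real K) / real (card B)
    = 2 * F * (\<theta> * sqrt n) + 2 * F * n * real K / real (card B)"
   using cB by (simp add: add_divide_distrib)
  then have 4: "(real (card B) * (2 * F * (\<theta> * sqrt n)) + 2 * F * n * real K) / real (card B) = c0"
   unfolding c0_def by (simp add: distrib_left)
  show ?thesis by (rule order_trans[OF 1[unfolded 2] 3[unfolded 4]])
 qed
 have sub: "\<bar>\<Sum>\<eta>\<in>?S. (\<psi> \<eta> * s \<eta>) * (?f b \<eta> - bernoulli_mean (?f b) (?av \<eta>)) * (h \<eta>)^2\<bar> \<le> (2 ^ card A - 1) * c0"
  if s: "\<And>\<eta>. 0 \<le> s \<eta> \<and> s \<eta> \<le> 1" "\<And>y z \<eta>. y \<in> B \<Longrightarrow> z \<in> B \<Longrightarrow> s (exchange y z \<eta>) = s \<eta>" for b s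
  unfolding c0_def n_def
 proof (rule insert.IH[OF aB(2) cA dq insert.prems(4)])
  fix \<eta>
  have "\<bar>\<psi> \<eta>\<bar> * \<bar>s \<eta>\<bar> \<le> 1 * 1" using s(1)[of \<eta>] by (intro mult_mono insert.prems) auto
  then show "\<bar>\<psi> \<eta> * s \<eta>\<bar> \<le> 1" by (simp add: abs_mult)
 next
  fix y z \<eta> assume "y \<in> B" "z \<in> B"
  then show "\<psi> (exchange y z \<eta>) * s (exchange y z \<eta>) = \<psi> \<eta> * s \<eta>"
   using s(2) insert.prems(6) by simp
 qed
 have t2: "\<bar>\<Sum>\<eta>\<in>?S. (\<psi> \<eta> * ?av \<eta>) * (?f True \<eta> - bernoulli_mean (?f True) (?av \<eta>)) * (h \<eta>)^2\<bar> \<le> (2 ^ card A - 1) * c0"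
  by (rule sub) (auto simp: Av_bounds Av_exchange)
 have t3: "\<bar>\<Sum>\<eta>\<in>?S. (\<psi> \<eta> * (1 - ?av \<eta>)) * (?f False \<eta> - bernoulli_mean (?f False) (?av \<eta>)) * (h \<eta>)^2\<bar> \<le> (2 ^ card A - 1) * c0"
  by (rule sub) (auto simp: Av_bounds Av_exchange)
 have "\<bar>\<Sum>\<eta>\<in>?S. \<psi> \<eta> * (f \<eta> - bernoulli_mean f (?av \<eta>)) * (h \<eta>)^2\<bar> \<le> c0 + (2 ^ card A - 1) * c0 + (2 ^ card A - 1) * c0"
  unfolding dec sum.distrib
  by (intro order_trans[OF abs_triangle_ineq] add_mono t1 t2 t3)
 also have "... = (2 ^ card (insert a A) - 1) * c0"
  using insert.hyps by (simp add: algebra_simps)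
 finally show ?case by (simp add: c0_def n_def)
qed

section \<open>The moving particle lemma\<close>

lemma energy_nonneg: "(\<And>x y. 0 \<le> c x y) \<Longrightarrow> 0 \<le> energy V c h"
 unfolding energy_def by (intro divide_nonneg_pos sum_nonneg) auto

text \<open>For symmetric c, twice the Dirichlet form of the exclusion generator with respect to
  counting measure.\<close>

definition swap_energy :: "'v set \<Rightarrow> ('v \<Rightarrow> 'v \<Rightarrow> real) \<Rightarrow> ('v config \<Rightarrow> real) \<Rightarrow> real" where
 "swap_energy V c h = (\<Sum>x\<in>V. \<Sum>y\<in>V. c x y * swap_form V h x y) / 2"

lemma sqrt_swap_form: "sqrt (swap_form V h x y) = L2_set (\<lambda>\<eta>. h (exchange x y \<eta>) - h \<eta>) (configs V)"
 by (simp add: swap_form_def L2_set_def)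

lemma L2_set_comp_exchange:
 assumes "x \<in> V" "y \<in> V"
 shows "L2_set (\<lambda>\<eta>. F (exchange x y \<eta>)) (configs V) = L2_set F (configs V)"
 unfolding L2_set_def using sum_exchange[OF assms, of "\<lambda>\<eta>. (F \<eta>)^2"] by simp

text \<open>Exchanging \<open>y\<close> and \<open>w\<close> amounts to exchanging \<open>x\<close> and \<open>w\<close>, then \<open>y\<close> and \<open>x\<close>, then \<open>x\<close> and \<open>w\<close>.\<close>

lemma sqrt_swap_form_triangle:
 assumes V: "y \<in> V" "x \<in> V" "w \<in> V"
 shows "sqrt (swap_form V h y w) \<le> sqrt (swap_form V h y x) + 2 * sqrt (swap_form V h x w)"
proof (cases "y = x \<or> y = w \<or> x = w")
 case True
 have "sqrt (swap_form V h z z) = 0" for z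
  by (simp add: swap_form_def exchange_def)
 moreover have "0 \<le> sqrt (swap_form V h p q)" for p q by (simp add: swap_form_nonneg)
 ultimately show ?thesis using True by (elim disjE) (simp_all add: add_nonneg_nonneg)
next
 case False
 let ?e = "exchange x w" and ?f = "exchange y x" and ?S = "configs V"
 have conj: "exchange y w \<eta> = ?e (?f (?e \<eta>))" for \<eta>
  using False by (auto simp: exchange_def fun_eq_iff)
 have "sqrt (swap_form V h y w)
   = L2_set (\<lambda>\<eta>. (h (?e (?f (?e \<eta>))) - h (?f (?e \<eta>))) + ((h (?f (?e \<eta>)) - h (?e \<eta>)) + (h (?e \<eta>) - h \<eta>))) ?S"
  unfolding sqrt_swap_form conj by simp
 also have "... \<le> L2_set (\<lambda>\<eta>. h (?e (?f (?e \<eta>))) - h (?f (?e \<eta>))) ?S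
   + (L2_set (\<lambda>\<eta>. h (?f (?e \<eta>)) - h (?e \<eta>)) ?S + L2_set (\<lambda>\<eta>. h (?e \<eta>) - h \<eta>) ?S)"
  by (intro order_trans[OF L2_set_triangle_ineq] add_left_mono L2_set_triangle_ineq)
 also have "L2_set (\<lambda>\<eta>. h (?e (?f (?e \<eta>))) - h (?f (?e \<eta>))) ?S = L2_set (\<lambda>\<eta>. h (?e \<eta>) - h \<eta>) ?S"
  using L2_set_comp_exchange[OF V(2,3), of "\<lambda>\<eta>. h (?e (?f \<eta>)) - h (?f \<eta>)"]
   L2_set_comp_exchange[OF V(1,2), of "\<lambda>\<eta>. h (?e \<eta>) - h \<eta>"] by simp
 also have "L2_set (\<lambda>\<eta>. h (?f (?e \<eta>)) - h (?e \<eta>)) ?S = L2_set (\<lambda>\<eta>. h (?f \<eta>) - h \<eta>) ?S"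
  by (rule L2_set_comp_exchange[OF V(2,3)])
 finally show ?thesis by (simp add: sqrt_swap_form)
qed

text \<open>Inversion is an involution on nonnegative extended reals, including 0 and infinity; for
  y = z both sides are infinite.\<close>

lemma inverse_R_eff:
 assumes "\<And>x y. 0 \<le> c x y"
 shows "inverse (R_eff V c y z) = (INF h\<in>{h. h y = 1 \<and> h z = 0}. ereal (energy V c h))" (is "_ = ?I")
proof -
 have "0 \<le> ?I" by (intro INF_greatest) (simp add: energy_nonneg assms)
 moreover have "inverse (inverse e) = e" if "0 \<le> e" for e :: ereal
  using that by (cases e) auto
 ultimately show ?thesis unfolding R_eff_def by blast
qed

text \<open>Moving particle lemma, with constant \<open>4\<close>: by \<open>sqrt_swap_form_triangle\<close>
 \<open>x \<mapsto> sqrt (swap_form V h y x)\<close> is an admissible test function for the effective resistance.\<close>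

lemma moving_particle:
 assumes c: "\<And>x y. 0 \<le> c x y" "\<And>x y. c x y = c y x"
  and V: "y \<in> V" "z \<in> V"
  and R: "ereal M \<le> ereal s * inverse (R_eff V c y z)" and s: "0 < s"
 shows "M * swap_form V h y z \<le> 4 * s * swap_energy V c h"
proof (cases "swap_form V h y z = 0")
 \<comment> \<open>Includes y = z. In the other case \<open>u z\<close> is positive and normalizes
   the test function t.\<close>
 case True
 have "0 \<le> swap_energy V c h"
  unfolding swap_energy_def by (intro divide_nonneg_pos sum_nonneg mult_nonneg_nonneg c swap_form_nonneg) auto
 then show ?thesis using True s by simp
next
 case False
 define u where "u x = sqrt (swap_form V h y x)" for x
 have m: "0 < swap_form V h y z" using False swap_form_nonneg[of V h y z] by linarith
 have uz: "0 < u z" "(u z)^2 = swap_form V h y z" using m by (auto simp: u_def)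
 have uy: "u y = 0" by (simp add: u_def swap_form_def exchange_def)
 define t where "t x = 1 - u x / u z" for x
 have mem: "t \<in> {h. h y = 1 \<and> h z = 0}" using uy uz by (simp add: t_def)
 have lip: "(u x - u w)^2 \<le> 4 * swap_form V h x w" if xw: "x \<in> V" "w \<in> V" for x w
 proof -
  have sym: "swap_form V h w x = swap_form V h x w"
  proof -
   have "exchange w x \<eta> = exchange x w \<eta>" for \<eta> :: "'a config" 
    by (cases "w = x") (auto simp: exchange_def fun_upd_twist)
   then show ?thesis by (simp add: swap_form_def)
  qed
  \<comment> \<open>The triangle inequality is used from x to w and from w to x; its factor 2
    becomes the constant 4 after squaring.\<close>
  have "\<bar>u x - u w\<bar> \<le> \<bar>2 * sqrt (swap_form V h x w)\<bar>"
   using sqrt_swap_form_triangle[OF V(1) xw, of h] real_sqrt_ge_zero[OF swap_form_nonneg[of V h x w]]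
    sqrt_swap_form_triangle[OF V(1) xw(2,1), of h, unfolded sym]
   unfolding u_def by linarith
  then have "(u x - u w)^2 \<le> (2 * sqrt (swap_form V h x w))^2" by (rule abs_le_square_iff[THEN iffD1])
  then show ?thesis by (simp add: power_mult_distrib swap_form_nonneg)
 qed
 have tu: "energy V c t = energy V c u / (u z)^2"
 proof -
  have "c x w * (t x - t w)^2 = c x w * (u x - u w)^2 / (u z)^2" for x w
   unfolding t_def by (simp add: power2_commute[of "u w"] power_divide flip: diff_divide_distrib)
  then show ?thesis unfolding energy_def by (simp flip: sum_divide_distrib)
 qed
 have eu: "energy V c u \<le> 4 * swap_energy V c h"
 proof -
  have "(\<Sum>x\<in>V. \<Sum>w\<in>V. c x w * (u x - u w)^2) \<le> (\<Sum>x\<in>V. \<Sum>w\<in>V. 4 * (c x w * swap_form V h x w))"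
   using lip by (intro sum_mono) (auto simp: mult.left_commute intro!: mult_left_mono c)
  also have "... = 4 * (\<Sum>x\<in>V. \<Sum>w\<in>V. c x w * swap_form V h x w)"
   by (simp add: sum_distrib_left)
  finally show ?thesis unfolding energy_def swap_energy_def by simp
 qed
 have et: "energy V c t \<le> 4 * swap_energy V c h / (u z)^2"
  unfolding tu by (intro divide_right_mono eu) simp
 have "inverse (R_eff V c y z) \<le> ereal (energy V c t)"
  unfolding inverse_R_eff[OF c(1)] by (rule INF_lower[OF mem])
 then have "ereal s * inverse (R_eff V c y z) \<le> ereal s * ereal (energy V c t)"
  using s by (intro ereal_mult_left_mono) auto
 with R have "ereal M \<le> ereal s * ereal (energy V c t)" by (rule order_trans)
 then have "M \<le> s * energy V c t" by simp
 also have "... \<le> s * (4 * swap_energy V c h / (u z)^2)" using et s by (intro mult_left_mono) auto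
 finally show ?thesis using uz m by (simp add: field_simps)
qed

section \<open>Dirichlet forms with respect to the stationary profile\<close>

text \<open>Here \<rho> is any profile that solves the one-site stationarity equations and stays
  \<beta> away from 0 and 1; the invariant measure itself does not appear.\<close>

locale driven_exclusion =
 fixes V :: "'v set" and c :: "'v \<Rightarrow> 'v \<Rightarrow> real" and bd :: "'v set"
  and lamP lamM :: "'v \<Rightarrow> real" and \<rho> :: "'v \<Rightarrow> real" and \<beta> :: real
 assumes finite_V: "finite V" and c_sym: "c x y = c y x" and c_nonneg: "0 \<le> c x y"
  and bd: "bd \<subseteq> V" and lam: "a \<in> bd \<Longrightarrow> 0 \<le> lamP a" "a \<in> bd \<Longrightarrow> 0 \<le> lamM a"
  and \<beta>: "0 < \<beta>" and \<rho>_bounds: "x \<in> V \<Longrightarrow> \<beta> \<le> \<rho> x" "x \<in> V \<Longrightarrow> \<beta> \<le> 1 - \<rho> x"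
  and harmonic: "x \<in> V - bd \<Longrightarrow> flow V c \<rho> x = 0"
  and stationary: "a \<in> bd \<Longrightarrow> flow V c \<rho> a = (lamP a + lamM a) * \<rho> a - lamP a"
begin

definition wt :: "'v \<Rightarrow> bool \<Rightarrow> real" where
 "wt x b = (if b then \<rho> x else 1 - \<rho> x)"

definition \<nu> :: "'v config \<Rightarrow> real" where
 "\<nu> \<eta> = (\<Prod>x\<in>V. wt x (\<eta> x))"

text \<open>The derivative of \<open>ln (wt x b)\<close> with respect to the density at x, the score
  of a Bernoulli variable.\<close>

definition om :: "'v \<Rightarrow> bool \<Rightarrow> real" where
 "om x b = (if b then 1 / \<rho> x else - 1 / (1 - \<rho> x))"

definition rate :: "'v \<Rightarrow> 'v config \<Rightarrow> real" where
 "rate a \<eta> = lamM a * of_bool (\<eta> a) + lamP a * (1 - of_bool (\<eta> a))"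

abbreviation gen where "gen \<equiv> L_bEX V c bd lamP lamM"

abbreviation normsq where "normsq g \<equiv> (\<Sum>\<eta>\<in>configs V. \<nu> \<eta> * (g \<eta>)^2)"

definition swap_dirichlet :: "('v config \<Rightarrow> real) \<Rightarrow> real" where
 "swap_dirichlet g =
   (\<Sum>x\<in>V. \<Sum>y\<in>V. c x y * (\<Sum>\<eta>\<in>configs V. \<nu> \<eta> * (g (exchange x y \<eta>) - g \<eta>)^2)) / 2"

definition flip_form :: "('v config \<Rightarrow> real) \<Rightarrow> 'v \<Rightarrow> real" where
 "flip_form g a = (\<Sum>\<eta>\<in>configs V. \<nu> \<eta> * (rate a \<eta> * (g (flip a \<eta>) - g \<eta>)^2))"

section \<open>Behaviour of the product weight under exchanges and flips\<close>

lemma wt_ge: "x \<in> V \<Longrightarrow> \<beta> \<le> wt x b"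
 using \<rho>_bounds by (simp add: wt_def)

lemma \<rho>_strict: "x \<in> V \<Longrightarrow> 0 < \<rho> x" "x \<in> V \<Longrightarrow> \<rho> x < 1"
 using \<rho>_bounds[of x] \<beta> by linarith+

lemma \<nu>_pos: "0 < \<nu> \<eta>"
 unfolding \<nu>_def using \<beta> wt_ge by (intro prod_pos) (auto intro: less_le_trans)

lemma \<nu>_ge: "\<beta> ^ card V \<le> \<nu> \<eta>"
proof -
 have "(\<Prod>x\<in>V. \<beta>) \<le> \<nu> \<eta>" unfolding \<nu>_def using \<beta> wt_ge by (intro prod_mono) auto
 then show ?thesis by simp
qed

lemma sum_\<nu>: "sum \<nu> (configs V) = 1"
proof -
 have "sum \<nu> (configs V) = (\<Prod>x\<in>V. \<Sum>b\<in>UNIV. wt x b)"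
  unfolding \<nu>_def configs_def by (rule prod_sum_PiE[symmetric]) (use finite_V in auto)
 also have "... = 1" by (simp add: UNIV_bool wt_def)
 finally show ?thesis .
qed

lemma \<nu>_remove2:
 assumes "x \<in> V" "y \<in> V" "x \<noteq> y"
 shows "\<nu> \<eta> = wt x (\<eta> x) * (wt y (\<eta> y) * (\<Prod>z\<in>V - {x} - {y}. wt z (\<eta> z)))"
 unfolding \<nu>_def using finite_V assms
 by (subst prod.remove[of V x], simp_all) (subst prod.remove[of "V - {x}" y], auto)

text \<open>As \<open>wt\<close> is affine in the density,
  \<open>wt x b = wt y b * (1 + (\<rho> x - \<rho> y) * om y b)\<close>, and likewise with x and y
  interchanged. Multiplying the two relations gives an exact identity: a part linear in
  \<open>om\<close>, which stationarity will cancel, and a quadratic part, which sums to the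
  energy.\<close>

lemma \<nu>_exchange:
 assumes xy: "x \<in> V" "y \<in> V"
 shows "\<nu> (exchange x y \<eta>) - \<nu> \<eta> = \<nu> \<eta> * ((\<rho> y - \<rho> x) * (om x (\<eta> x) - om y (\<eta> y))
      - (\<rho> x - \<rho> y)^2 * om x (\<eta> x) * om y (\<eta> y))"
proof (cases "x = y")
 case True
 then show ?thesis by (simp add: exchange_def)
next
 case False
 let ?R = "\<Prod>z\<in>V - {x} - {y}. wt z (\<eta> z)"
 have 1: "\<nu> \<eta> = wt x (\<eta> x) * (wt y (\<eta> y) * ?R)" by (rule \<nu>_remove2[OF xy False])
 have "(\<Prod>z\<in>V - {x} - {y}. wt z (exchange x y \<eta> z)) = ?R"
  by (intro prod.cong refl) (auto simp: exchange_def)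
 then have 2: "\<nu> (exchange x y \<eta>) = wt x (\<eta> y) * (wt y (\<eta> x) * ?R)"
  using \<nu>_remove2[OF xy False, of "exchange x y \<eta>"] False by (simp add: exchange_def)
 have nz: "\<rho> x \<noteq> 0" "\<rho> y \<noteq> 0" "1 - \<rho> x \<noteq> 0" "1 - \<rho> y \<noteq> 0"
  using \<rho>_strict[OF xy(1)] \<rho>_strict[OF xy(2)] by auto
 have key: "wt x (\<eta> y) * wt y (\<eta> x) - wt x (\<eta> x) * wt y (\<eta> y)
   = wt x (\<eta> x) * wt y (\<eta> y) * ((\<rho> y - \<rho> x) * (om x (\<eta> x) - om y (\<eta> y))
      - (\<rho> x - \<rho> y)^2 * om x (\<eta> x) * om y (\<eta> y))"
  using nz by (cases "\<eta> x"; cases "\<eta> y")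
   (simp_all add: wt_def om_def divide_simps power2_eq_square, (simp add: algebra_simps)+)
 have "\<nu> (exchange x y \<eta>) - \<nu> \<eta> = (wt x (\<eta> y) * wt y (\<eta> x) - wt x (\<eta> x) * wt y (\<eta> y)) * ?R"
  unfolding 1 2 by (simp add: algebra_simps)
 then show ?thesis unfolding key 1 by (simp only: mult_ac)
qed

lemma om_bound: "x \<in> V \<Longrightarrow> \<bar>om x b\<bar> \<le> 1 / \<beta>"
 using \<rho>_bounds[of x] \<beta> by (auto simp: om_def abs_if intro!: divide_left_mono)

lemma \<beta>_le: "x \<in> V \<Longrightarrow> \<beta> \<le> 1"
 using \<rho>_bounds[of x] \<beta> by linarith

text \<open>The 3 is 2 from the linear part, with \<open>1 / \<beta>\<close> weakened to its square,
  plus 1 from the quadratic part, where one factor \<open>\<bar>\<rho> x - \<rho> y\<bar>\<close> is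
  bounded by 1.\<close>

lemma \<nu>_exchange_bound:
 assumes xy: "x \<in> V" "y \<in> V"
 shows "\<bar>\<nu> (exchange x y \<eta>) - \<nu> \<eta>\<bar> \<le> \<nu> \<eta> * (3 / \<beta>^2 * \<bar>\<rho> x - \<rho> y\<bar>)"
proof -
 let ?d = "\<bar>\<rho> x - \<rho> y\<bar>" and ?a = "om x (\<eta> x)" and ?b = "om y (\<eta> y)"
 have d1: "?d \<le> 1" using \<rho>_strict[OF xy(1)] \<rho>_strict[OF xy(2)] by linarith
 have b1: "1 / \<beta> \<le> 1 / \<beta>^2"
  using \<beta> \<beta>_le[OF xy(1)] by (simp add: divide_simps power2_eq_square)
 have "\<bar>(\<rho> y - \<rho> x) * (?a - ?b)\<bar> \<le> ?d * (2 / \<beta>)"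
  unfolding abs_mult using om_bound[OF xy(1), of "\<eta> x"] om_bound[OF xy(2), of "\<eta> y"]
  by (intro mult_mono) (auto simp: abs_minus_commute)
 also have "... \<le> ?d * (2 / \<beta>^2)" using b1 by (intro mult_left_mono) auto
 finally have 1: "\<bar>(\<rho> y - \<rho> x) * (?a - ?b)\<bar> \<le> ?d * (2 / \<beta>^2)" .
 have "\<bar>(\<rho> x - \<rho> y)^2 * ?a * ?b\<bar> \<le> (?d * 1) * (1 / \<beta>) * (1 / \<beta>)"
  unfolding abs_mult power2_eq_square using d1 \<beta>
  by (intro mult_mono om_bound xy) auto
 then have 2: "\<bar>(\<rho> x - \<rho> y)^2 * ?a * ?b\<bar> \<le> ?d * (1 / \<beta>^2)" by (simp add: power2_eq_square)
 have "?d * (2 / \<beta>^2) + ?d * (1 / \<beta>^2) = 3 / \<beta>^2 * ?d" by (simp add: field_simps)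
 with 1 2 have "\<bar>(\<rho> y - \<rho> x) * (?a - ?b) - (\<rho> x - \<rho> y)^2 * ?a * ?b\<bar> \<le> 3 / \<beta>^2 * ?d"
  by linarith
 from mult_left_mono[OF this less_imp_le[OF \<nu>_pos[of \<eta>]]] show ?thesis
  unfolding \<nu>_exchange[OF xy] abs_mult[of "\<nu> \<eta>"] abs_of_pos[OF \<nu>_pos] .
qed

lemma \<nu>_remove1:
 "a \<in> V \<Longrightarrow> \<nu> \<eta> = wt a (\<eta> a) * (\<Prod>z\<in>V - {a}. wt z (\<eta> z))"
 unfolding \<nu>_def using finite_V by (rule prod.remove)

lemma \<nu>_flip_ratio:
 assumes a: "a \<in> V"
 shows "\<nu> (flip a \<eta>) * wt a (\<eta> a) = \<nu> \<eta> * wt a (\<not> \<eta> a)"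
proof -
 have "(\<Prod>z\<in>V - {a}. wt z (flip a \<eta> z)) = (\<Prod>z\<in>V - {a}. wt z (\<eta> z))"
  by (intro prod.cong refl) (auto simp: flip_def)
 then show ?thesis using \<nu>_remove1[OF a, of \<eta>] \<nu>_remove1[OF a, of "flip a \<eta>"]
  by (simp add: flip_def)
qed

lemma \<nu>_flip_le: "a \<in> V \<Longrightarrow> \<nu> (flip a \<eta>) \<le> \<nu> \<eta> / \<beta>"
proof -
 assume a: "a \<in> V"
 have "\<nu> (flip a \<eta>) * \<beta> \<le> \<nu> (flip a \<eta>) * wt a (\<eta> a)"
  by (intro mult_left_mono wt_ge a less_imp_le[OF \<nu>_pos])
 also have "... = \<nu> \<eta> * wt a (\<not> \<eta> a)" by (rule \<nu>_flip_ratio[OF a])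
 also have "... \<le> \<nu> \<eta> * 1"
  using \<rho>_strict[OF a] by (intro mult_left_mono less_imp_le[OF \<nu>_pos]) (simp add: wt_def)
 finally show "\<nu> (flip a \<eta>) \<le> \<nu> \<eta> / \<beta>" using \<beta> by (simp add: field_simps)
qed

text \<open>For a boundary site the coefficient of \<open>om\<close> is
  \<open>- flow V c \<rho> a\<close> by stationarity, which is what lets it cancel against the
  exchanges.\<close>

lemma \<nu>_flip:
 assumes a: "a \<in> V"
 shows "rate a (flip a \<eta>) * \<nu> (flip a \<eta>) - rate a \<eta> * \<nu> \<eta>
   = \<nu> \<eta> * ((lamP a - (lamP a + lamM a) * \<rho> a) * om a (\<eta> a))"
proof -
 have nz: "\<rho> a \<noteq> 0" "1 - \<rho> a \<noteq> 0" "wt a (\<eta> a) \<noteq> 0"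
  using \<rho>_strict[OF a] by (auto simp: wt_def)
 then have eq: "\<nu> (flip a \<eta>) = \<nu> \<eta> * wt a (\<not> \<eta> a) / wt a (\<eta> a)"
  using \<nu>_flip_ratio[OF a, of \<eta>] by (simp add: field_simps)
 have rf: "rate a (flip a \<eta>) = (if \<eta> a then lamP a else lamM a)"
  "rate a \<eta> = (if \<eta> a then lamM a else lamP a)"
  by (simp_all add: rate_def flip_def)
 show ?thesis unfolding eq rf using nz
  by (cases "\<eta> a") (simp_all add: wt_def om_def divide_simps, (simp add: algebra_simps)+)
qed

text \<open>By stationarity the terms linear in \<open>\<omega>\<close> that come from the exchanges
 cancel those that come from the boundary.\<close>

lemma adjoint_cancellation:
 "(\<Sum>x\<in>V. \<Sum>y\<in>V. c x y * ((\<rho> y - \<rho> x) * (\<omega> x - \<omega> y))) / 2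
   + (\<Sum>a\<in>bd. (lamP a - (lamP a + lamM a) * \<rho> a) * \<omega> a) = 0"
proof -
 have swap: "(\<Sum>x\<in>V. \<Sum>y\<in>V. c x y * ((\<rho> y - \<rho> x) * \<omega> y)) = (\<Sum>x\<in>V. \<Sum>y\<in>V. c x y * ((\<rho> x - \<rho> y) * \<omega> x))"
  by (subst sum.swap) (simp add: c_sym)
 have "(\<Sum>x\<in>V. \<Sum>y\<in>V. c x y * ((\<rho> y - \<rho> x) * (\<omega> x - \<omega> y)))
   = (\<Sum>x\<in>V. \<Sum>y\<in>V. c x y * ((\<rho> y - \<rho> x) * \<omega> x)) - (\<Sum>x\<in>V. \<Sum>y\<in>V. c x y * ((\<rho> y - \<rho> x) * \<omega> y))"
  unfolding sum_subtractf[symmetric] by (intro sum.cong refl) (simp add: algebra_simps)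
 also have "... = 2 * (\<Sum>x\<in>V. flow V c \<rho> x * \<omega> x)"
  unfolding swap sum_subtractf[symmetric] flow_def sum_distrib_left sum_distrib_right
  by (intro sum.cong refl) (simp add: algebra_simps)
 also have "(\<Sum>x\<in>V. flow V c \<rho> x * \<omega> x) = (\<Sum>a\<in>bd. flow V c \<rho> a * \<omega> a)"
  using finite_V bd harmonic by (intro sum.mono_neutral_right) auto
 also have "... = (\<Sum>a\<in>bd. ((lamP a + lamM a) * \<rho> a - lamP a) * \<omega> a)"
  using stationary by (intro sum.cong refl) simp
 also have "... = - (\<Sum>a\<in>bd. (lamP a - (lamP a + lamM a) * \<rho> a) * \<omega> a)"
  unfolding sum_negf[symmetric] by (intro sum.cong refl) (simp add: algebra_simps)
 finally show ?thesis by simp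
qed


text \<open>The identity \<open>sq\<close> splits off minus half a squared difference; in the rest,
  a change of variables moves the transformation from \<open>g^2\<close> to the weight. What
  multiplies \<open>g^2\<close> is the density of the adjoint applied to 1, and only its quadratic
  part is left.\<close>

lemma dirichlet_bound:
 "(\<Sum>\<eta>\<in>configs V. \<nu> \<eta> * (g \<eta> * gen g \<eta>))
  \<le> - (swap_dirichlet g + (\<Sum>a\<in>bd. flip_form g a)) / 2 + energy V c \<rho> / (2 * \<beta>^2) * normsq g"
proof -
 let ?S = "configs V"
 have sq: "u * (v - u) = - ((v - u)^2) / 2 + (v^2 - u^2) / 2" for u v :: real
  by (simp add: power2_eq_square field_simps)
 let ?Lx = "\<lambda>x y \<eta>. (\<rho> y - \<rho> x) * (om x (\<eta> x) - om y (\<eta> y))"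
 let ?Q = "\<lambda>x y \<eta>. (\<rho> x - \<rho> y)^2 * om x (\<eta> x) * om y (\<eta> y)"
 let ?b = "\<lambda>a \<eta>. (lamP a - (lamP a + lamM a) * \<rho> a) * om a (\<eta> a)"
 have ex: "(\<Sum>\<eta>\<in>?S. \<nu> \<eta> * (g \<eta> * (g (exchange x y \<eta>) - g \<eta>)))
   = - (\<Sum>\<eta>\<in>?S. \<nu> \<eta> * (g (exchange x y \<eta>) - g \<eta>)^2) / 2
    + (\<Sum>\<eta>\<in>?S. \<nu> \<eta> * (g \<eta>)^2 * (?Lx x y \<eta> - ?Q x y \<eta>)) / 2" if xy: "x \<in> V" "y \<in> V" for x y
 proof -
  have "(\<Sum>\<eta>\<in>?S. \<nu> \<eta> * (g (exchange x y \<eta>))^2) = (\<Sum>\<eta>\<in>?S. \<nu> (exchange x y \<eta>) * (g \<eta>)^2)"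
   using sum_exchange[OF xy, of "\<lambda>\<eta>. \<nu> (exchange x y \<eta>) * (g \<eta>)^2"] by simp
  then have "(\<Sum>\<eta>\<in>?S. \<nu> \<eta> * ((g (exchange x y \<eta>))^2 - (g \<eta>)^2)) = (\<Sum>\<eta>\<in>?S. (\<nu> (exchange x y \<eta>) - \<nu> \<eta>) * (g \<eta>)^2)"
   by (simp only: right_diff_distrib left_diff_distrib sum_subtractf)
  also have "... = (\<Sum>\<eta>\<in>?S. \<nu> \<eta> * (g \<eta>)^2 * (?Lx x y \<eta> - ?Q x y \<eta>))"
   unfolding \<nu>_exchange[OF xy] by (simp only: mult_ac)
  finally have e: "(\<Sum>\<eta>\<in>?S. \<nu> \<eta> * ((g (exchange x y \<eta>))^2 - (g \<eta>)^2)) = (\<Sum>\<eta>\<in>?S. \<nu> \<eta> * (g \<eta>)^2 * (?Lx x y \<eta> - ?Q x y \<eta>))" .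
  have "(\<Sum>\<eta>\<in>?S. \<nu> \<eta> * (g \<eta> * (g (exchange x y \<eta>) - g \<eta>)))
    = (\<Sum>\<eta>\<in>?S. - (\<nu> \<eta> * (g (exchange x y \<eta>) - g \<eta>)^2) / 2 + (\<nu> \<eta> * ((g (exchange x y \<eta>))^2 - (g \<eta>)^2)) / 2)"
   by (intro sum.cong refl) (simp only: sq, simp add: algebra_simps)
  then show ?thesis unfolding e[symmetric] by (simp add: sum.distrib sum_negf sum_subtractf flip: sum_divide_distrib)
 qed
 have fl: "(\<Sum>\<eta>\<in>?S. \<nu> \<eta> * (g \<eta> * (rate a \<eta> * (g (flip a \<eta>) - g \<eta>))))
   = - flip_form g a / 2 + (\<Sum>\<eta>\<in>?S. \<nu> \<eta> * (g \<eta>)^2 * ?b a \<eta>) / 2" if a: "a \<in> V" for a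
 proof -
  have "(\<Sum>\<eta>\<in>?S. \<nu> \<eta> * rate a \<eta> * (g (flip a \<eta>))^2) = (\<Sum>\<eta>\<in>?S. \<nu> (flip a \<eta>) * rate a (flip a \<eta>) * (g \<eta>)^2)"
   using sum_flip[OF a, of "\<lambda>\<eta>. \<nu> (flip a \<eta>) * rate a (flip a \<eta>) * (g \<eta>)^2"] by simp
  then have "(\<Sum>\<eta>\<in>?S. \<nu> \<eta> * rate a \<eta> * ((g (flip a \<eta>))^2 - (g \<eta>)^2))
    = (\<Sum>\<eta>\<in>?S. (rate a (flip a \<eta>) * \<nu> (flip a \<eta>) - rate a \<eta> * \<nu> \<eta>) * (g \<eta>)^2)"
   by (simp only: right_diff_distrib left_diff_distrib sum_subtractf mult.commute[of "\<nu> _" "rate _ _"])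
  also have "... = (\<Sum>\<eta>\<in>?S. \<nu> \<eta> * (g \<eta>)^2 * ?b a \<eta>)"
   unfolding \<nu>_flip[OF a] by (simp only: mult_ac)
  finally have e: "(\<Sum>\<eta>\<in>?S. \<nu> \<eta> * rate a \<eta> * ((g (flip a \<eta>))^2 - (g \<eta>)^2)) = (\<Sum>\<eta>\<in>?S. \<nu> \<eta> * (g \<eta>)^2 * ?b a \<eta>)" .
  have "(\<Sum>\<eta>\<in>?S. \<nu> \<eta> * (g \<eta> * (rate a \<eta> * (g (flip a \<eta>) - g \<eta>))))
    = (\<Sum>\<eta>\<in>?S. - (\<nu> \<eta> * (rate a \<eta> * (g (flip a \<eta>) - g \<eta>)^2)) / 2 + (\<nu> \<eta> * rate a \<eta> * ((g (flip a \<eta>))^2 - (g \<eta>)^2)) / 2)"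
   by (intro sum.cong refl) (simp only: mult.left_commute[of "g _" "rate _ _"] sq, simp add: algebra_simps)
  then show ?thesis unfolding e[symmetric] flip_form_def
   by (simp add: sum.distrib sum_negf sum_subtractf flip: sum_divide_distrib)
 qed
 have "(\<Sum>\<eta>\<in>?S. \<nu> \<eta> * (g \<eta> * L_EX V c g \<eta>))
   = (\<Sum>x\<in>V. \<Sum>y\<in>V. c x y * (\<Sum>\<eta>\<in>?S. \<nu> \<eta> * (g \<eta> * (g (exchange x y \<eta>) - g \<eta>)))) / 2"
  unfolding L_EX_def sum_distrib_left sum_divide_distrib
  by (subst sum.swap, rule sum.cong[OF refl], subst sum.swap, intro sum.cong refl) simp
 also have "... = (\<Sum>x\<in>V. \<Sum>y\<in>V. - (c x y * (\<Sum>\<eta>\<in>?S. \<nu> \<eta> * (g (exchange x y \<eta>) - g \<eta>)^2)) / 2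
    + (\<Sum>\<eta>\<in>?S. \<nu> \<eta> * (g \<eta>)^2 * (c x y * (?Lx x y \<eta> - ?Q x y \<eta>))) / 2) / 2"
 proof (intro arg_cong2[where f = "(/)"] sum.cong refl)
  fix x y assume xy: "x \<in> V" "y \<in> V"
  have pull: "(\<Sum>\<eta>\<in>?S. \<nu> \<eta> * (g \<eta>)^2 * (c x y * (?Lx x y \<eta> - ?Q x y \<eta>)))
    = c x y * (\<Sum>\<eta>\<in>?S. \<nu> \<eta> * (g \<eta>)^2 * (?Lx x y \<eta> - ?Q x y \<eta>))"
   unfolding sum_distrib_left by (intro sum.cong refl) (simp only: mult_ac)
  have gen: "k * (- A / 2 + B / 2) = - (k * A) / 2 + (k * B) / 2" for k A B :: real
   by (simp add: field_simps)
  show "c x y * (\<Sum>\<eta>\<in>?S. \<nu> \<eta> * (g \<eta> * (g (exchange x y \<eta>) - g \<eta>)))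
    = - (c x y * (\<Sum>\<eta>\<in>?S. \<nu> \<eta> * (g (exchange x y \<eta>) - g \<eta>)^2)) / 2
     + (\<Sum>\<eta>\<in>?S. \<nu> \<eta> * (g \<eta>)^2 * (c x y * (?Lx x y \<eta> - ?Q x y \<eta>))) / 2"
   by (subst ex[OF xy], subst pull) (rule gen)
 qed
 also have "... = - swap_dirichlet g / 2 + (\<Sum>x\<in>V. \<Sum>y\<in>V. \<Sum>\<eta>\<in>?S. \<nu> \<eta> * (g \<eta>)^2 * (c x y * (?Lx x y \<eta> - ?Q x y \<eta>))) / 4"
  unfolding swap_dirichlet_def
  by (simp only: sum.distrib sum_divide_distrib[symmetric] sum_negf add_divide_distrib divide_divide_eq_left)
 also have "(\<Sum>x\<in>V. \<Sum>y\<in>V. \<Sum>\<eta>\<in>?S. \<nu> \<eta> * (g \<eta>)^2 * (c x y * (?Lx x y \<eta> - ?Q x y \<eta>)))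
   = (\<Sum>\<eta>\<in>?S. \<Sum>x\<in>V. \<Sum>y\<in>V. \<nu> \<eta> * (g \<eta>)^2 * (c x y * (?Lx x y \<eta> - ?Q x y \<eta>)))"
  by (subst (2) sum.swap, subst sum.swap) (rule refl)
 also have "... = (\<Sum>\<eta>\<in>?S. \<nu> \<eta> * (g \<eta>)^2 * (\<Sum>x\<in>V. \<Sum>y\<in>V. c x y * (?Lx x y \<eta> - ?Q x y \<eta>)))"
  by (simp only: sum_distrib_left)
 finally have EX: "(\<Sum>\<eta>\<in>?S. \<nu> \<eta> * (g \<eta> * L_EX V c g \<eta>)) = - swap_dirichlet g / 2
   + (\<Sum>\<eta>\<in>?S. \<nu> \<eta> * (g \<eta>)^2 * (\<Sum>x\<in>V. \<Sum>y\<in>V. c x y * (?Lx x y \<eta> - ?Q x y \<eta>))) / 4" .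
 have "(\<Sum>\<eta>\<in>?S. \<nu> \<eta> * (g \<eta> * L_bdry bd lamP lamM g \<eta>))
   = (\<Sum>a\<in>bd. \<Sum>\<eta>\<in>?S. \<nu> \<eta> * (g \<eta> * (rate a \<eta> * (g (flip a \<eta>) - g \<eta>))))"
  unfolding L_bdry_def sum_distrib_left rate_def by (rule sum.swap)
 also have "... = (\<Sum>a\<in>bd. - flip_form g a / 2 + (\<Sum>\<eta>\<in>?S. \<nu> \<eta> * (g \<eta>)^2 * ?b a \<eta>) / 2)"
  using bd by (intro sum.cong refl fl) auto
 also have "... = - (\<Sum>a\<in>bd. flip_form g a) / 2 + (\<Sum>\<eta>\<in>?S. \<Sum>a\<in>bd. \<nu> \<eta> * (g \<eta>)^2 * ?b a \<eta>) / 2"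
  by (simp only: sum.distrib sum_divide_distrib[symmetric] sum_negf sum.swap[of _ bd])
 finally have BD: "(\<Sum>\<eta>\<in>?S. \<nu> \<eta> * (g \<eta> * L_bdry bd lamP lamM g \<eta>))
   = - (\<Sum>a\<in>bd. flip_form g a) / 2 + (\<Sum>\<eta>\<in>?S. \<nu> \<eta> * (g \<eta>)^2 * (\<Sum>a\<in>bd. ?b a \<eta>)) / 2"
  by (simp only: sum_distrib_left)
 \<comment> \<open>The adjoint of the generator in the weight \<nu>, applied to 1.\<close>
 let ?K = "\<lambda>\<eta>. (\<Sum>x\<in>V. \<Sum>y\<in>V. c x y * (?Lx x y \<eta> - ?Q x y \<eta>)) / 2 + (\<Sum>a\<in>bd. ?b a \<eta>)"
 have K: "?K \<eta> \<le> energy V c \<rho> / \<beta>^2" for \<eta>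
 proof -
  have "?K \<eta> = - (\<Sum>x\<in>V. \<Sum>y\<in>V. c x y * ?Q x y \<eta>) / 2"
   using adjoint_cancellation[of "\<lambda>x. om x (\<eta> x)"]
   by (simp add: right_diff_distrib[of "c _ _"] sum_subtractf diff_divide_distrib)
  also have "... \<le> (\<Sum>x\<in>V. \<Sum>y\<in>V. c x y * ((\<rho> x - \<rho> y)^2 * (1 / \<beta>^2))) / 2"
   unfolding sum_negf[symmetric]
  proof (intro divide_right_mono sum_mono)
   fix x y assume xy: "x \<in> V" "y \<in> V"
   have "\<bar>?Q x y \<eta>\<bar> \<le> (\<rho> x - \<rho> y)^2 * (1 / \<beta>) * (1 / \<beta>)"
    unfolding abs_mult using \<beta> by (intro mult_mono om_bound xy) auto
   then have "- ?Q x y \<eta> \<le> (\<rho> x - \<rho> y)^2 * (1 / \<beta>^2)" by (simp add: power2_eq_square abs_le_iff)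
   then show "- (c x y * ?Q x y \<eta>) \<le> c x y * ((\<rho> x - \<rho> y)^2 * (1 / \<beta>^2))"
    using mult_left_mono[OF _ c_nonneg[of x y], of "- ?Q x y \<eta>"] by (simp only: mult_minus_right)
  qed simp
  also have "... = energy V c \<rho> / \<beta>^2"
   unfolding energy_def by (simp flip: sum_divide_distrib)
  finally show ?thesis .
 qed
 have eq: "(\<Sum>\<eta>\<in>?S. \<nu> \<eta> * (g \<eta> * gen g \<eta>))
   = - (swap_dirichlet g + (\<Sum>a\<in>bd. flip_form g a)) / 2 + (\<Sum>\<eta>\<in>?S. \<nu> \<eta> * (g \<eta>)^2 * ?K \<eta>) / 2"
 proof -
  have split: "(\<Sum>\<eta>\<in>?S. \<nu> \<eta> * (g \<eta>)^2 * ?K \<eta>)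
   = (\<Sum>\<eta>\<in>?S. \<nu> \<eta> * (g \<eta>)^2 * (\<Sum>x\<in>V. \<Sum>y\<in>V. c x y * (?Lx x y \<eta> - ?Q x y \<eta>))) / 2
    + (\<Sum>\<eta>\<in>?S. \<nu> \<eta> * (g \<eta>)^2 * (\<Sum>a\<in>bd. ?b a \<eta>))"
   by (simp only: distrib_left sum.distrib times_divide_eq_right sum_divide_distrib[symmetric])
  have Ls: "(\<Sum>\<eta>\<in>?S. \<nu> \<eta> * (g \<eta> * gen g \<eta>))
    = (\<Sum>\<eta>\<in>?S. \<nu> \<eta> * (g \<eta> * L_EX V c g \<eta>)) + (\<Sum>\<eta>\<in>?S. \<nu> \<eta> * (g \<eta> * L_bdry bd lamP lamM g \<eta>))"
   by (simp only: L_bEX_def distrib_left sum.distrib)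
  have gen: "p = - (d + e) / 2 + k / 2"
   if "k = u / 2 + w" "p = p1 + p2" "p1 = - d / 2 + u / 4" "p2 = - e / 2 + w / 2" for p p1 p2 d e u w k :: real
   unfolding that(2-4) that(1) by (simp add: field_simps)
  show ?thesis by (rule gen[OF split Ls EX BD])
 qed
 have k1: "(\<Sum>\<eta>\<in>?S. \<nu> \<eta> * (g \<eta>)^2 * ?K \<eta>) \<le> (\<Sum>\<eta>\<in>?S. \<nu> \<eta> * (g \<eta>)^2 * (energy V c \<rho> / \<beta>^2))"
  by (intro sum_mono mult_left_mono K) (simp add: less_imp_le[OF \<nu>_pos])
 have k2: "(\<Sum>\<eta>\<in>?S. \<nu> \<eta> * (g \<eta>)^2 * (energy V c \<rho> / \<beta>^2)) = normsq g * (energy V c \<rho> / \<beta>^2)"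
  by (simp only: sum_distrib_right)
 have gen: "d + k / 2 \<le> d + e / (2 * b) * m" if "k \<le> z" "z = m * (e / b)" for d k z m e b :: real
 proof -
  have e: "e / (2 * b) * m = m * (e / b) / 2" by (simp add: mult.commute)
  show ?thesis unfolding e that(2)[symmetric] using that(1) by simp
 qed
 show ?thesis unfolding eq by (rule gen[OF k1 k2])
qed


lemma swap_dirichlet_nonneg: "0 \<le> swap_dirichlet g"
 unfolding swap_dirichlet_def
 by (intro divide_nonneg_pos sum_nonneg mult_nonneg_nonneg c_nonneg less_imp_le[OF \<nu>_pos]) auto

lemma rate_nonneg: "a \<in> bd \<Longrightarrow> 0 \<le> rate a \<eta>"
 using lam by (simp add: rate_def)

lemma flip_form_nonneg: "a \<in> bd \<Longrightarrow> 0 \<le> flip_form g a"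
 unfolding flip_form_def
 by (intro sum_nonneg mult_nonneg_nonneg rate_nonneg less_imp_le[OF \<nu>_pos]) auto

text \<open>Passing from \<open>\<nu>\<close> to the exchange-invariant counting measure costs only the energy of \<open>\<rho>\<close>.\<close>

lemma swap_energy_le:
 "swap_energy V c (\<lambda>\<eta>. sqrt (\<nu> \<eta>) * g \<eta>)
   \<le> 2 * swap_dirichlet g + 18 / \<beta> ^ 4 * energy V c \<rho> * normsq g"
proof -
 let ?S = "configs V"
 let ?h = "\<lambda>\<eta>. sqrt (\<nu> \<eta>) * g \<eta>"
 have pair: "swap_form V ?h x y \<le> 2 * (\<Sum>\<eta>\<in>?S. \<nu> \<eta> * (g (exchange x y \<eta>) - g \<eta>)^2)
   + 18 / \<beta> ^ 4 * (\<rho> x - \<rho> y)^2 * normsq g" if xy: "x \<in> V" "y \<in> V" for x y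
 proof -
  let ?e = "exchange x y"
  let ?r = "\<lambda>\<eta>. sqrt (\<nu> (?e \<eta>)) - sqrt (\<nu> \<eta>)"
  \<comment> \<open>Leibniz rule for the product \<open>sqrt \<nu> * g\<close>. The 18 of the lemma
    is this factor 2 times the square of the 3 in \<open>\<nu>_exchange_bound\<close>.\<close>
  have "swap_form V ?h x y \<le> (\<Sum>\<eta>\<in>?S. 2 * (\<nu> \<eta> * (g (?e \<eta>) - g \<eta>)^2) + 2 * ((g (?e \<eta>))^2 * (?r \<eta>)^2))"
   unfolding swap_form_def
  proof (rule sum_mono)
   fix \<eta>
   let ?u = "sqrt (\<nu> \<eta>) * (g (?e \<eta>) - g \<eta>)" and ?v = "g (?e \<eta>) * ?r \<eta>"
   have "?h (?e \<eta>) - ?h \<eta> = ?u + ?v" by (simp add: algebra_simps)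
   moreover have "(?u + ?v)^2 \<le> 2 * ?u^2 + 2 * ?v^2"
    using zero_le_power2[of "?u - ?v"] by (simp add: power2_sum power2_diff)
   moreover have "?u^2 = \<nu> \<eta> * (g (?e \<eta>) - g \<eta>)^2"
    using less_imp_le[OF \<nu>_pos[of \<eta>]] by (simp add: power_mult_distrib)
   moreover have "?v^2 = (g (?e \<eta>))^2 * (?r \<eta>)^2" by (simp add: power_mult_distrib)
   ultimately show "(?h (?e \<eta>) - ?h \<eta>)^2 \<le> 2 * (\<nu> \<eta> * (g (?e \<eta>) - g \<eta>)^2) + 2 * ((g (?e \<eta>))^2 * (?r \<eta>)^2)"
    by (simp only:)
  qed
  also have "... = 2 * (\<Sum>\<eta>\<in>?S. \<nu> \<eta> * (g (?e \<eta>) - g \<eta>)^2) + 2 * (\<Sum>\<eta>\<in>?S. (g (?e \<eta>))^2 * (?r \<eta>)^2)"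
   by (simp only: sum.distrib sum_distrib_left)
  also have "(\<Sum>\<eta>\<in>?S. (g (?e \<eta>))^2 * (?r \<eta>)^2) = (\<Sum>\<eta>\<in>?S. (g \<eta>)^2 * (?r \<eta>)^2)"
   using sum_exchange[OF xy, of "\<lambda>\<eta>. (g \<eta>)^2 * (?r \<eta>)^2"] by (simp add: power2_commute[of "sqrt (\<nu> (?e _))"])
  also have "... \<le> (\<Sum>\<eta>\<in>?S. (\<nu> \<eta> * (g \<eta>)^2) * (9 / \<beta> ^ 4 * (\<rho> x - \<rho> y)^2))"
  proof (rule sum_mono)
   fix \<eta>
   let ?p = "sqrt (\<nu> \<eta>)" and ?q = "sqrt (\<nu> (?e \<eta>))" and ?d = "3 / \<beta>^2 * \<bar>\<rho> x - \<rho> y\<bar>"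
   have pq: "0 < ?p" "0 < ?q" "?p^2 = \<nu> \<eta>" "?q^2 = \<nu> (?e \<eta>)"
    using \<nu>_pos[of \<eta>] \<nu>_pos[of "?e \<eta>"] by (auto simp: less_imp_le)
   \<comment> \<open>A difference of square roots times their sum is the difference of the weights,
     so the linear bound on the weights passes to their roots.\<close>
   have "\<bar>?q - ?p\<bar> * ?p \<le> \<bar>?q - ?p\<bar> * (?q + ?p)" using pq by (intro mult_left_mono) auto
   also have "... = \<bar>(?q - ?p) * (?q + ?p)\<bar>" using pq by (simp add: abs_mult)
   also have "... = \<bar>\<nu> (?e \<eta>) - \<nu> \<eta>\<bar>" using pq by (simp add: power2_eq_square algebra_simps)
   also have "... \<le> ?p^2 * ?d" using \<nu>_exchange_bound[OF xy, of \<eta>] pq by simp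
   finally have "\<bar>?q - ?p\<bar> * ?p \<le> (?p * ?d) * ?p" by (simp only: power2_eq_square mult_ac)
   then have "\<bar>?q - ?p\<bar> \<le> ?p * ?d" using pq(1) by (rule mult_right_le_imp_le)
   then have "(?r \<eta>)^2 \<le> (?p * ?d)^2" by (metis abs_ge_zero power2_abs power_mono)
   also have "... = \<nu> \<eta> * (9 / \<beta> ^ 4 * (\<rho> x - \<rho> y)^2)"
    using pq(3) by (simp add: power_mult_distrib power_divide flip: power_mult)
   finally show "(g \<eta>)^2 * (?r \<eta>)^2 \<le> (\<nu> \<eta> * (g \<eta>)^2) * (9 / \<beta> ^ 4 * (\<rho> x - \<rho> y)^2)"
    using mult_left_mono[of _ _ "(g \<eta>)^2"] by (fastforce simp: mult_ac)
  qed
  also have "... = normsq g * (9 / \<beta> ^ 4 * (\<rho> x - \<rho> y)^2)" by (simp only: sum_distrib_right)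
  finally show ?thesis by (simp add: mult_ac)
 qed
 have "(\<Sum>x\<in>V. \<Sum>y\<in>V. c x y * swap_form V ?h x y)
   \<le> (\<Sum>x\<in>V. \<Sum>y\<in>V. 2 * (c x y * (\<Sum>\<eta>\<in>?S. \<nu> \<eta> * (g (exchange x y \<eta>) - g \<eta>)^2))
      + (18 / \<beta> ^ 4 * normsq g) * (c x y * (\<rho> x - \<rho> y)^2))"
 proof (intro sum_mono)
  fix x y assume "x \<in> V" "y \<in> V"
  from mult_left_mono[OF pair[OF this] c_nonneg[of x y]]
  show "c x y * swap_form V ?h x y \<le> 2 * (c x y * (\<Sum>\<eta>\<in>?S. \<nu> \<eta> * (g (exchange x y \<eta>) - g \<eta>)^2))
      + (18 / \<beta> ^ 4 * normsq g) * (c x y * (\<rho> x - \<rho> y)^2)"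
   by (simp only: distrib_left mult_ac)
 qed
 also have "... = 2 * (\<Sum>x\<in>V. \<Sum>y\<in>V. c x y * (\<Sum>\<eta>\<in>?S. \<nu> \<eta> * (g (exchange x y \<eta>) - g \<eta>)^2))
   + (18 / \<beta> ^ 4 * normsq g) * (\<Sum>x\<in>V. \<Sum>y\<in>V. c x y * (\<rho> x - \<rho> y)^2)"
  by (simp only: sum.distrib sum_distrib_left)
 finally show ?thesis
  unfolding swap_energy_def swap_dirichlet_def energy_def by (simp add: field_simps)
qed

end

text \<open>The size of \<Lambda> is left open: it depends on all the rates and on the acceleration
  \<tau>, but no conclusion of the Feynman-Kac bounds contains it.\<close>

lemma finite_generator_L_bEX:
 assumes V: "finite V" "bd \<subseteq> V" and \<tau>: "0 \<le> \<tau>"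
 shows "\<exists>\<Lambda>. finite_generator (configs V) (\<lambda>f \<eta>. \<tau> * L_bEX V c bd lamP lamM f \<eta>) \<Lambda>"
proof -
 let ?r = "\<lambda>a \<eta>. lamM a * of_bool (\<eta> a) + lamP a * (1 - of_bool (\<eta> a))"
 let ?C = "(\<Sum>x\<in>V. \<Sum>y\<in>V. \<bar>c x y\<bar> * 2) / 2 + (\<Sum>a\<in>bd. (\<bar>lamM a\<bar> + \<bar>lamP a\<bar>) * 2)"
 have C: "0 \<le> ?C" by (intro add_nonneg_nonneg divide_nonneg_pos sum_nonneg) auto
 have "finite_generator (configs V) (\<lambda>f \<eta>. \<tau> * L_bEX V c bd lamP lamM f \<eta>) (\<tau> * ?C)"
 proof
  show "finite (configs V)" by (rule finite_configs[OF V(1)])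
  show "0 \<le> \<tau> * ?C" using \<tau> C by simp
  show "(\<lambda>\<eta>. \<tau> * L_bEX V c bd lamP lamM (\<lambda>\<eta>. f \<eta> + g \<eta>) \<eta>)
    = (\<lambda>\<eta>. \<tau> * L_bEX V c bd lamP lamM f \<eta> + \<tau> * L_bEX V c bd lamP lamM g \<eta>)" for f g :: "'a config \<Rightarrow> real"
  proof
   fix \<eta>
   have "u * (p + q - (p' + q')) = u * (p - p') + u * (q - q')" for u p q p' q' :: real
    by (simp add: algebra_simps)
   then show "\<tau> * L_bEX V c bd lamP lamM (\<lambda>\<eta>. f \<eta> + g \<eta>) \<eta>
     = \<tau> * L_bEX V c bd lamP lamM f \<eta> + \<tau> * L_bEX V c bd lamP lamM g \<eta>"
    unfolding L_bEX_def L_EX_def L_bdry_def by (simp only: sum.distrib add_divide_distrib distrib_left add_ac)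
  qed
  show "(\<lambda>\<eta>. \<tau> * L_bEX V c bd lamP lamM (\<lambda>\<eta>. k * f \<eta>) \<eta>)
    = (\<lambda>\<eta>. k * (\<tau> * L_bEX V c bd lamP lamM f \<eta>))" for k and f :: "'a config \<Rightarrow> real"
  proof
   fix \<eta>
   have "u * (k * p - k * q) = k * (u * (p - q))" for u p q :: real
    by (simp add: algebra_simps)
   then have "L_bEX V c bd lamP lamM (\<lambda>\<eta>. k * f \<eta>) \<eta> = k * L_bEX V c bd lamP lamM f \<eta>"
    unfolding L_bEX_def L_EX_def L_bdry_def by (simp only: sum_distrib_left[symmetric] times_divide_eq_right distrib_left)
   then show "\<tau> * L_bEX V c bd lamP lamM (\<lambda>\<eta>. k * f \<eta>) \<eta> = k * (\<tau> * L_bEX V c bd lamP lamM f \<eta>)"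
    by (simp only: mult.left_commute)
  qed
  show "\<bar>\<tau> * L_bEX V c bd lamP lamM f \<eta>\<bar> \<le> \<tau> * ?C * B"
   if f: "\<And>\<eta>. \<eta> \<in> configs V \<Longrightarrow> \<bar>f \<eta>\<bar> \<le> B" and \<eta>: "\<eta> \<in> configs V" for f :: "'a config \<Rightarrow> real" and B \<eta>
  proof -
   have B: "0 \<le> B" using f[OF \<eta>] by linarith
   have diff: "\<bar>f \<xi> - f \<eta>\<bar> \<le> 2 * B" if "\<xi> \<in> configs V" for \<xi>
    using f[OF \<eta>] f[OF that] by linarith
   have "\<bar>L_EX V c f \<eta>\<bar> \<le> (\<Sum>x\<in>V. \<Sum>y\<in>V. \<bar>c x y\<bar> * (2 * B)) / 2"
    unfolding L_EX_def abs_divide abs_numeral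
    by (intro divide_right_mono order_trans[OF sum_abs] sum_mono)
     (auto simp: abs_mult intro!: mult_left_mono diff exchange_configs \<eta>)
   moreover have "\<bar>L_bdry bd lamP lamM f \<eta>\<bar> \<le> (\<Sum>a\<in>bd. (\<bar>lamM a\<bar> + \<bar>lamP a\<bar>) * (2 * B))"
    unfolding L_bdry_def
   proof (intro order_trans[OF sum_abs] sum_mono)
    fix a assume "a \<in> bd"
    then have "flip a \<eta> \<in> configs V" using V \<eta> by (auto intro: flip_configs)
    then show "\<bar>?r a \<eta> * (f (flip a \<eta>) - f \<eta>)\<bar> \<le> (\<bar>lamM a\<bar> + \<bar>lamP a\<bar>) * (2 * B)"
     unfolding abs_mult using diff B by (intro mult_mono) (auto simp: of_bool_def)
   qed
   ultimately have "\<bar>L_bEX V c bd lamP lamM f \<eta>\<bar>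
     \<le> (\<Sum>x\<in>V. \<Sum>y\<in>V. \<bar>c x y\<bar> * (2 * B)) / 2 + (\<Sum>a\<in>bd. (\<bar>lamM a\<bar> + \<bar>lamP a\<bar>) * (2 * B))"
    unfolding L_bEX_def by linarith
   also have "... = ?C * B"
   proof -
    have "(\<Sum>x\<in>V. \<Sum>y\<in>V. \<bar>c x y\<bar> * (2 * B)) = (\<Sum>x\<in>V. \<Sum>y\<in>V. \<bar>c x y\<bar> * 2) * B"
     by (simp only: sum_distrib_right mult.assoc)
    moreover have "(\<Sum>a\<in>bd. (\<bar>lamM a\<bar> + \<bar>lamP a\<bar>) * (2 * B)) = (\<Sum>a\<in>bd. (\<bar>lamM a\<bar> + \<bar>lamP a\<bar>) * 2) * B"
     by (simp only: sum_distrib_right mult.assoc)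
    ultimately show ?thesis by (simp only: distrib_right[of _ _ B] times_divide_eq_left)
   qed
   finally show ?thesis using \<tau> by (simp add: abs_mult mult.assoc mult_left_mono del: times_divide_eq_left)
  qed
 qed
 then show ?thesis by blast
qed

section \<open>Form bounds for the generator with a potential, in the bulk and at the
  boundary\<close>

context driven_exclusion
begin

lemma normsq_nonneg: "0 \<le> normsq g"
 by (intro sum_nonneg mult_nonneg_nonneg less_imp_le[OF \<nu>_pos]) auto

text \<open>The potential costs at most a multiple of \<open>\<theta> * sqrt n\<close>, where
  \<open>\<theta>^2\<close> is the uniform bound on the exchanges within B given by the moving
  particle lemma. As \<open>\<theta>^2\<close> is proportional to the exchange energy D, Young's
  inequality absorbs it into the dissipation \<open>- \<tau> * D / 4\<close>.\<close>

lemma bulk_form_bound: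
 assumes B: "B \<subseteq> V" and \<tau>: "0 < \<tau>" and v: "0 < v" and M: "0 < M" and k: "0 < k" and s: "s \<in> {1, -1}"
  and R: "\<And>y z. y \<in> B \<Longrightarrow> z \<in> B \<Longrightarrow> ereal M \<le> ereal (\<tau> / v) * inverse (R_eff V c y z)"
  and A: "finite A" "A \<subseteq> B" "card A \<le> K" "depends_only_on A f" and F: "\<And>\<eta>. \<bar>f \<eta>\<bar> \<le> F"
 shows "(\<Sum>\<eta>\<in>configs V. \<nu> \<eta> * (g \<eta> * (\<tau> * gen g \<eta>
      + s * (k * v) * (f \<eta> - bernoulli_mean f (Av B \<eta>)) * g \<eta>)))
   \<le> v * (5 / \<beta> ^ 4 * (\<tau> / v * energy V c \<rho>) + k * (2 ^ K * (2 * F)) * (real K / real (card B))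
      + 4 * (k * (2 ^ K * (2 * F)))^2 / M) * normsq g"
proof -
 let ?S = "configs V" and ?U = "\<lambda>\<eta>. f \<eta> - bernoulli_mean f (Av B \<eta>)"
 define n where "n = normsq g"
 define E where "E = energy V c \<rho>"
 define h where "h \<eta> = sqrt (\<nu> \<eta>) * g \<eta>" for \<eta>
 define D where "D = swap_energy V c h"
 define \<theta> where "\<theta> = sqrt (4 * (\<tau> / v * D) / M)"
 define C where "C = 2 ^ K * (2 * F)"
 have F0: "0 \<le> F" using F[of undefined] by linarith
 have C0: "0 \<le> C" using F0 by (simp add: C_def)
 have E0: "0 \<le> E" unfolding E_def by (rule energy_nonneg) (rule c_nonneg)
 have n0: "0 \<le> n" unfolding n_def by (rule normsq_nonneg)
 have D0: "0 \<le> D" unfolding D_def swap_energy_def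
  by (intro divide_nonneg_pos sum_nonneg mult_nonneg_nonneg c_nonneg swap_form_nonneg) auto
 have hsq: "(h \<eta>)^2 = \<nu> \<eta> * (g \<eta>)^2" for \<eta>
  unfolding h_def by (simp add: power_mult_distrib less_imp_le[OF \<nu>_pos])
 then have nh: "(\<Sum>\<eta>\<in>?S. (h \<eta>)^2) = n" by (simp add: n_def)
 have \<theta>2: "\<theta>^2 = 4 * (\<tau> / v * D) / M" "0 \<le> \<theta>" using \<tau> v M D0 by (auto simp: \<theta>_def)
 have swap: "swap_form V h y z \<le> \<theta>^2" if "y \<in> B" "z \<in> B" for y z
 proof -
  have "M * swap_form V h y z \<le> 4 * (\<tau> / v) * swap_energy V c h"
   by (rule moving_particle) (use R[OF that] that B \<tau> v c_nonneg c_sym in auto)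
  then show ?thesis unfolding \<theta>2 D_def pos_le_divide_eq[OF M] by (simp only: mult_ac)
 qed
 have "\<bar>\<Sum>\<eta>\<in>?S. 1 * ?U \<eta> * (h \<eta>)^2\<bar>
   \<le> (2 ^ card A - 1) * (2 * F * (real K / real (card B) * n + \<theta> * sqrt n))"
  unfolding nh[symmetric]
  by (rule mean_field_replacement[OF finite_V B \<theta>2(2) swap A F]) auto
 also have "... \<le> 2 ^ K * (2 * F * (real K / real (card B) * n + \<theta> * sqrt n))"
 proof (intro mult_right_mono)
  have "(2 :: real) ^ card A \<le> 2 ^ K" by (rule power_increasing[OF A(3)]) simp
  then show "2 ^ card A - 1 \<le> (2 :: real) ^ K" by linarith
 qed (use F0 n0 \<theta>2 in auto)
 finally have mf: "\<bar>\<Sum>\<eta>\<in>?S. ?U \<eta> * (h \<eta>)^2\<bar> \<le> C * (real K / real (card B) * n + \<theta> * sqrt n)"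
  by (simp add: C_def mult.assoc)
 have U: "(\<Sum>\<eta>\<in>?S. \<nu> \<eta> * (g \<eta> * (s * (k * v) * ?U \<eta> * g \<eta>))) \<le> k * v * (C * (real K / real (card B) * n + \<theta> * sqrt n))"
 proof -
  have "(\<Sum>\<eta>\<in>?S. \<nu> \<eta> * (g \<eta> * (s * (k * v) * ?U \<eta> * g \<eta>))) = s * (k * v) * (\<Sum>\<eta>\<in>?S. ?U \<eta> * (h \<eta>)^2)"
   unfolding hsq unfolding sum_distrib_left by (intro sum.cong refl) (simp only: power2_eq_square mult_ac)
  also have "... \<le> \<bar>s * (k * v) * (\<Sum>\<eta>\<in>?S. ?U \<eta> * (h \<eta>)^2)\<bar>" by (rule abs_ge_self)
  also have "... = k * v * \<bar>\<Sum>\<eta>\<in>?S. ?U \<eta> * (h \<eta>)^2\<bar>" using s k v by (auto simp: abs_mult)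
  also have "... \<le> k * v * (C * (real K / real (card B) * n + \<theta> * sqrt n))"
   using k v by (intro mult_left_mono mf) auto
  finally show ?thesis .
 qed
 \<comment> \<open>The flip forms are dropped by sign. The 5 is 18/4 from the change of measure plus
   1/2 from \<open>dirichlet_bound\<close>, whose \<open>\<beta>^2\<close> is lowered to
   \<open>\<beta> ^ 4\<close>.\<close>
 have Lb: "(\<Sum>\<eta>\<in>?S. \<nu> \<eta> * (g \<eta> * gen g \<eta>)) \<le> - D / 4 + 5 / \<beta> ^ 4 * E * n"
 proof -
  have "0 \<le> (\<Sum>a\<in>bd. flip_form g a)" by (intro sum_nonneg flip_form_nonneg)
  then have "(\<Sum>\<eta>\<in>?S. \<nu> \<eta> * (g \<eta> * gen g \<eta>)) \<le> - swap_dirichlet g / 2 + E / (2 * \<beta>^2) * n"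
   using dirichlet_bound[of g] unfolding n_def E_def by argo
  moreover have "D \<le> 2 * swap_dirichlet g + 18 / \<beta> ^ 4 * E * n"
   using swap_energy_le[of g] unfolding D_def h_def E_def n_def .
  moreover have "E / (2 * \<beta>^2) * n + 18 / 4 / \<beta> ^ 4 * E * n \<le> 5 / \<beta> ^ 4 * E * n"
  proof (cases "V = {}")
   case True
   then show ?thesis by (simp add: E_def energy_def)
  next
   case False
   then have "\<beta> \<le> 1" using \<beta>_le by auto
   then have "\<beta> ^ 4 \<le> \<beta>^2" using \<beta> by (intro power_decreasing) auto
   then have "1 / \<beta>^2 \<le> 1 / \<beta> ^ 4" using \<beta> by (intro divide_left_mono) auto
   then have "1 / \<beta>^2 * (E * n) \<le> 1 / \<beta> ^ 4 * (E * n)" using E0 n0 by (intro mult_right_mono) auto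
   then show ?thesis by (simp add: field_simps)
  qed
  ultimately show ?thesis by argo
 qed
 \<comment> \<open>The coefficient 1/16 is forced: \<open>\<tau> * D / 4\<close> equals
   \<open>v * (M * \<theta>^2 / 16)\<close>.\<close>
 have young: "k * C * \<theta> * sqrt n - M * \<theta>^2 / 16 \<le> 4 * (k * C)^2 / M * n"
 proof -
  have "0 \<le> (\<theta> * M / 4 - 2 * (k * C) * sqrt n)^2 / M" using M by simp
  also have "... = M * \<theta>^2 / 16 - k * C * \<theta> * sqrt n + 4 * (k * C)^2 / M * n"
   using M n0 by (simp add: power2_diff power_mult_distrib power_divide field_simps) (simp add: power2_eq_square)
  finally show ?thesis by linarith
 qed
 have TD: "\<tau> * D = v * (M * \<theta>^2 / 4)" using \<theta>2 M v by simp
 have "(\<Sum>\<eta>\<in>?S. \<nu> \<eta> * (g \<eta> * (\<tau> * gen g \<eta> + s * (k * v) * ?U \<eta> * g \<eta>)))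
   = \<tau> * (\<Sum>\<eta>\<in>?S. \<nu> \<eta> * (g \<eta> * gen g \<eta>))
    + (\<Sum>\<eta>\<in>?S. \<nu> \<eta> * (g \<eta> * (s * (k * v) * ?U \<eta> * g \<eta>)))"
  unfolding sum_distrib_left sum.distrib[symmetric]
  by (intro sum.cong refl) (simp only: distrib_left mult.left_commute)
 also have "... \<le> \<tau> * (- D / 4 + 5 / \<beta> ^ 4 * E * n) + k * v * (C * (real K / real (card B) * n + \<theta> * sqrt n))"
  using \<tau> by (intro add_mono U mult_left_mono Lb) auto
 also have "... = v * (5 / \<beta> ^ 4 * (\<tau> / v * E) * n + k * C * (real K / real (card B)) * n
   + (k * C * \<theta> * sqrt n - M * \<theta>^2 / 16))"
 proof -
  have "\<tau> * (- D / 4 + 5 / \<beta> ^ 4 * E * n) = - (\<tau> * D) / 4 + v * (5 / \<beta> ^ 4 * (\<tau> / v * E) * n)"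
   using v by (simp add: algebra_simps)
  then show ?thesis unfolding TD by (simp add: algebra_simps)
 qed
 also have "... \<le> v * (5 / \<beta> ^ 4 * (\<tau> / v * E) * n + k * C * (real K / real (card B)) * n + 4 * (k * C)^2 / M * n)"
  using v young by (intro mult_left_mono add_left_mono) auto
 also have "... = v * (5 / \<beta> ^ 4 * (\<tau> / v * E) + k * C * (real K / real (card B)) + 4 * (k * C)^2 / M) * n"
  by (simp only: distrib_right distrib_left mult.assoc)
 finally show ?thesis unfolding E_def C_def n_def .
qed

text \<open>A single flip at a dominates the occupation variable there, m being a lower bound for
  both flip rates. The variable is first centred at \<open>\<rho> a\<close>; the shift to the
  reservoir density costs the flow divided by m.\<close>

lemma boundary_form_bound:
 assumes a: "a \<in> bd" and \<tau>: "0 < \<tau>" and m: "0 < m" "m \<le> lamP a" "m \<le> lamM a"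
  and q: "\<bar>q\<bar> \<le> G" and G: "0 < G"
 shows "(\<Sum>\<eta>\<in>configs V. \<nu> \<eta> * (g \<eta> * (\<tau> * gen g \<eta>
      + q * (of_bool (\<eta> a) - lamP a / (lamP a + lamM a)) * g \<eta>)))
   \<le> (\<tau> * energy V c \<rho> / (2 * \<beta>^2) + G * (\<bar>flow V c \<rho> a\<bar> / m) + G^2 / (2 * \<tau> * m * \<beta>)) * normsq g"
proof -
 let ?S = "configs V"
 define n where "n = normsq g"
 define E where "E = energy V c \<rho>"
 have aV: "a \<in> V" using a bd by auto
 have n0: "0 \<le> n" unfolding n_def by (rule normsq_nonneg)
 define W where "W = (\<Sum>\<eta>\<in>?S. \<nu> \<eta> * (g (flip a \<eta>) - g \<eta>)^2)"
 have Wle: "m * W \<le> (\<Sum>a\<in>bd. flip_form g a)"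
 proof -
  have "m * W = (\<Sum>\<eta>\<in>?S. \<nu> \<eta> * (m * (g (flip a \<eta>) - g \<eta>)^2))"
   unfolding W_def sum_distrib_left by (simp only: mult.left_commute)
  also have "... \<le> flip_form g a"
   unfolding flip_form_def using m
   by (intro sum_mono mult_left_mono mult_right_mono less_imp_le[OF \<nu>_pos]) (auto simp: rate_def)
  also have "... \<le> (\<Sum>a\<in>bd. flip_form g a)"
   using a finite_subset[OF bd finite_V] flip_form_nonneg by (intro member_le_sum) auto
  finally show ?thesis .
 qed
 define X where "X = (\<Sum>\<eta>\<in>?S. \<nu> \<eta> * (of_bool (\<eta> a) - \<rho> a) * (g \<eta>)^2)"
 have X: "G * \<bar>X\<bar> \<le> \<tau> * m * W / 2 + G^2 / (2 * \<tau> * m * \<beta>) * n"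
 proof -
  \<comment> \<open>Centring at \<open>\<rho> a\<close> is what makes the \<nu>-weighted variable
    antisymmetric under the flip, since \<open>\<rho> a\<close> is the mean of
    \<open>\<eta> a\<close> under \<nu>.\<close>
  have anti: "\<nu> (flip a \<eta>) * (of_bool (flip a \<eta> a) - \<rho> a) = - (\<nu> \<eta> * (of_bool (\<eta> a) - \<rho> a))" for \<eta>
   using \<nu>_flip_ratio[OF aV, of \<eta>] by (cases "\<eta> a") (simp_all add: flip_def wt_def algebra_simps)
  have "X = (\<Sum>\<eta>\<in>?S. \<nu> (flip a \<eta>) * (of_bool (flip a \<eta> a) - \<rho> a) * (g (flip a \<eta>))^2)"
   unfolding X_def by (rule sum_flip[OF aV, symmetric])
  also have "... = - (\<Sum>\<eta>\<in>?S. \<nu> \<eta> * (of_bool (\<eta> a) - \<rho> a) * (g (flip a \<eta>))^2)"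
   unfolding anti by (simp add: sum_negf)
  finally have "2 * X = (\<Sum>\<eta>\<in>?S. \<nu> \<eta> * (of_bool (\<eta> a) - \<rho> a) * (g \<eta>)^2)
    - (\<Sum>\<eta>\<in>?S. \<nu> \<eta> * (of_bool (\<eta> a) - \<rho> a) * (g (flip a \<eta>))^2)"
   unfolding X_def by linarith
  also have "... = (\<Sum>\<eta>\<in>?S. \<nu> \<eta> * (of_bool (\<eta> a) - \<rho> a) * ((g \<eta>)^2 - (g (flip a \<eta>))^2))"
   by (simp only: sum_subtractf right_diff_distrib)
  finally have X2: "2 * X = (\<Sum>\<eta>\<in>?S. \<nu> \<eta> * (of_bool (\<eta> a) - \<rho> a) * ((g \<eta>)^2 - (g (flip a \<eta>))^2))" .
  have "2 * \<bar>X\<bar> = \<bar>2 * X\<bar>" by simp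
  also have "... \<le> (\<Sum>\<eta>\<in>?S. \<nu> \<eta> * \<bar>(g \<eta>)^2 - (g (flip a \<eta>))^2\<bar>)"
   unfolding X2
  proof (intro order_trans[OF sum_abs] sum_mono)
   fix \<eta>
   have "\<bar>of_bool (\<eta> a) - \<rho> a\<bar> \<le> 1" using \<rho>_strict[OF aV] by (auto simp: of_bool_def)
   then have "\<nu> \<eta> * \<bar>of_bool (\<eta> a) - \<rho> a\<bar> * \<bar>(g \<eta>)^2 - (g (flip a \<eta>))^2\<bar>
     \<le> \<nu> \<eta> * 1 * \<bar>(g \<eta>)^2 - (g (flip a \<eta>))^2\<bar>"
    by (intro mult_right_mono mult_left_mono less_imp_le[OF \<nu>_pos]) auto
   then show "\<bar>\<nu> \<eta> * (of_bool (\<eta> a) - \<rho> a) * ((g \<eta>)^2 - (g (flip a \<eta>))^2)\<bar> \<le> \<nu> \<eta> * \<bar>(g \<eta>)^2 - (g (flip a \<eta>))^2\<bar>"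
    by (simp only: abs_mult abs_of_pos[OF \<nu>_pos] mult_1_right)
  qed
  finally have X3: "2 * \<bar>X\<bar> \<le> (\<Sum>\<eta>\<in>?S. \<nu> \<eta> * \<bar>(g \<eta>)^2 - (g (flip a \<eta>))^2\<bar>)" .
  have tm: "0 < \<tau> * m" using \<tau> m by simp
  have young: "G * \<bar>u^2 - w^2\<bar> \<le> \<tau> * m * (w - u)^2 + G^2 / (2 * \<tau> * m) * (u^2 + w^2)" for u w :: real
  proof -
   have gen: "(2 * P * A - G * B)^2 / (4 * P) = P * A^2 - G * (A * B) + G^2 / (4 * P) * B^2"
    if "0 < P" for P A B :: real
    using that by (simp add: power2_eq_square field_simps)
   have "0 \<le> (2 * (\<tau> * m) * \<bar>w - u\<bar> - G * \<bar>w + u\<bar>)^2 / (4 * (\<tau> * m))" using tm by simp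
   also have "... = \<tau> * m * (w - u)^2 - G * (\<bar>w - u\<bar> * \<bar>w + u\<bar>) + G^2 / (4 * (\<tau> * m)) * (w + u)^2"
    by (simp only: gen[OF tm] power2_abs)
   also have "\<bar>w - u\<bar> * \<bar>w + u\<bar> = \<bar>u^2 - w^2\<bar>"
    by (simp add: power2_eq_square square_diff_square_factored abs_minus_commute flip: abs_mult)
      (metis abs_minus_commute abs_mult add.commute mult.commute)
   finally have "G * \<bar>u^2 - w^2\<bar> \<le> \<tau> * m * (w - u)^2 + G^2 / (4 * (\<tau> * m)) * (w + u)^2" by linarith
   also have "G^2 / (4 * (\<tau> * m)) * (w + u)^2 \<le> G^2 / (4 * (\<tau> * m)) * (2 * (u^2 + w^2))"
   proof (intro mult_left_mono)
    show "(w + u)^2 \<le> 2 * (u^2 + w^2)"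
     using zero_le_power2[of "w - u"] by (simp add: power2_sum power2_diff)
   qed (use tm in simp)
   also have "G^2 / (4 * (\<tau> * m)) * (2 * (u^2 + w^2)) = G^2 / (2 * \<tau> * m) * (u^2 + w^2)"
   proof -
    have "G^2 / (4 * P) * (2 * x) = G^2 / (2 * P) * x" for P x :: real by simp
    then show ?thesis by (simp only: mult.assoc)
   qed
   finally show ?thesis by simp
  qed
  have "2 * (G * \<bar>X\<bar>) \<le> G * (\<Sum>\<eta>\<in>?S. \<nu> \<eta> * \<bar>(g \<eta>)^2 - (g (flip a \<eta>))^2\<bar>)"
   using mult_left_mono[OF X3, of G] G by simp
  also have "... = (\<Sum>\<eta>\<in>?S. \<nu> \<eta> * (G * \<bar>(g \<eta>)^2 - (g (flip a \<eta>))^2\<bar>))"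
   unfolding sum_distrib_left by (simp only: mult.left_commute)
  also have "... \<le> (\<Sum>\<eta>\<in>?S. \<nu> \<eta> * (\<tau> * m * (g (flip a \<eta>) - g \<eta>)^2
    + G^2 / (2 * \<tau> * m) * ((g \<eta>)^2 + (g (flip a \<eta>))^2)))"
   by (intro sum_mono mult_left_mono young less_imp_le[OF \<nu>_pos])
  also have "... = \<tau> * m * W + G^2 / (2 * \<tau> * m) * (n + (\<Sum>\<eta>\<in>?S. \<nu> \<eta> * (g (flip a \<eta>))^2))"
   unfolding W_def n_def sum_distrib_left sum.distrib[symmetric]
   by (intro sum.cong refl) (simp only: distrib_left mult.left_commute)
  also have "(\<Sum>\<eta>\<in>?S. \<nu> \<eta> * (g (flip a \<eta>))^2) = (\<Sum>\<eta>\<in>?S. \<nu> (flip a \<eta>) * (g \<eta>)^2)"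
   using sum_flip[OF aV, of "\<lambda>\<eta>. \<nu> (flip a \<eta>) * (g \<eta>)^2"] by simp
  finally have Xle: "2 * (G * \<bar>X\<bar>) \<le> \<tau> * m * W + G^2 / (2 * \<tau> * m) * (n + (\<Sum>\<eta>\<in>?S. \<nu> (flip a \<eta>) * (g \<eta>)^2))" .
  \<comment> \<open>The norm of the flipped function is compared with that of g by
    \<open>\<nu>_flip_le\<close>; this produces the \<beta> in the last error term.\<close>
  have "n + (\<Sum>\<eta>\<in>?S. \<nu> (flip a \<eta>) * (g \<eta>)^2) \<le> 2 / \<beta> * n"
  proof -
   have "(\<Sum>\<eta>\<in>?S. \<nu> (flip a \<eta>) * (g \<eta>)^2) \<le> (\<Sum>\<eta>\<in>?S. \<nu> \<eta> / \<beta> * (g \<eta>)^2)"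
    by (intro sum_mono mult_right_mono \<nu>_flip_le aV) auto
   also have "... = 1 / \<beta> * n" unfolding n_def sum_distrib_left by (simp add: field_simps)
   finally have 1: "(\<Sum>\<eta>\<in>?S. \<nu> (flip a \<eta>) * (g \<eta>)^2) \<le> 1 / \<beta> * n" .
   have "1 * n \<le> 1 / \<beta> * n" using \<beta> \<beta>_le[OF aV] n0 by (intro mult_right_mono) auto
   with 1 show ?thesis by simp
  qed
  from mult_left_mono[OF this, of "G^2 / (2 * \<tau> * m)"]
  have "G^2 / (2 * \<tau> * m) * (n + (\<Sum>\<eta>\<in>?S. \<nu> (flip a \<eta>) * (g \<eta>)^2)) \<le> G^2 / (2 * \<tau> * m) * (2 / \<beta> * n)"
   using tm by simp
  also have "... = 2 * (G^2 / (2 * \<tau> * m * \<beta>) * n)" by simp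
  finally show ?thesis using Xle by linarith
 qed
 let ?\<alpha> = "lamP a / (lamP a + lamM a)"
 have dr: "\<bar>\<rho> a - ?\<alpha>\<bar> \<le> \<bar>flow V c \<rho> a\<bar> / m"
 proof -
  have l: "0 < lamP a + lamM a" using m by linarith
  \<comment> \<open>Stationarity at a boundary site says that the deviation from the reservoir
    density is the flow over the total rate.\<close>
  then have "\<rho> a - ?\<alpha> = flow V c \<rho> a / (lamP a + lamM a)"
   unfolding stationary[OF a] by (simp add: field_simps)
  then have "\<bar>\<rho> a - ?\<alpha>\<bar> = \<bar>flow V c \<rho> a\<bar> / (lamP a + lamM a)" using l by simp
  also have "... \<le> \<bar>flow V c \<rho> a\<bar> / m" using m by (intro divide_left_mono) auto
  finally show ?thesis .
 qed
 have Y: "(\<Sum>\<eta>\<in>?S. \<nu> \<eta> * (g \<eta> * (q * (of_bool (\<eta> a) - ?\<alpha>) * g \<eta>))) = q * X + q * ((\<rho> a - ?\<alpha>) * n)"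
  unfolding X_def n_def sum_distrib_left sum.distrib[symmetric]
  by (intro sum.cong refl) (simp add: power2_eq_square algebra_simps)
 have q1: "q * X \<le> G * \<bar>X\<bar>"
 proof -
  have "q * X \<le> \<bar>q\<bar> * \<bar>X\<bar>" by (metis abs_ge_self abs_mult)
  also have "... \<le> G * \<bar>X\<bar>" using q by (intro mult_right_mono) auto
  finally show ?thesis .
 qed
 have q2: "q * ((\<rho> a - ?\<alpha>) * n) \<le> G * (\<bar>flow V c \<rho> a\<bar> / m) * n"
 proof -
  have "q * ((\<rho> a - ?\<alpha>) * n) \<le> \<bar>q\<bar> * (\<bar>\<rho> a - ?\<alpha>\<bar> * n)"
   using n0 by (metis abs_ge_self abs_mult abs_of_nonneg)
  also have "... \<le> G * (\<bar>flow V c \<rho> a\<bar> / m * n)" using q n0 G m by (intro mult_mono dr) auto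
  finally show ?thesis by (simp only: mult.assoc)
 qed
 have "(\<Sum>\<eta>\<in>?S. \<nu> \<eta> * (g \<eta> * gen g \<eta>)) \<le> - (m * W) / 2 + E / (2 * \<beta>^2) * n"
  using dirichlet_bound[of g] Wle swap_dirichlet_nonneg[of g] unfolding E_def n_def by argo
 then have L: "\<tau> * (\<Sum>\<eta>\<in>?S. \<nu> \<eta> * (g \<eta> * gen g \<eta>))
   \<le> \<tau> * (- (m * W) / 2 + E / (2 * \<beta>^2) * n)" using \<tau> by (intro mult_left_mono) auto
 have "(\<Sum>\<eta>\<in>?S. \<nu> \<eta> * (g \<eta> * (\<tau> * gen g \<eta> + q * (of_bool (\<eta> a) - ?\<alpha>) * g \<eta>)))
   = \<tau> * (\<Sum>\<eta>\<in>?S. \<nu> \<eta> * (g \<eta> * gen g \<eta>))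
    + (\<Sum>\<eta>\<in>?S. \<nu> \<eta> * (g \<eta> * (q * (of_bool (\<eta> a) - ?\<alpha>) * g \<eta>)))"
  unfolding sum_distrib_left sum.distrib[symmetric]
  by (intro sum.cong refl) (simp only: distrib_left mult.left_commute)
 also have "... \<le> \<tau> * (- (m * W) / 2 + E / (2 * \<beta>^2) * n) + (\<tau> * m * W / 2 + G^2 / (2 * \<tau> * m * \<beta>) * n)
   + G * (\<bar>flow V c \<rho> a\<bar> / m) * n"
  unfolding Y using L q1 q2 X by linarith
 also have "... = (\<tau> * E / (2 * \<beta>^2) + G * (\<bar>flow V c \<rho> a\<bar> / m) + G^2 / (2 * \<tau> * m * \<beta>)) * n"
  by (simp add: algebra_simps)
 finally show ?thesis unfolding E_def n_def .
qed

end

section \<open>Balls, maximum principle and stationary density\<close>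

context weighted_graph
begin

section \<open>Graph distance, geodesics and sizes of balls\<close>

abbreviation adj where "adj \<equiv> (\<lambda>u v. 0 < c u v)"

lemma gdist_path: "(adj ^^ gdist c x y) x y"
proof -
 obtain n where "(adj ^^ n) x y" using connected[of x y] rtranclp_power[of adj x y] by auto
 then show ?thesis unfolding gdist_def by (rule LeastI)
qed

lemma gdist_le: "(adj ^^ n) x y \<Longrightarrow> gdist c x y \<le> n"
 unfolding gdist_def by (rule Least_le)

lemma gdist_self [simp]: "gdist c x x = 0"
 using gdist_le[of 0 x x] by simp

lemma gdist_eq_0: "gdist c x y = 0 \<longleftrightarrow> x = y"
 using gdist_path[of x y] by auto

lemma gdist_triangle: "gdist c x z \<le> gdist c x y + gdist c y z"
 by (rule gdist_le, unfold relpowp_add, rule relcomppI, rule gdist_path, rule gdist_path)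

lemma gdist_sym: "gdist c x y = gdist c y x"
proof -
 have conv: "(adj ^^ n) y x" if "(adj ^^ n) x y" for n x y
  using that
 proof (induction n arbitrary: y)
  case (Suc n)
  then obtain w where "(adj ^^ n) x w" "adj w y" by auto
  then have "adj y w" "(adj ^^ n) w x" using Suc.IH[of w] sym[of w y] by simp_all
  then show ?case by (rule relpowp_Suc_I2)
 qed simp
 have "gdist c x y \<le> gdist c y x" for x y by (rule gdist_le[OF conv[OF gdist_path]])
 then show ?thesis by (intro order_antisym)
qed

lemma gdist_predecessor:
 assumes "gdist c x y = Suc n"
 obtains w where "0 < c w y" "gdist c x w = n"
proof -
 obtain w where w: "(adj ^^ n) x w" "adj w y"
  using gdist_path[of x y] unfolding assms by auto
 have "gdist c w y \<le> 1" by (rule gdist_le) (use w in auto)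
 then have "gdist c x w = n"
  using gdist_le[OF w(1)] gdist_triangle[of x y w] assms by linarith
 then show ?thesis using w that by blast
qed

lemma geodesic_point:
 assumes "k \<le> gdist c x y"
 obtains w where "gdist c x w = k" "gdist c y w \<le> gdist c x y - k"
proof -
 have "\<exists>w. gdist c x w = gdist c x y - j \<and> gdist c y w \<le> j" if "j \<le> gdist c x y" for j
  using that
 proof (induction j)
  case (Suc j)
  then obtain w where w: "gdist c x w = gdist c x y - j" "gdist c y w \<le> j" by auto
  then have "gdist c x w \<noteq> 0" using Suc.prems by simp
  then obtain n where n: "gdist c x w = Suc n" using not0_implies_Suc by blast
  then obtain u where u: "0 < c u w" "gdist c x u = n" by (rule gdist_predecessor)
  have "gdist c w u \<le> 1" by (rule gdist_le) (use u sym[of u w] in auto)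
  then show ?case using gdist_triangle[of y u w] w n u Suc.prems by (intro exI[of _ u]) auto
 qed (auto intro: exI[of _ y])
 from this[of "gdist c x y - k"] show ?thesis using assms that by auto
qed

lemma finite_gdist_le: "finite {y. gdist c x y \<le> n}"
proof (induction n)
 case 0
 then show ?case by (simp add: gdist_eq_0)
next
 case (Suc n)
 have "{y. gdist c x y \<le> Suc n} \<subseteq> {y. gdist c x y \<le> n} \<union> (\<Union>w\<in>{y. gdist c x y \<le> n}. {y. 0 < c w y})"
 proof
  fix y assume y: "y \<in> {y. gdist c x y \<le> Suc n}"
  show "y \<in> {y. gdist c x y \<le> n} \<union> (\<Union>w\<in>{y. gdist c x y \<le> n}. {y. 0 < c w y})"
  proof (cases "gdist c x y \<le> n")
   case False
   then have "gdist c x y = Suc n" using y by auto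
   then obtain w where "0 < c w y" "gdist c x w = n" by (rule gdist_predecessor)
   then show ?thesis by auto
  qed auto
 qed
 then show ?case by (rule finite_subset) (use Suc locally_finite in auto)
qed

lemma finite_gball: "finite (gball c x r)"
 by (rule finite_subset[OF _ finite_gdist_le[of x "nat \<lceil>r\<rceil>"]]) (auto simp: gball_def, linarith)

lemma exists_far:
 obtains y where "n \<le> gdist c x y"
proof -
 obtain y where "\<not> gdist c x y \<le> n"
  using ex_new_if_finite[OF infinite_vertices finite_gdist_le[of x n]] by blast
 then show ?thesis using that[of y] by simp
qed

text \<open>The ball may be cut off by the finite graph, so its points are sought along geodesics
  from the centre \<open>o'\<close>. If x is far from \<open>o'\<close>, the last n points before x
  qualify. If x is near \<open>o'\<close>, a geodesic from \<open>o'\<close> to a remote vertex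
  supplies n points, each within 2n of x. Distinct distances from \<open>o'\<close> make the points
  distinct.\<close>

lemma card_gball_Int_ge:
 assumes x: "x \<in> gball c o' S" and n: "2 * real n \<le> R" "R \<le> S"
 shows "n \<le> card (gball c x R \<inter> gball c o' S)"
proof -
 let ?B = "gball c x R \<inter> gball c o' S"
 have fin: "finite ?B" using finite_gball by auto
 show ?thesis
 proof (cases "n \<le> gdist c o' x")
  case True
  let ?d = "gdist c o' x"
  have "{?d - n<..?d} \<subseteq> gdist c o' ` ?B"
  proof
   fix k assume k: "k \<in> {?d - n<..?d}"
   then obtain w where w: "gdist c o' w = k" "gdist c x w \<le> ?d - k"
    using geodesic_point[of k o' x] by auto
   have "?d - k < n" using k True by auto
   then have "real (gdist c x w) < R" using w(2) n(1) by linarith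
   moreover have "real (gdist c o' w) < S" using w(1) k x by (auto simp: gball_def)
   ultimately show "k \<in> gdist c o' ` ?B" using w by (auto simp: gball_def)
  qed
  then have "card {?d - n<..?d} \<le> card ?B" by (rule surj_card_le[OF fin])
  then show ?thesis using True by simp
 next
  case False
  obtain y where y: "n \<le> gdist c o' y" by (rule exists_far)
  have "{..<n} \<subseteq> gdist c o' ` ?B"
  proof
   fix k assume k: "k \<in> {..<n}"
   obtain w where w: "gdist c o' w = k"
    by (rule geodesic_point[of k o' y]) (use y k in auto)
   have "gdist c x w < 2 * n" using gdist_triangle[of x w o'] gdist_sym[of x o'] False w k by auto
   then have "real (gdist c x w) < R" using n(1) by linarith
   moreover have "real (gdist c o' w) < S" using w k n by auto
   ultimately show "k \<in> gdist c o' ` ?B" using w by (auto simp: gball_def)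
  qed
  then have "card {..<n} \<le> card ?B" by (rule surj_card_le[OF fin])
  then show ?thesis by simp
 qed
qed

lemma neighbour_in_gball:
 assumes R: "1 < R" and x: "x \<in> gball c o' R"
 obtains w where "w \<in> gball c o' R" "0 < c x w"
proof (cases "gdist c o' x")
 case 0
 obtain y where "1 \<le> gdist c o' y" by (rule exists_far)
 then obtain w where w: "gdist c o' w = 1" by (rule geodesic_point)
 then obtain u where "0 < c u w" "gdist c o' u = 0" using gdist_predecessor[of o' w 0] by auto
 then show ?thesis using that[of w] 0 w R by (auto simp: gball_def gdist_eq_0)
next
 case (Suc n)
 then obtain w where "0 < c w x" "gdist c o' w = n" by (rule gdist_predecessor)
 then show ?thesis using that[of w] Suc x sym[of w x] by (auto simp: gball_def)
qed

text \<open>The boundary hypothesis \<open>bdry\<close> is a Robin condition in disguise: it bounds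
  f only where the flow is nonpositive, as it is at a maximum. Hence a maximum above b cannot lie in
  \<open>bd\<close>; it then spreads to the whole ball and reaches \<open>bd\<close> after
  all.\<close>

lemma maximum_principle:
 fixes R :: real and o'
 defines "V \<equiv> gball c o' R"
 assumes bd: "bd \<noteq> {}" "bd \<subseteq> V"
  and harm: "\<And>x. x \<in> V - bd \<Longrightarrow> flow V c f x = 0"
  and bdry: "\<And>a. a \<in> bd \<Longrightarrow> flow V c f a \<le> 0 \<Longrightarrow> f a \<le> b"
  and x: "x \<in> V"
 shows "f x \<le> b"
proof (rule ccontr)
 assume nb: "\<not> f x \<le> b"
 have fin: "finite V" unfolding V_def by (rule finite_gball)
 define m where "m = Max (f ` V)"
 have m: "f y \<le> m" if "y \<in> V" for y
  unfolding m_def by (rule Max_ge) (use fin that in auto)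
 have mV: "m \<in> f ` V" unfolding m_def by (rule Max_in) (use fin x in auto)
 have mb: "b < m" using m[OF x] nb by linarith
 have le: "c z y * (f y - f z) \<le> 0" if "f z = m" "y \<in> V" for z y
  using m[OF that(2)] that(1) nonneg[of z y] by (simp add: mult_nonneg_nonpos)
 have int: "z \<notin> bd" if "z \<in> V" "f z = m" for z
 proof
  assume "z \<in> bd"
  moreover have "flow V c f z \<le> 0" unfolding flow_def by (intro sum_nonpos le that)
  ultimately have "f z \<le> b" by (rule bdry)
  then show False using mb that(2) by simp
 qed
 have spread: "f y = m" if z: "z \<in> V" "f z = m" and y: "y \<in> V" "0 < c z y" for z y
 proof -
  have "flow V c f z = 0" by (rule harm) (use int z in auto)
  then have "(\<Sum>y\<in>V. - (c z y * (f y - f z))) = 0" by (simp add: flow_def sum_negf)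
  moreover have "0 \<le> - (c z u * (f u - f z))" if "u \<in> V" for u using le[OF z(2) that] by simp
  ultimately have "- (c z y * (f y - f z)) = 0"
   using y(1) by (simp add: sum_nonneg_eq_0_iff[OF fin])
  then show ?thesis using y(2) z(2) by simp
 qed
 obtain z where z: "z \<in> V" "f z = m" using mV by auto
 \<comment> \<open>The maximum is carried to the centre and then outwards: geodesics to the centre
   stay in the ball, while those between two general points need not.\<close>
 have o': "f o' = m \<and> o' \<in> V"
 proof -
  have "f o' = m \<and> o' \<in> V" if "gdist c o' z = n" "z \<in> V" "f z = m" for n z
   using that
  proof (induction n arbitrary: z)
   case 0
   then show ?case by (auto simp: gdist_eq_0)
  next
   case (Suc n)
   obtain w where w: "0 < c w z" "gdist c o' w = n" using Suc.prems(1) by (rule gdist_predecessor)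
   have "w \<in> V" using w(2) Suc.prems(1,2) by (auto simp: V_def gball_def)
   moreover have "f w = m" by (rule spread[OF Suc.prems(2,3) \<open>w \<in> V\<close>]) (use w sym[of w z] in simp)
   ultimately show ?case using Suc.IH[OF w(2)] by blast
  qed
  then show ?thesis using z by blast
 qed
 have "f y = m" if "gdist c o' y = n" "y \<in> V" for n y
  using that
 proof (induction n arbitrary: y)
  case 0
  then show ?case using o' by (auto simp: gdist_eq_0)
 next
  case (Suc n)
  obtain w where w: "0 < c w y" "gdist c o' w = n" using Suc.prems(1) by (rule gdist_predecessor)
  have "w \<in> V" using w(2) Suc.prems by (auto simp: V_def gball_def)
  moreover have "f w = m" by (rule Suc.IH[OF w(2) \<open>w \<in> V\<close>])
  ultimately show ?case using spread[of w y] w(1) Suc.prems(2) by simp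
 qed
 then have all: "f y = m" if "y \<in> V" for y using that by simp
 obtain a where a: "a \<in> bd" using bd(1) by auto
 then have "a \<in> V" using bd(2) by auto
 then show False using int[OF _ all] a by simp
qed

text \<open>Tests the effective resistance of an edge at \<open>a\<close> with the indicator of \<open>a\<close>.\<close>

lemma inverse_R_eff_le_site_conductance:
 assumes V: "finite V" "a \<in> V" and w: "w \<noteq> a"
 shows "inverse (R_eff V c a w) \<le> ereal (site_conductance V c a)"
proof -
 let ?h = "\<lambda>x. of_bool (x = a) :: real"
 have "inverse (R_eff V c a w) \<le> ereal (energy V c ?h)"
  unfolding inverse_R_eff[of c, OF nonneg] by (rule INF_lower) (use w in auto)
 also have "energy V c ?h = site_conductance V c a"
 proof -
  have "(\<Sum>x\<in>V. \<Sum>y\<in>V. c x y * (?h x - ?h y)^2)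
    = (\<Sum>x\<in>V. \<Sum>y\<in>V. (if x = a then c a y else 0) + (if y = a then c x a else 0))"
   by (intro sum.cong refl) (auto simp: no_loops)
  also have "... = (\<Sum>y\<in>V. c a y) + (\<Sum>x\<in>V. c x a)"
   unfolding sum.distrib using V by (subst sum.swap) simp
  also have "(\<Sum>x\<in>V. c x a) = (\<Sum>y\<in>V. c a y)" by (simp add: sym)
  finally show ?thesis by (simp add: energy_def site_conductance_def)
 qed
 finally show ?thesis .
qed

end

text \<open>Invariance at time t and the second-order expansion give an error of order t after
  division by t; then t tends to 0.\<close>

lemma (in finite_generator) invariant_expectation_zero:
 assumes inv: "invariant_measure S L \<mu>"
 shows "measure_pmf.expectation \<mu> (L f) = 0"
proof -
 have sub: "set_pmf \<mu> \<subseteq> S" using inv by (simp add: invariant_measure_def)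
 have E: "measure_pmf.expectation \<mu> g = (\<Sum>\<eta>\<in>S. g \<eta> * pmf \<mu> \<eta>)" for g :: "'s \<Rightarrow> real"
  by (rule integral_measure_pmf_real[OF finite_S]) (use sub in auto)
 obtain B where B: "\<And>\<eta>. \<eta> \<in> S \<Longrightarrow> \<bar>f \<eta>\<bar> \<le> B" using bounded_on_S[of f] by metis
 define K where "K = exp \<Lambda> * B"
 have bound: "\<bar>measure_pmf.expectation \<mu> (L f)\<bar> \<le> t * K" if t: "0 < t" "t \<le> 1" for t
 proof -
  have "(\<Sum>\<eta>\<in>S. P t f \<eta> * pmf \<mu> \<eta>) = (\<Sum>\<eta>\<in>S. f \<eta> * pmf \<mu> \<eta>)"
   using inv t unfolding invariant_measure_def E[symmetric] by auto
  then have "t * (\<Sum>\<eta>\<in>S. L f \<eta> * pmf \<mu> \<eta>) = - (\<Sum>\<eta>\<in>S. (P t f \<eta> - f \<eta> - t * L f \<eta>) * pmf \<mu> \<eta>)"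
   by (simp add: left_diff_distrib sum_subtractf sum_distrib_left mult.assoc)
  then have "\<bar>t * (\<Sum>\<eta>\<in>S. L f \<eta> * pmf \<mu> \<eta>)\<bar> = \<bar>\<Sum>\<eta>\<in>S. (P t f \<eta> - f \<eta> - t * L f \<eta>) * pmf \<mu> \<eta>\<bar>"
   by simp
  also have "... \<le> (\<Sum>\<eta>\<in>S. t^2 * K * pmf \<mu> \<eta>)"
   unfolding K_def
   by (intro order_trans[OF sum_abs] sum_mono)
    (use t in \<open>auto simp: abs_mult intro!: mult_right_mono semigroup_expansion[OF B]\<close>)
  also have "... = t^2 * K"
   using sum_pmf_eq_1[OF finite_S sub] by (simp flip: sum_distrib_left)
  finally have "t * \<bar>\<Sum>\<eta>\<in>S. L f \<eta> * pmf \<mu> \<eta>\<bar> \<le> t * (t * K)"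
   using t by (simp add: abs_mult power2_eq_square mult.assoc)
  then show ?thesis unfolding E using t by simp
 qed
 have "\<bar>measure_pmf.expectation \<mu> (L f)\<bar> \<le> 0"
 proof (rule LIMSEQ_le_const)
  show "(\<lambda>n. 1 / real (Suc n) * K) \<longlonglongrightarrow> 0"
   using tendsto_mult_left_zero[OF LIMSEQ_Suc[OF lim_1_over_n]] .
  show "\<exists>N. \<forall>n\<ge>N. \<bar>measure_pmf.expectation \<mu> (L f)\<bar> \<le> 1 / real (Suc n) * K"
   by (intro exI[of _ 0] allI impI bound) auto
 qed
 then show ?thesis by simp
qed

text \<open>The generator maps the occupation variable at x to an affine combination of occupation
  variables, so the equations for the one-site densities close.\<close>

lemma invariant_density_stationary:
 assumes V: "finite V" "bd \<subseteq> V" and c: "\<And>x y. c x y = c y x"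
  and inv: "invariant_measure (configs V) (L_bEX V c bd lamP lamM) \<mu>" and x: "x \<in> V"
 shows "flow V c (density \<mu>) x
   + (if x \<in> bd then lamP x - (lamP x + lamM x) * density \<mu> x else 0) = 0"
proof -
 let ?S = "configs V" and ?L = "L_bEX V c bd lamP lamM" and ?f = "\<lambda>\<eta>. of_bool (\<eta> x) :: real"
 obtain \<Lambda> where "finite_generator ?S (\<lambda>f \<eta>. 1 * ?L f \<eta>) \<Lambda>"
  using finite_generator_L_bEX[OF V zero_le_one, of c lamP lamM] by blast
 then interpret finite_generator ?S ?L \<Lambda> by simp
 have sub: "set_pmf \<mu> \<subseteq> ?S" using inv by (simp add: invariant_measure_def)
 have E: "measure_pmf.expectation \<mu> g = (\<Sum>\<eta>\<in>?S. g \<eta> * pmf \<mu> \<eta>)" for g :: "'a config \<Rightarrow> real"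
  by (rule integral_measure_pmf_real[OF finite_S]) (use sub in auto)
 have one: "(\<Sum>\<eta>\<in>?S. pmf \<mu> \<eta>) = 1" by (rule sum_pmf_eq_1[OF finite_S sub])
 have ex: "L_EX V c ?f \<eta> = (\<Sum>y\<in>V. c x y * (of_bool (\<eta> y) - of_bool (\<eta> x)))" for \<eta>
 proof -
  have "(\<Sum>u\<in>V. \<Sum>v\<in>V. c u v * (?f (exchange u v \<eta>) - ?f \<eta>))
    = (\<Sum>u\<in>V. \<Sum>v\<in>V. (if u = x then c x v * (of_bool (\<eta> v) - of_bool (\<eta> x)) else 0)
       + (if v = x then c u x * (of_bool (\<eta> u) - of_bool (\<eta> x)) else 0))"
   by (intro sum.cong refl) (auto simp: exchange_def)
  also have "... = (\<Sum>v\<in>V. c x v * (of_bool (\<eta> v) - of_bool (\<eta> x)))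
    + (\<Sum>u\<in>V. c u x * (of_bool (\<eta> u) - of_bool (\<eta> x)))"
   unfolding sum.distrib using V x by (subst sum.swap) simp
  also have "(\<Sum>u\<in>V. c u x * (of_bool (\<eta> u) - of_bool (\<eta> x))) = (\<Sum>v\<in>V. c x v * (of_bool (\<eta> v) - of_bool (\<eta> x)))"
   by (simp only: c[of _ x])
  finally show ?thesis by (simp add: L_EX_def)
 qed
 have bdr: "L_bdry bd lamP lamM ?f \<eta> = (if x \<in> bd then lamP x - (lamP x + lamM x) * of_bool (\<eta> x) else 0)" for \<eta>
 proof -
  have "L_bdry bd lamP lamM ?f \<eta>
    = (\<Sum>a\<in>bd. if a = x then lamP x - (lamP x + lamM x) * of_bool (\<eta> x) else 0)"
   unfolding L_bdry_def by (intro sum.cong refl) (auto simp: flip_def)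
  then show ?thesis using finite_subset[OF V(2,1)] by simp
 qed
 have "0 = measure_pmf.expectation \<mu> (?L ?f)" using invariant_expectation_zero[OF inv] by simp
 also have "... = (\<Sum>\<eta>\<in>?S. (\<Sum>y\<in>V. c x y * (of_bool (\<eta> y) - of_bool (\<eta> x))) * pmf \<mu> \<eta>)
   + (\<Sum>\<eta>\<in>?S. (if x \<in> bd then lamP x - (lamP x + lamM x) * of_bool (\<eta> x) else 0) * pmf \<mu> \<eta>)"
  unfolding E L_bEX_def ex bdr by (simp only: distrib_right sum.distrib)
 also have "(\<Sum>\<eta>\<in>?S. (\<Sum>y\<in>V. c x y * (of_bool (\<eta> y) - of_bool (\<eta> x))) * pmf \<mu> \<eta>)
   = (\<Sum>y\<in>V. c x y * (density \<mu> y - density \<mu> x))"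
  unfolding density_def E sum_subtractf[symmetric] sum_distrib_left sum_distrib_right
  by (subst sum.swap) (simp only: left_diff_distrib mult.assoc)
 also have "(\<Sum>\<eta>\<in>?S. (if x \<in> bd then lamP x - (lamP x + lamM x) * of_bool (\<eta> x) else 0) * pmf \<mu> \<eta>)
   = (if x \<in> bd then lamP x - (lamP x + lamM x) * density \<mu> x else 0)"
 proof (cases "x \<in> bd")
  case True
  have "(\<Sum>\<eta>\<in>?S. (lamP x - (lamP x + lamM x) * of_bool (\<eta> x)) * pmf \<mu> \<eta>)
    = lamP x * (\<Sum>\<eta>\<in>?S. pmf \<mu> \<eta>) - (lamP x + lamM x) * (\<Sum>\<eta>\<in>?S. of_bool (\<eta> x) * pmf \<mu> \<eta>)"
   unfolding sum_distrib_left sum_subtractf[symmetric] by (simp only: left_diff_distrib mult.assoc)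
  then show ?thesis using True unfolding one density_def E by simp
 qed simp
 finally show ?thesis by (simp add: flow_def)
qed

section \<open>Exponential tail bounds\<close>

lemma elog_le:
 assumes "p \<le> exp A" "0 < v"
 shows "ereal (1 / v) * elog p \<le> ereal (A / v)"
proof (cases "p \<le> 0")
 case True
 then show ?thesis using assms(2) by (simp add: elog_def)
next
 case False
 then have "ln p \<le> A" using assms(1) ln_le_cancel_iff[of p "exp A"] by simp
 then show ?thesis using False assms(2) by (simp add: elog_def divide_right_mono)
qed

context driven_exclusion
begin

text \<open>With the exponent \<open>k * v\<close> and a form bound proportional to v, division by v
  leaves \<open>T * \<theta> - k * \<delta>\<close> plus the start cost, of which only
  \<open>card V / v\<close> remains.\<close>

lemma tail_log_bound:
 assumes mc: "markov_chain_from M (configs V) (\<lambda>f \<eta>. \<tau> * gen f \<eta>) \<eta>0 X"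
  and pos: "0 < T" "0 < \<tau>" "0 < v" "0 < k"
  and Y: "\<And>t \<eta>. 0 \<le> t \<Longrightarrow> t \<le> T \<Longrightarrow> \<eta> \<in> configs V \<Longrightarrow> \<bar>Y t \<eta>\<bar> \<le> w"
  and cont: "\<And>\<eta>. \<eta> \<in> configs V \<Longrightarrow> continuous_on {0..T} (\<lambda>t. Y t \<eta>)"
  and form: "\<And>t g s. 0 \<le> t \<Longrightarrow> t \<le> T \<Longrightarrow> s \<in> {1, -1} \<Longrightarrow>
   (\<Sum>\<eta>\<in>configs V. \<nu> \<eta> * (g \<eta> * (\<tau> * gen g \<eta> + s * (k * v) * Y t \<eta> * g \<eta>)))
    \<le> v * \<theta> * normsq g"
 shows "ereal (1 / v) * elog (measure M {\<omega> \<in> space M. \<bar>LBINT t:{0..T}. Y t (X t \<omega>)\<bar> > \<delta>})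
   \<le> ereal (ln 2 / v + real (card V) / v * ln (1 / \<beta>) + T * \<theta> - k * \<delta>)"
proof -
 obtain \<Lambda> where "finite_generator (configs V) (\<lambda>f \<eta>. \<tau> * gen f \<eta>) \<Lambda>"
  using finite_generator_L_bEX[OF finite_V bd less_imp_le[OF pos(2)], of c lamP lamM] by blast
 then interpret G: finite_generator "configs V" "\<lambda>f \<eta>. \<tau> * gen f \<eta>" \<Lambda> .
 have \<eta>0: "\<eta>0 \<in> configs V" using mc by (simp add: markov_chain_from_def)
 have kv: "0 < k * v" using pos by simp
 have "measure M {\<omega> \<in> space M. \<bar>LBINT t:{0..T}. Y t (X t \<omega>)\<bar> > \<delta>}
   \<le> 2 * exp (v * \<theta> * T - k * v * \<delta>) * sqrt (sum \<nu> (configs V) / \<nu> \<eta>0)"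
  by (rule G.time_integral_tail_bound[OF mc pos(1) \<nu>_pos Y cont kv form])
 also have "... \<le> 2 * exp (v * \<theta> * T - k * v * \<delta>) * (1 / \<beta>) ^ card V"
 proof (intro mult_left_mono)
  have "\<nu> \<eta>0 \<le> sum \<nu> (configs V)"
   using \<nu>_pos finite_configs[OF finite_V] by (intro member_le_sum \<eta>0) (auto intro: less_imp_le)
  then have 1: "1 \<le> 1 / \<nu> \<eta>0" using \<nu>_pos[of \<eta>0] by (simp add: sum_\<nu>)
  \<comment> \<open>Dropping the root is harmless: it merely enlarges the constant in front of
    \<open>card V\<close>.\<close>
  have sqrt_le: "sqrt x \<le> x" if "1 \<le> x" for x :: real
   using that mult_left_mono[of 1 x x] by (intro real_le_lsqrt) (auto simp: power2_eq_square)
  have "sqrt (1 / \<nu> \<eta>0) \<le> 1 / \<nu> \<eta>0" by (rule sqrt_le[OF 1])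
  also have "... \<le> 1 / \<beta> ^ card V" using \<beta> \<nu>_pos[of \<eta>0] by (intro divide_left_mono \<nu>_ge) auto
  finally show "sqrt (sum \<nu> (configs V) / \<nu> \<eta>0) \<le> (1 / \<beta>) ^ card V" by (simp add: sum_\<nu> power_one_over)
 qed simp
 also have "... = exp (ln 2 + real (card V) * ln (1 / \<beta>) + (v * \<theta> * T - k * v * \<delta>))"
 proof -
  have "exp (real (card V) * ln (1 / \<beta>)) = (1 / \<beta>) ^ card V"
   using \<beta> by (simp add: exp_of_nat_mult)
  then show ?thesis by (simp only: exp_add exp_ln zero_less_numeral mult_ac)
 qed
 finally have "ereal (1 / v) * elog (measure M {\<omega> \<in> space M. \<bar>LBINT t:{0..T}. Y t (X t \<omega>)\<bar> > \<delta>})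
   \<le> ereal ((ln 2 + real (card V) * ln (1 / \<beta>) + (v * \<theta> * T - k * v * \<delta>)) / v)"
  by (rule elog_le[OF _ pos(3)])
 also have "(ln 2 + real (card V) * ln (1 / \<beta>) + (v * \<theta> * T - k * v * \<delta>)) / v
   = ln 2 / v + real (card V) / v * ln (1 / \<beta>) + T * \<theta> - k * \<delta>"
  using pos(3) by (simp add: add_divide_distrib diff_divide_distrib)
 finally show ?thesis .
qed

lemma bulk_log_bound:
 assumes mc: "markov_chain_from M (configs V) (\<lambda>f \<eta>. \<tau> * gen f \<eta>) \<eta>0 X"
  and pos: "0 < T" "0 < \<tau>" "0 < v" "0 < k" "0 < m"
  and B: "B \<subseteq> V"
  and R: "\<And>y z. y \<in> B \<Longrightarrow> z \<in> B \<Longrightarrow> ereal m \<le> ereal (\<tau> / v) * inverse (R_eff V c y z)"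
  and A: "finite A" "A \<subseteq> B" "card A \<le> K" "depends_only_on A f" and F: "\<And>\<eta>. \<bar>f \<eta>\<bar> \<le> F"
 shows "ereal (1 / v) * elog (measure M {\<omega> \<in> space M.
      \<bar>LBINT t:{0..T}. f (X t \<omega>) - bernoulli_mean f (Av B (X t \<omega>))\<bar> > \<delta>})
   \<le> ereal (ln 2 / v + real (card V) / v * ln (1 / \<beta>)
     + T * (5 / \<beta> ^ 4 * (\<tau> / v * energy V c \<rho>) + k * (2 ^ K * (2 * F)) * (real K / real (card B))
      + 4 * (k * (2 ^ K * (2 * F)))^2 / m) - k * \<delta>)"
proof -
 let ?Y = "\<lambda>(t :: real) \<eta>. f \<eta> - bernoulli_mean f (Av B \<eta>)"
 have bdd: "\<bar>?Y t \<eta>\<bar> \<le> (\<Sum>\<xi>\<in>configs V. \<bar>?Y t \<xi>\<bar>)" if "\<eta> \<in> configs V" for t \<eta>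
  by (rule member_le_sum[OF that]) (auto intro: finite_configs finite_V)
 show ?thesis
  by (rule tail_log_bound[OF mc pos(1-4), where Y = ?Y, OF bdd _ bulk_form_bound[OF B pos(2,3,5,4) _ R A F]])
   auto
qed

lemma boundary_log_bound:
 assumes mc: "markov_chain_from M (configs V) (\<lambda>f \<eta>. \<tau> * gen f \<eta>) \<eta>0 X"
  and pos: "0 < T" "0 < \<tau>" "0 < v" "0 < k" "0 < G0"
  and a: "a \<in> bd" and m: "0 < m" "m \<le> lamP a" "m \<le> lamM a"
  and G: "continuous_on {0..T} G" "\<And>t. t \<in> {0..T} \<Longrightarrow> \<bar>G t\<bar> \<le> G0"
 shows "ereal (1 / v) * elog (measure M {\<omega> \<in> space M.
      \<bar>LBINT t:{0..T}. G t * (of_bool (X t \<omega> a) - lamP a / (lamP a + lamM a))\<bar> > \<delta>})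
   \<le> ereal (ln 2 / v + real (card V) / v * ln (1 / \<beta>)
     + T * (\<tau> / v * energy V c \<rho> / (2 * \<beta>^2) + k * G0 * (\<bar>flow V c \<rho> a\<bar> / m)
      + (k * G0)^2 / (2 * (\<tau> / v * m) * \<beta>)) - k * \<delta>)"
proof -
 let ?\<alpha> = "lamP a / (lamP a + lamM a)"
 let ?Y = "\<lambda>t \<eta>. G t * (of_bool (\<eta> a) - lamP a / (lamP a + lamM a))"
 have \<alpha>: "0 \<le> ?\<alpha>" "?\<alpha> \<le> 1" using m by auto
 have bdd: "\<bar>?Y t \<eta>\<bar> \<le> G0" if t: "0 \<le> t" "t \<le> T" for t \<eta>
 proof -
  have "\<bar>of_bool (\<eta> a) - ?\<alpha>\<bar> \<le> 1" using \<alpha> by (auto simp: of_bool_def abs_le_iff)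
  then have "\<bar>G t\<bar> * \<bar>of_bool (\<eta> a) - ?\<alpha>\<bar> \<le> G0 * 1"
   using G(2)[of t] t by (intro mult_mono) auto
  then show ?thesis by (simp add: abs_mult)
 qed
 let ?\<theta> = "\<tau> / v * energy V c \<rho> / (2 * \<beta>^2) + k * G0 * (\<bar>flow V c \<rho> a\<bar> / m)
   + (k * G0)^2 / (2 * (\<tau> / v * m) * \<beta>)"
 have form: "(\<Sum>\<eta>\<in>configs V. \<nu> \<eta> * (g \<eta> * (\<tau> * gen g \<eta> + s * (k * v) * ?Y t \<eta> * g \<eta>)))
   \<le> v * ?\<theta> * normsq g"
  if t: "0 \<le> t" "t \<le> T" and s: "s \<in> {1, -1}" for t g s
 proof -
  have q: "\<bar>s * (k * v) * G t\<bar> \<le> k * v * G0"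
   using s pos G(2)[of t] t by (auto simp: abs_mult)
  have th: "\<tau> * energy V c \<rho> / (2 * \<beta>^2) + k * v * G0 * (\<bar>flow V c \<rho> a\<bar> / m)
     + (k * v * G0)^2 / (2 * \<tau> * m * \<beta>) = v * ?\<theta>"
   using pos(3) by (simp add: distrib_left power2_eq_square mult_ac)
  have "(\<Sum>\<eta>\<in>configs V. \<nu> \<eta> * (g \<eta> * (\<tau> * gen g \<eta>
    + s * (k * v) * G t * (of_bool (\<eta> a) - ?\<alpha>) * g \<eta>)))
   \<le> (\<tau> * energy V c \<rho> / (2 * \<beta>^2) + k * v * G0 * (\<bar>flow V c \<rho> a\<bar> / m)
     + (k * v * G0)^2 / (2 * \<tau> * m * \<beta>)) * normsq g"
   by (rule boundary_form_bound[OF a pos(2) m q]) (use pos in simp)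
  then show ?thesis unfolding th by (simp only: mult.assoc)
 qed
 show ?thesis
 proof (rule tail_log_bound[OF mc pos(1-4), where Y = ?Y and w = G0 and \<theta> = ?\<theta>])
  show "\<bar>?Y t \<eta>\<bar> \<le> G0" if "0 \<le> t" "t \<le> T" for t \<eta> by (rule bdd[OF that])
  show "continuous_on {0..T} (\<lambda>t. ?Y t \<eta>)" for \<eta> by (intro continuous_intros G)
 qed (rule form)
qed

end

section \<open>Choice of constants and passage to the limit\<close>

lemma eventually_le_of_limsup:
 assumes "limsup (\<lambda>N. ereal (f N)) < \<infinity>"
 obtains C where "0 \<le> C" "\<forall>\<^sub>F N in sequentially. f N \<le> C"
proof -
 obtain n :: nat where "limsup (\<lambda>N. ereal (f N)) < ereal (real n)"
  using assms less_PInf_Ex_of_nat by auto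
 then have "\<forall>\<^sub>F N in sequentially. ereal (f N) < ereal (real n)" by (rule Limsup_lessD)
 then have "\<forall>\<^sub>F N in sequentially. f N \<le> real n" by (rule eventually_mono) simp
 then show ?thesis using that[of "real n"] by simp
qed

lemma exists_large:
 fixes a b d :: real
 assumes "0 < d"
 obtains k where "0 < k" "a - k * d \<le> b"
proof
 let ?k = "max 1 ((a - b) / d)"
 show "0 < ?k" by simp
 have "a - b = (a - b) / d * d" using assms by simp
 also have "... \<le> ?k * d" using assms by (intro mult_right_mono) auto
 finally show "a - ?k * d \<le> b" by simp
qed

text \<open>In \<open>cond2\<close> the infimum over sites stands inside the lower limits, matching
  the supremum over indices in the conclusion. The suprema run over indices whose function reads
  only sites of \<open>V N\<close>, because an extensional configuration carries no information
  elsewhere.\<close>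

theorem theorem4:
  fixes c :: "'v \<Rightarrow> 'v \<Rightarrow> real"
    and orig :: 'v
    and r :: "nat \<Rightarrow> real"
    and V bd :: "nat \<Rightarrow> 'v set"
    and \<V> \<T> :: "nat \<Rightarrow> real"
    and lamP lamM :: "nat \<Rightarrow> 'v \<Rightarrow> real"
    and L :: "nat \<Rightarrow> ('v config \<Rightarrow> real) \<Rightarrow> 'v config \<Rightarrow> real"
    and \<mu> :: "nat \<Rightarrow> 'v config pmf"
    and \<rho> :: "nat \<Rightarrow> 'v \<Rightarrow> real"
    and \<eta>0 :: "nat \<Rightarrow> 'v config"
    and M :: "nat \<Rightarrow> 'w measure"
    and X :: "nat \<Rightarrow> real \<Rightarrow> 'w \<Rightarrow> 'v config"
  assumes graph: "weighted_graph c"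
    and r: "r 1 = 1" "mono_on {1..} r" "filterlim r at_top sequentially"
    and V: "\<And>N. V N = gball c orig (r N)"
    and \<V>: "\<And>N. N \<ge> 1 \<Longrightarrow> 0 < \<V> N" "mono_on {1..} \<V>"
    and \<T>: "\<And>N. N \<ge> 1 \<Longrightarrow> 0 < \<T> N" "mono_on {1..} \<T>"
    and boundary: "\<And>N. N \<ge> 1 \<Longrightarrow> bd N \<noteq> {}" "\<And>N. N \<ge> 1 \<Longrightarrow> bd N \<subseteq> V N"
      "\<And>N a a'. N \<ge> 1 \<Longrightarrow> a \<in> bd N \<Longrightarrow> a' \<in> bd N \<Longrightarrow> c a a' = 0"
    and rates: "\<And>N a. N \<ge> 1 \<Longrightarrow> a \<in> bd N \<Longrightarrow> 0 \<le> lamP N a \<and> 0 \<le> lamM N a"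
    and L: "\<And>N. L N = L_bEX (V N) c (bd N) (lamP N) (lamM N)"
    and inv: "\<And>N. N \<ge> 1 \<Longrightarrow> invariant_measure (configs (V N)) (L N) (\<mu> N)"
    and \<rho>: "\<And>N. \<rho> N = density (\<mu> N)"
    and process: "\<And>N. N \<ge> 1 \<Longrightarrow>
      markov_chain_from (M N) (configs (V N)) (\<lambda>f \<eta>. \<T> N * L N f \<eta>) (\<eta>0 N) (X N)"
    and E: "limsup (\<lambda>N. ereal (real (card (V N)) / \<V> N)) < \<infinity>"
    and BR: "\<exists>\<gamma>\<ge>1. \<exists>\<gamma>'\<ge>1. \<forall>N\<ge>1. \<forall>a\<in>bd N.
        1 / \<gamma> \<le> lamP N a / lamM N a \<and> lamP N a / lamM N a \<le> \<gamma> \<and>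
        (site_conductance (V N) c a \<noteq> 0 \<longrightarrow>
           1 / \<gamma>' \<le> lamP N a / site_conductance (V N) c a \<and>
           lamP N a / site_conductance (V N) c a \<le> \<gamma>')"
    and cond1: "liminf (\<lambda>N. ereal (\<T> N / \<V> N)) = \<infinity>"
    and cond2: "Liminf (at_right 0) (\<lambda>\<epsilon>. liminf (\<lambda>N.
        INF x\<in>V N.
        INF y\<in>gball c x (r (nat \<lfloor>\<epsilon> * real N\<rfloor>)) \<inter> V N.
        INF z\<in>gball c x (r (nat \<lfloor>\<epsilon> * real N\<rfloor>)) \<inter> V N.
          ereal (\<T> N / \<V> N) * inverse (R_eff (V N) c y z))) = \<infinity>"
    and cond3: "limsup (\<lambda>N. ereal (\<T> N / \<V> N * (\<Sum>a\<in>bd N. \<bar>flow (V N) c (\<rho> N) a\<bar>))) < \<infinity>"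
      "limsup (\<lambda>N. ereal (\<T> N / \<V> N * energy (V N) c (\<rho> N))) < \<infinity>"
  shows "(\<forall>\<phi> T \<delta>. vertex_bundle c \<phi> \<and> uniform_bundle UNIV \<phi> \<and> 0 < T \<and> 0 < \<delta> \<longrightarrow>
      Limsup (at_right 0) (\<lambda>\<epsilon>. limsup (\<lambda>N.
        SUP x\<in>{x \<in> V N. depends_only_on (V N) (\<phi> x)}.
          ereal (1 / \<V> N) * elog (measure (M N) {\<omega> \<in> space (M N).
            \<bar>LBINT t:{0..T}. U_fun (V N) c (r (nat \<lfloor>\<epsilon> * real N\<rfloor>)) x (\<phi> x) (X N t \<omega>)\<bar> > \<delta>}))) = -\<infinity>)
    \<and> (\<forall>\<phi> T \<delta>. edge_bundle c \<phi> \<and> uniform_bundle (directed_edges c UNIV) \<phi> \<and> 0 < T \<and> 0 < \<delta> \<longrightarrow>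
      Limsup (at_right 0) (\<lambda>\<epsilon>. limsup (\<lambda>N.
        SUP e\<in>{e \<in> directed_edges c (V N). depends_only_on (V N) (\<phi> e)}.
          ereal (1 / \<V> N) * elog (measure (M N) {\<omega> \<in> space (M N).
            \<bar>LBINT t:{0..T}. U_fun (V N) c (r (nat \<lfloor>\<epsilon> * real N\<rfloor>)) (fst e) (\<phi> e) (X N t \<omega>)\<bar> > \<delta>}))) = -\<infinity>)
    \<and> (\<forall>T \<delta> (G :: real \<Rightarrow> real). 0 < T \<and> 0 < \<delta> \<and> continuous_on {0..T} G \<longrightarrow>
      limsup (\<lambda>N. SUP a\<in>bd N.
          ereal (1 / \<V> N) * elog (measure (M N) {\<omega> \<in> space (M N).
            \<bar>LBINT t:{0..T}. G t * (of_bool (X N t \<omega> a) - lamP N a / (lamP N a + lamM N a))\<bar> > \<delta>})) = -\<infinity>)"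
proof -
 interpret weighted_graph c by (rule graph)
 obtain \<gamma> \<gamma>' where \<gamma>: "1 \<le> \<gamma>" "1 \<le> \<gamma>'" and BR':
  "\<And>N a. N \<ge> 1 \<Longrightarrow> a \<in> bd N \<Longrightarrow> 1 / \<gamma> \<le> lamP N a / lamM N a \<and> lamP N a / lamM N a \<le> \<gamma> \<and>
    (site_conductance (V N) c a \<noteq> 0 \<longrightarrow>
      1 / \<gamma>' \<le> lamP N a / site_conductance (V N) c a \<and>
      lamP N a / site_conductance (V N) c a \<le> \<gamma>')"
  using BR by blast
 \<comment> \<open>A ratio of the rates between \<open>1 / \<gamma>\<close> and \<gamma> keeps the
   reservoir densities between \<open>1 / (1 + \<gamma>)\<close> and its complement.\<close>
 define \<beta> where "\<beta> = 1 / (1 + \<gamma>)"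
 have \<beta>: "0 < \<beta>" using \<gamma> by (simp add: \<beta>_def)
 have \<beta>1: "\<beta> \<le> 1" using \<gamma> by (simp add: \<beta>_def)
 have lam: "0 < lamP N a" "0 < lamM N a" "lamP N a \<le> \<gamma> * lamM N a" "lamM N a \<le> \<gamma> * lamP N a"
  if "N \<ge> 1" "a \<in> bd N" for N a
 proof -
  note b = BR'[OF that] and rt = rates[OF that]
  have g: "0 < 1 / \<gamma>" using \<gamma> by simp
  then have q: "0 < lamP N a / lamM N a" using b by linarith
  then have "lamP N a \<noteq> 0" "lamM N a \<noteq> 0" by auto
  then show p: "0 < lamP N a" "0 < lamM N a" using rt by auto
  show "lamP N a \<le> \<gamma> * lamM N a" "lamM N a \<le> \<gamma> * lamP N a"
   using b p \<gamma> by (auto simp: field_simps)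
 qed
 have finV: "finite (V N)" for N unfolding V by (rule finite_gball)
 have V1: "\<V> 1 \<le> \<V> N" if "N \<ge> 1" for N using \<V>(2) that by (auto simp: mono_on_def)
 have DE: "driven_exclusion (V N) c (bd N) (lamP N) (lamM N) (\<rho> N) \<beta>" if N: "N \<ge> 1" for N
 proof -
  have st: "flow (V N) c (\<rho> N) x + (if x \<in> bd N then lamP N x - (lamP N x + lamM N x) * \<rho> N x else 0) = 0"
   if "x \<in> V N" for x
   unfolding \<rho>
   by (rule invariant_density_stationary[OF finV boundary(2)[OF N] sym inv[OF N, unfolded L] that])
  \<comment> \<open>Stationarity turns a nonpositive flow at a boundary site into the bound by the
    reservoir density. The lower bound is the same argument for the negated profile.\<close>
  have hi: "\<rho> N x \<le> 1 - \<beta>" if x: "x \<in> V N" for x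
  proof (rule maximum_principle[OF boundary(1)[OF N] boundary(2)[OF N, unfolded V] _ _ x[unfolded V]])
   show "flow (gball c orig (r N)) c (\<rho> N) x = 0" if "x \<in> gball c orig (r N) - bd N" for x
    using st[of x] that by (simp add: V)
   show "\<rho> N a \<le> 1 - \<beta>" if a: "a \<in> bd N" and fl: "flow (gball c orig (r N)) c (\<rho> N) a \<le> 0" for a
   proof -
    note l = lam[OF N a]
    have "lamP N a - (lamP N a + lamM N a) * \<rho> N a \<ge> 0"
     using st[of a] boundary(2)[OF N] a fl by (auto simp: V)
    then have "\<rho> N a \<le> lamP N a / (lamP N a + lamM N a)" using l by (simp add: field_simps)
    also have "... \<le> 1 - \<beta>" using l \<gamma> unfolding \<beta>_def by (simp add: field_simps)
    finally show ?thesis .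
   qed
  qed
  have neg: "flow A c (\<lambda>x. - \<rho> N x) x = - flow A c (\<rho> N) x" for A x
   by (simp add: flow_def sum_negf[symmetric] algebra_simps)
  have lo: "- \<rho> N x \<le> - \<beta>" if x: "x \<in> V N" for x
  proof (rule maximum_principle[OF boundary(1)[OF N] boundary(2)[OF N, unfolded V] _ _ x[unfolded V]])
   show "flow (gball c orig (r N)) c (\<lambda>x. - \<rho> N x) x = 0" if "x \<in> gball c orig (r N) - bd N" for x
    using st[of x] that by (simp add: V neg)
   show "- \<rho> N a \<le> - \<beta>" if a: "a \<in> bd N" and fl: "flow (gball c orig (r N)) c (\<lambda>x. - \<rho> N x) a \<le> 0" for a
   proof -
    note l = lam[OF N a]
    have "lamP N a - (lamP N a + lamM N a) * \<rho> N a \<le> 0"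
     using st[of a] boundary(2)[OF N] a fl by (auto simp: V neg)
    then have "lamP N a / (lamP N a + lamM N a) \<le> \<rho> N a" using l by (simp add: field_simps)
    moreover have "\<beta> \<le> lamP N a / (lamP N a + lamM N a)" using l \<gamma> unfolding \<beta>_def by (simp add: field_simps)
    ultimately show ?thesis by simp
   qed
  qed
  show ?thesis
  proof
   show "flow (V N) c (\<rho> N) x = 0" if "x \<in> V N - bd N" for x using st[of x] that by simp
   show "flow (V N) c (\<rho> N) a = (lamP N a + lamM N a) * \<rho> N a - lamP N a" if "a \<in> bd N" for a
    using st[of a] that boundary(2)[OF N] by auto
   show "\<beta> \<le> \<rho> N x" if "x \<in> V N" for x using lo[OF that] by simp
   show "\<beta> \<le> 1 - \<rho> N x" if "x \<in> V N" for x using hi[OF that] by simp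
  qed (use finV sym nonneg boundary(2)[OF N] rates[OF N] \<beta> in auto)
 qed
 obtain C1 where C1: "0 \<le> C1" "\<forall>\<^sub>F N in sequentially. real (card (V N)) / \<V> N \<le> C1"
  using E by (rule eventually_le_of_limsup)
 obtain C2 where C2: "0 \<le> C2" "\<forall>\<^sub>F N in sequentially. \<T> N / \<V> N * energy (V N) c (\<rho> N) \<le> C2"
  using cond3(2) by (rule eventually_le_of_limsup)
 obtain C3 where C3: "0 \<le> C3" "\<forall>\<^sub>F N in sequentially. \<T> N / \<V> N * (\<Sum>a\<in>bd N. \<bar>flow (V N) c (\<rho> N) a\<bar>) \<le> C3"
  using cond3(1) by (rule eventually_le_of_limsup)
 \<comment> \<open>Bounds the terms untouched by k: the factor 2 from the two signs and the start
   cost.\<close>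
 define c0 where "c0 = ln 2 / \<V> 1 + C1 * ln (1 / \<beta>)"
 have c0: "\<forall>\<^sub>F N in sequentially. ln 2 / \<V> N + real (card (V N)) / \<V> N * ln (1 / \<beta>) \<le> c0"
  using C1(2) eventually_ge_at_top[of 1]
 proof eventually_elim
  case (elim N)
  have "ln 2 / \<V> N \<le> ln 2 / \<V> 1" using V1[OF elim(2)] \<V>(1)[of 1] \<V>(1)[OF elim(2)] by (intro divide_left_mono) auto
  moreover have "real (card (V N)) / \<V> N * ln (1 / \<beta>) \<le> C1 * ln (1 / \<beta>)"
   using elim(1) \<beta> \<beta>1 by (intro mult_right_mono) auto
  ultimately show ?case unfolding c0_def by linarith
 qed
 define B where "B \<epsilon> N x = gball c x (r (nat \<lfloor>\<epsilon> * real N\<rfloor>)) \<inter> V N" for \<epsilon> :: real and N x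
 have res: "\<forall>\<^sub>F \<epsilon> in at_right 0. \<forall>\<^sub>F N in sequentially. \<forall>x\<in>V N. \<forall>y\<in>B \<epsilon> N x. \<forall>z\<in>B \<epsilon> N x.
   ereal m \<le> ereal (\<T> N / \<V> N) * inverse (R_eff (V N) c y z)" for m :: real
 proof -
  have "\<forall>\<^sub>F \<epsilon> in at_right 0. ereal m < liminf (\<lambda>N. INF x\<in>V N. INF y\<in>B \<epsilon> N x. INF z\<in>B \<epsilon> N x.
     ereal (\<T> N / \<V> N) * inverse (R_eff (V N) c y z))"
   by (rule less_LiminfD) (use cond2 in \<open>simp add: B_def\<close>)
  then show ?thesis
  proof eventually_elim
   case (elim \<epsilon>)
   show ?case
   proof (rule eventually_mono[OF less_LiminfD[OF elim]], intro ballI)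
    fix N x y z
    assume inf: "ereal m < (INF x\<in>V N. INF y\<in>B \<epsilon> N x. INF z\<in>B \<epsilon> N x.
      ereal (\<T> N / \<V> N) * inverse (R_eff (V N) c y z))"
     and xyz: "x \<in> V N" "y \<in> B \<epsilon> N x" "z \<in> B \<epsilon> N x"
    show "ereal m \<le> ereal (\<T> N / \<V> N) * inverse (R_eff (V N) c y z)"
     by (rule less_imp_le[OF less_INF_D[OF less_INF_D[OF less_INF_D[OF inf xyz(1)] xyz(2)] xyz(3)]])
   qed
  qed
 qed
 have eps: "\<forall>\<^sub>F \<epsilon> in at_right 0. (0 :: real) < \<epsilon> \<and> \<epsilon> < 1"
  by (rule eventually_mono[OF eventually_at_right_real[of 0 1]]) auto
 have floor_top: "filterlim (\<lambda>N. nat \<lfloor>\<epsilon> * real N\<rfloor>) at_top sequentially" if "0 < \<epsilon>" for \<epsilon> :: real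
  unfolding filterlim_at_top
 proof
  fix Z :: nat
  show "\<forall>\<^sub>F N in sequentially. Z \<le> nat \<lfloor>\<epsilon> * real N\<rfloor>"
   using eventually_ge_at_top[of "nat \<lceil>real Z / \<epsilon>\<rceil>"]
  proof eventually_elim
   case (elim N)
   then have "real Z / \<epsilon> \<le> real N" by linarith
   then have "real Z \<le> \<epsilon> * real N" using that by (simp add: field_simps)
   then show ?case by (simp add: le_nat_iff le_floor_iff)
  qed
 qed
 have radius: "\<forall>\<^sub>F N in sequentially. a \<le> r (nat \<lfloor>\<epsilon> * real N\<rfloor>) \<and> r (nat \<lfloor>\<epsilon> * real N\<rfloor>) \<le> r N"
  if \<epsilon>: "0 < \<epsilon>" "\<epsilon> < 1" for \<epsilon> a :: real
 proof -
  have "\<forall>\<^sub>F N in sequentially. a \<le> r (nat \<lfloor>\<epsilon> * real N\<rfloor>)"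
   using filterlim_compose[OF r(3) floor_top[OF \<epsilon>(1)]] by (simp add: filterlim_at_top)
  moreover have "\<forall>\<^sub>F N in sequentially. 1 \<le> nat \<lfloor>\<epsilon> * real N\<rfloor>"
   using floor_top[OF \<epsilon>(1)] by (simp add: filterlim_at_top)
  ultimately show ?thesis
  proof eventually_elim
   case (elim N)
   have "\<epsilon> * real N \<le> real N" using \<epsilon> by (simp add: mult_left_le_one_le)
   then have "nat \<lfloor>\<epsilon> * real N\<rfloor> \<le> N" by linarith
   then show ?case using elim r(2) by (auto simp: mono_on_def)
  qed
 qed
 \<comment> \<open>What vertex and edge bundles have in common: a base point, a local function and
   the uniform constants. Both claims are proved through it.\<close>
 define local_at where "local_at K r0 N x f \<longleftrightarrow> (\<forall>\<eta>. \<bar>f \<eta>\<bar> \<le> real K) \<and>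
   (\<exists>A. finite A \<and> card A \<le> K \<and> depends_only_on A f) \<and>
   depends_only_on (gball c x r0) f \<and> depends_only_on (V N) f" for K :: nat and r0 N x and f :: "'v config \<Rightarrow> real"
 define tail where "tail T \<delta> \<epsilon> N x f = ereal (1 / \<V> N) * elog (measure (M N) {\<omega> \<in> space (M N).
   \<bar>LBINT t:{0..T}. U_fun (V N) c (r (nat \<lfloor>\<epsilon> * real N\<rfloor>)) x f (X N t \<omega>)\<bar> > \<delta>})" for T \<delta> \<epsilon> N x f
 \<comment> \<open>Order of choices: Q determines k, then k determines the level m and the ball size
   n, then \<epsilon> is small for this m, and N is large.\<close>
 have bulk: "\<forall>\<^sub>F \<epsilon> in at_right 0. \<forall>\<^sub>F N in sequentially. \<forall>x\<in>V N. \<forall>f.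
   local_at K r0 N x f \<longrightarrow> tail T \<delta> \<epsilon> N x f \<le> ereal Q"
  if T: "0 < T" and \<delta>: "0 < \<delta>" for K r0 T \<delta> Q
 proof -
  define A0 where "A0 = c0 + T * (5 / \<beta> ^ 4 * C2 + 1 + 1)"
  obtain k where k: "0 < k" "A0 - k * \<delta> \<le> Q" using exists_large[OF \<delta>] by blast
  define C where "C = 2 ^ K * (2 * real K)"
  have C: "0 \<le> C" by (simp add: C_def)
  \<comment> \<open>Chosen, like n below, so that an error growing with k is at most 1; these are
    the two summands 1 in \<open>A0\<close>.\<close>
  define m where "m = 4 * (k * C)^2 + 1"
  have m: "0 < m" by (simp add: m_def add_nonneg_pos)
  have km: "4 * (k * C)^2 / m \<le> 1" using m by (simp add: m_def)
  obtain n :: nat where n: "k * C * real K + 1 \<le> real n" using real_arch_simple by blast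
  have npos: "0 < real n" using n k(1) C by (smt (verit) mult_nonneg_nonneg of_nat_0_le_iff)
  show ?thesis using res[of m] eps
  proof eventually_elim
   case (elim \<epsilon>)
   have \<epsilon>: "0 < \<epsilon>" "\<epsilon> < 1" using elim(2) by auto
   show ?case
    using elim(1) radius[OF \<epsilon>, of "max r0 (2 * real n)"] c0 C2(2) eventually_ge_at_top[of 1]
   proof eventually_elim
    case (elim N)
    note N = elim(5)
    interpret D: driven_exclusion "V N" c "bd N" "lamP N" "lamM N" "\<rho> N" \<beta> by (rule DE[OF N])
    show ?case
    proof (intro ballI allI impI)
     fix x f assume x: "x \<in> V N" and f: "local_at K r0 N x f"
     let ?R = "r (nat \<lfloor>\<epsilon> * real N\<rfloor>)" and ?B = "B \<epsilon> N x"
     obtain A where A: "finite A" "card A \<le> K" "depends_only_on A f" using f by (auto simp: local_at_def)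
     define A' where "A' = A \<inter> (gball c x r0 \<inter> V N)"
     have A': "finite A'" "card A' \<le> K" "depends_only_on A' f"
      using A f card_mono[of A A'] by (auto simp: local_at_def A'_def intro!: depends_only_on_Int)
     have sub: "A' \<subseteq> ?B" using elim(2) by (auto simp: A'_def B_def gball_def)
     have nB: "n \<le> card ?B"
      unfolding B_def V using x elim(2) by (intro card_gball_Int_ge) (auto simp: V)
     have BV: "?B \<subseteq> V N" by (simp add: B_def)
     have Rm: "ereal m \<le> ereal (\<T> N / \<V> N) * inverse (R_eff (V N) c y z)"
      if "y \<in> ?B" "z \<in> ?B" for y z using elim(1) x that by blast
     have "ereal (1 / \<V> N) * elog (measure (M N) {\<omega> \<in> space (M N).
       \<bar>LBINT t:{0..T}. f (X N t \<omega>) - bernoulli_mean f (Av ?B (X N t \<omega>))\<bar> > \<delta>})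
      \<le> ereal (ln 2 / \<V> N + real (card (V N)) / \<V> N * ln (1 / \<beta>)
       + T * (5 / \<beta> ^ 4 * (\<T> N / \<V> N * energy (V N) c (\<rho> N)) + k * (2 ^ K * (2 * real K)) * (real K / real (card ?B))
        + 4 * (k * (2 ^ K * (2 * real K)))^2 / m) - k * \<delta>)"
      by (rule D.bulk_log_bound[OF process[OF N, unfolded L] T \<T>(1)[OF N] \<V>(1)[OF N] k(1) m BV Rm A'(1) sub A'(2,3)])
       (use f in \<open>auto simp: local_at_def\<close>)
     also have "... \<le> ereal (c0 + T * (5 / \<beta> ^ 4 * C2 + 1 + 1) - k * \<delta>)"
     proof -
      have "k * C * (real K / real (card ?B)) \<le> k * C * (real K / real n)"
       using nB npos k C by (intro mult_left_mono divide_left_mono mult_pos_pos) auto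
      also have "... \<le> 1" using n npos by (simp add: divide_le_eq)
      finally have "5 / \<beta> ^ 4 * (\<T> N / \<V> N * energy (V N) c (\<rho> N)) + k * C * (real K / real (card ?B))
        + 4 * (k * C)^2 / m \<le> 5 / \<beta> ^ 4 * C2 + 1 + 1"
       using elim(4) \<beta> km by (intro add_mono mult_left_mono) auto
      then have "T * (5 / \<beta> ^ 4 * (\<T> N / \<V> N * energy (V N) c (\<rho> N)) + k * C * (real K / real (card ?B))
        + 4 * (k * C)^2 / m) \<le> T * (5 / \<beta> ^ 4 * C2 + 1 + 1)"
       using T by (intro mult_left_mono) auto
      then show ?thesis using elim(3) by (simp add: C_def[symmetric])
     qed
     also have "... \<le> ereal Q" using k(2) by (simp add: A0_def)
     finally show "tail T \<delta> \<epsilon> N x f \<le> ereal Q"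
      unfolding tail_def U_fun_def B_def .
    qed
   qed
  qed
 qed
 \<comment> \<open>The resistance condition for a site and one of its neighbours, combined with the
   indicator of the site as test function.\<close>
 have conductance: "\<forall>\<^sub>F N in sequentially. \<forall>a\<in>V N. m \<le> \<T> N / \<V> N * site_conductance (V N) c a" for m
 proof -
  have "\<forall>\<^sub>F \<epsilon> in at_right (0 :: real). \<forall>\<^sub>F N in sequentially. \<forall>a\<in>V N. m \<le> \<T> N / \<V> N * site_conductance (V N) c a"
   using res[of m] eps
  proof eventually_elim
   case (elim \<epsilon>)
   have \<epsilon>: "0 < \<epsilon>" "\<epsilon> < 1" using elim(2) by auto
   show ?case using elim(1) radius[OF \<epsilon>, of 2] eventually_ge_at_top[of 1]
   proof eventually_elim
    case (elim N)
    note N = elim(3)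
    show ?case
    proof
     fix a assume a: "a \<in> V N"
     obtain w where w: "w \<in> V N" "0 < c a w"
      using neighbour_in_gball[of "r N" a orig] a elim(2) unfolding V by force
     have "gdist c a w \<le> 1" by (rule gdist_le) (use w in auto)
     then have "w \<in> B \<epsilon> N a" "a \<in> B \<epsilon> N a" using w a elim(2) by (auto simp: B_def gball_def)
     then have "ereal m \<le> ereal (\<T> N / \<V> N) * inverse (R_eff (V N) c a w)" using elim(1) a by blast
     also have "... \<le> ereal (\<T> N / \<V> N) * ereal (site_conductance (V N) c a)"
     proof (rule ereal_mult_left_mono[OF inverse_R_eff_le_site_conductance[OF finV a]])
      show "w \<noteq> a" using w no_loops by auto
      show "0 \<le> ereal (\<T> N / \<V> N)" using \<T>(1)[OF N] \<V>(1)[OF N] by simp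
     qed
     finally show "m \<le> \<T> N / \<V> N * site_conductance (V N) c a" by simp
    qed
   qed
  qed
  \<comment> \<open>The statement about N does not mention \<epsilon>, so one admissible \<epsilon>
    suffices.\<close>
  from eventually_happens'[OF trivial_limit_at_right_real this] show ?thesis by (rule exE)
 qed
 define btail where "btail T \<delta> G N a = ereal (1 / \<V> N) * elog (measure (M N) {\<omega> \<in> space (M N).
   \<bar>LBINT t:{0..T}. G t * (of_bool (X N t \<omega> a) - lamP N a / (lamP N a + lamM N a))\<bar> > \<delta>})" for T \<delta> G N a
 have bdry: "\<forall>\<^sub>F N in sequentially. \<forall>a\<in>bd N. btail T \<delta> G N a \<le> ereal Q"
  if T: "0 < T" and \<delta>: "0 < \<delta>" and G: "continuous_on {0..T} G" for T \<delta> Q and G :: "real \<Rightarrow> real"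
 proof -
  have "bounded (G ` {0..T})" by (rule compact_imp_bounded[OF compact_continuous_image[OF G]]) simp
  then obtain G0 where G0: "0 < G0" "\<And>t. t \<in> {0..T} \<Longrightarrow> \<bar>G t\<bar> \<le> G0"
   by (auto simp: bounded_pos)
  define A0 where "A0 = c0 + T * (C2 / (2 * \<beta>^2) + 1 + 1)"
  obtain k where k: "0 < k" "A0 - k * \<delta> \<le> Q" using exists_large[OF \<delta>] by blast
  define m where "m = k * G0 * C3 + (k * G0)^2 / (2 * \<beta>) + 1"
  have m: "k * G0 * C3 \<le> m" "(k * G0)^2 / (2 * \<beta>) \<le> m" "0 < m"
   using k G0 C3 \<beta> by (auto simp: m_def add_nonneg_pos)
  show ?thesis
   using conductance[of "\<gamma> * \<gamma>' * m"] c0 C2(2) C3(2) eventually_ge_at_top[of 1]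
  proof eventually_elim
   case (elim N)
   note N = elim(5)
   interpret D: driven_exclusion "V N" c "bd N" "lamP N" "lamM N" "\<rho> N" \<beta> by (rule DE[OF N])
   show ?case
   proof
    fix a assume a: "a \<in> bd N"
    have aV: "a \<in> V N" using a boundary(2)[OF N] by auto
    define s where "s = \<T> N / \<V> N"
    define sc where "sc = site_conductance (V N) c a"
    \<comment> \<open>A common lower bound for both rates: \<open>lamP\<close> is at least
      \<open>sc / \<gamma>'\<close>, and \<open>lamM\<close> is at least
      \<open>lamP / \<gamma>\<close>. The threshold \<open>\<gamma> * \<gamma>' * m\<close> for the
      conductance makes \<open>s * l\<close> at least m.\<close>
    define l where "l = sc / (\<gamma> * \<gamma>')"
    have s: "0 < s" using \<T>(1)[OF N] \<V>(1)[OF N] by (simp add: s_def)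
    have gg: "0 < \<gamma> * \<gamma>'" using \<gamma> by simp
    have ssc: "\<gamma> * \<gamma>' * m \<le> s * sc" using elim(1) aV by (simp add: s_def sc_def)
    have sl: "m \<le> s * l" using ssc gg by (simp add: l_def field_simps)
    then have l: "0 < l" using m s by (smt (verit) zero_less_mult_pos)
    \<comment> \<open>Positivity activates the part of \<open>BR\<close> that is guarded by a
      nonzero conductance.\<close>
    then have sc: "0 < sc" using gg by (simp add: l_def zero_less_divide_iff)
    have lP: "sc / \<gamma>' \<le> lamP N a"
     using BR'[OF N a] sc \<gamma> unfolding sc_def by (auto simp: field_simps)
    have "l \<le> sc / \<gamma>'" using sc \<gamma> gg unfolding l_def by (intro divide_left_mono) (auto simp: mult_le_cancel_right1)
    then have l1: "l \<le> lamP N a" using lP by linarith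
    have "\<gamma> * l = sc / \<gamma>'" using \<gamma> by (simp add: l_def)
    then have "\<gamma> * l \<le> \<gamma> * lamM N a" using lP lam(3)[OF N a] by linarith
    then have l2: "l \<le> lamM N a" using \<gamma> by simp
    have fl: "s * \<bar>flow (V N) c (\<rho> N) a\<bar> \<le> C3"
    proof -
     have "\<bar>flow (V N) c (\<rho> N) a\<bar> \<le> (\<Sum>a\<in>bd N. \<bar>flow (V N) c (\<rho> N) a\<bar>)"
      using a finite_subset[OF boundary(2)[OF N] finV] by (intro member_le_sum) auto
     then have "s * \<bar>flow (V N) c (\<rho> N) a\<bar> \<le> s * (\<Sum>a\<in>bd N. \<bar>flow (V N) c (\<rho> N) a\<bar>)"
      using s by (intro mult_left_mono) auto
     then show ?thesis using elim(4) by (simp add: s_def)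
    qed
    have t1: "k * G0 * (\<bar>flow (V N) c (\<rho> N) a\<bar> / l) \<le> 1"
    proof -
     have "k * G0 * (\<bar>flow (V N) c (\<rho> N) a\<bar> / l) = k * G0 * (s * \<bar>flow (V N) c (\<rho> N) a\<bar>) / (s * l)"
      using s by simp
     also have "... \<le> k * G0 * C3 / (s * l)"
      using k G0 s l by (intro divide_right_mono mult_left_mono fl) auto
     also have "... \<le> 1" using m sl s l by (simp add: divide_le_eq)
     finally show ?thesis .
    qed
    have t2: "(k * G0)^2 / (2 * (s * l) * \<beta>) \<le> 1"
    proof -
     have "(k * G0)^2 / (2 * (s * l) * \<beta>) = (k * G0)^2 / (2 * \<beta>) / (s * l)" by simp
     also have "... \<le> 1" using m sl s l by (simp only: divide_le_eq_1_pos mult_pos_pos)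
     finally show ?thesis .
    qed
    have "btail T \<delta> G N a
     \<le> ereal (ln 2 / \<V> N + real (card (V N)) / \<V> N * ln (1 / \<beta>)
      + T * (\<T> N / \<V> N * energy (V N) c (\<rho> N) / (2 * \<beta>^2) + k * G0 * (\<bar>flow (V N) c (\<rho> N) a\<bar> / l)
       + (k * G0)^2 / (2 * (\<T> N / \<V> N * l) * \<beta>)) - k * \<delta>)"
     unfolding btail_def by (rule D.boundary_log_bound[OF process[OF N, unfolded L] T \<T>(1)[OF N] \<V>(1)[OF N] k(1) G0(1) a l l1 l2 G G0(2)])
    also have "... \<le> ereal (c0 + T * (C2 / (2 * \<beta>^2) + 1 + 1) - k * \<delta>)"
    proof -
     have "\<T> N / \<V> N * energy (V N) c (\<rho> N) / (2 * \<beta>^2) + k * G0 * (\<bar>flow (V N) c (\<rho> N) a\<bar> / l)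
       + (k * G0)^2 / (2 * (\<T> N / \<V> N * l) * \<beta>) \<le> C2 / (2 * \<beta>^2) + 1 + 1"
      using elim(3) \<beta> t1 t2 unfolding s_def by (intro add_mono divide_right_mono) auto
     then have "T * (\<T> N / \<V> N * energy (V N) c (\<rho> N) / (2 * \<beta>^2) + k * G0 * (\<bar>flow (V N) c (\<rho> N) a\<bar> / l)
       + (k * G0)^2 / (2 * (\<T> N / \<V> N * l) * \<beta>)) \<le> T * (C2 / (2 * \<beta>^2) + 1 + 1)"
      using T by (intro mult_left_mono) auto
     then show ?thesis using elim(2) by simp
    qed
    also have "... \<le> ereal Q" using k(2) by (simp add: A0_def)
    finally show "btail T \<delta> G N a \<le> ereal Q" .
   qed
  qed
 qed
 \<comment> \<open>The index set consists of pairs of base point and function, so one statement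
   covers vertices and edges. An upper limit below every real is minus infinity.\<close>
 have lim: "Limsup (at_right 0) (\<lambda>\<epsilon>. limsup (\<lambda>N. SUP q\<in>Q N. tail T \<delta> \<epsilon> N (fst q) (snd q))) = -\<infinity>"
  if "0 < T" "0 < \<delta>" and Q: "\<And>N q. q \<in> Q N \<Longrightarrow> fst q \<in> V N \<and> local_at K r0 N (fst q) (snd q)"
  for T \<delta> K r0 Q
 proof (rule ereal_bot, rule Limsup_bounded, rule eventually_mono[OF bulk[OF that(1,2), of K r0]])
  fix B \<epsilon> :: real
  assume *: "\<forall>\<^sub>F N in sequentially. \<forall>x\<in>V N. \<forall>f. local_at K r0 N x f \<longrightarrow> tail T \<delta> \<epsilon> N x f \<le> ereal B"
  show "limsup (\<lambda>N. SUP q\<in>Q N. tail T \<delta> \<epsilon> N (fst q) (snd q)) \<le> ereal B"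
   by (rule Limsup_bounded, rule eventually_mono[OF *], rule SUP_least) (simp add: Q)
 qed
 show ?thesis
  unfolding tail_def[symmetric] btail_def[symmetric]
 proof (intro conjI allI impI)
  fix \<phi> and T \<delta> :: real assume h: "vertex_bundle c \<phi> \<and> uniform_bundle UNIV \<phi> \<and> 0 < T \<and> 0 < \<delta>"
  obtain r0 where r0: "\<And>x. depends_only_on (gball c x r0) (\<phi> x)" using h by (auto simp: vertex_bundle_def)
  obtain K :: nat where K: "\<And>x. (\<forall>\<eta>. \<bar>\<phi> x \<eta>\<bar> \<le> real K) \<and> (\<exists>A. finite A \<and> card A \<le> K \<and> depends_only_on A (\<phi> x))"
   using h by (auto simp: uniform_bundle_def)
  show "Limsup (at_right 0) (\<lambda>\<epsilon>. limsup (\<lambda>N.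
    SUP x\<in>{x \<in> V N. depends_only_on (V N) (\<phi> x)}. tail T \<delta> \<epsilon> N x (\<phi> x))) = -\<infinity>"
  proof -
   let ?Q = "\<lambda>N. (\<lambda>x. (x, \<phi> x)) ` {x \<in> V N. depends_only_on (V N) (\<phi> x)}"
   have Q: "fst q \<in> V N \<and> local_at K r0 N (fst q) (snd q)" if q: "q \<in> ?Q N" for N q
    using q by (elim imageE) (simp add: local_at_def K r0)
   show ?thesis
    using lim[of T \<delta> ?Q, OF _ _ Q] h by (simp add: image_image)
  qed
 next
  fix \<phi> and T \<delta> :: real
  assume h: "edge_bundle c \<phi> \<and> uniform_bundle (directed_edges c UNIV) \<phi> \<and> 0 < T \<and> 0 < \<delta>"
  obtain r0 where r0: "\<And>e. e \<in> directed_edges c UNIV \<Longrightarrow> depends_only_on (gball c (fst e) r0) (\<phi> e)"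
   using h by (auto simp: edge_bundle_def)
  obtain K :: nat where K: "\<And>e. e \<in> directed_edges c UNIV \<Longrightarrow>
    (\<forall>\<eta>. \<bar>\<phi> e \<eta>\<bar> \<le> real K) \<and> (\<exists>A. finite A \<and> card A \<le> K \<and> depends_only_on A (\<phi> e))"
   using h by (auto simp: uniform_bundle_def)
  have edge: "e \<in> directed_edges c UNIV" "fst e \<in> V N" if "e \<in> directed_edges c (V N)" for e N
   using that by (auto simp: directed_edges_def)
  show "Limsup (at_right 0) (\<lambda>\<epsilon>. limsup (\<lambda>N.
    SUP e\<in>{e \<in> directed_edges c (V N). depends_only_on (V N) (\<phi> e)}. tail T \<delta> \<epsilon> N (fst e) (\<phi> e))) = -\<infinity>"
  proof -
   let ?Q = "\<lambda>N. (\<lambda>e. (fst e, \<phi> e)) ` {e \<in> directed_edges c (V N). depends_only_on (V N) (\<phi> e)}"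
   have Q: "fst q \<in> V N \<and> local_at K r0 N (fst q) (snd q)" if q: "q \<in> ?Q N" for N q
    using q by (elim imageE) (simp add: local_at_def K r0 edge[of _ N])
   show ?thesis
    using lim[of T \<delta> ?Q, OF _ _ Q] h by (simp add: image_image)
  qed
 next
  fix T \<delta> :: real and G :: "real \<Rightarrow> real" assume h: "0 < T \<and> 0 < \<delta> \<and> continuous_on {0..T} G"
  show "limsup (\<lambda>N. SUP a\<in>bd N. btail T \<delta> G N a) = -\<infinity>"
  proof (rule ereal_bot, rule Limsup_bounded, rule eventually_mono[OF bdry[of T \<delta> G]])
  qed (use h in \<open>simp_all add: SUP_le_iff\<close>)
 qed
qed

end
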